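(* Aside from indexing of link components, the fundamental multivariate Alexander quandle $Q_A$ is a strictly stronger invariant of classical links than Crowell's link module sequence. Explicitly: (i) if $L$ and $L'$ are classical links with $Q_A(L)\cong Q_A(L')$ as quandles, then the components of $L$ and $L'$ can be re-indexed so that the resulting links are Crowell equivalent; (ii) there exist classical links $L$ and $L'$ that are Crowell equivalent but for which $Q_A(L)\not\cong Q_A(L')$.
   Context: Links are classical: oriented, tame, in $\mathbb{S}^3$, with indexed components. $\Lambda_\mu=\mathbb{Z}[t_1^{\pm1},\dots,t_\mu^{\pm1}]$ is the Laurent polynomial ring and $I_\mu$ is its ideal generated by $t_1-1,\dots,t_\mu-1$. Alexander module. Let $D$ be a diagram of $L=K_1\cup\dots\cup K_\mu$, with set of arcs $A(D)$ and set of crossings $C(D)$; $\kappa_D(a)=i$ means the arc $a$ belongs to the image of $K_i$. At a crossing $c$ let $a_{\mathrm{over}}$ be the overpassing arc, and let $a_{\mathrm{left}}$, $a_{\mathrm{right}}$ be the underpassing arcs lying to the left and to the right of $a_{\mathrm{over}}$ with respect to the orientation of $a_{\mathrm{over}}$. Let $\rho_D:\Lambda_\mu^{C(D)}\to\Lambda_\mu^{A(D)}$ be the $\Lambda_\mu$-linear map of free modules with $\rho_D(c)=(1-t_{\kappa_D(a_{\mathrm{left}})})a_{\mathrm{over}}+t_{\kappa_D(a_{\mathrm{over}})}a_{\mathrm{right}}-a_{\mathrm{left}}$. The Alexander module is $M_A(L)=\mathrm{coker}\,\rho_D$, with quotient map $\gamma_D:\Lambda_\mu^{A(D)}\to M_A(L)$,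 and the Crowell map $\phi_L:M_A(L)\to I_\mu$ is the $\Lambda_\mu$-linear map with $\phi_L(\gamma_D(a))=t_{\kappa_D(a)}-1$ for all $a\in A(D)$. The link module sequence of $L$ is the exact sequence $0\to\ker\phi_L\to M_A(L)\xrightarrow{\phi_L}I_\mu\to0$. Crowell equivalence. Two $\mu$-component links $L,L'$ are Crowell equivalent (equivalently, their link module sequences are equivalent) if there is a $\Lambda_\mu$-linear isomorphism $g:M_A(L)\to M_A(L')$ with $\phi_L=\phi_{L'}g$. Quandle. On $M_A(L)$ put $x\triangleright y=(\phi_L(y)+1)x-\phi_L(x)y$ and, whenever $\phi_L(y)+1$ is a unit of $\Lambda_\mu$, $x\triangleright^{-1}y=(\phi_L(y)+1)^{-1}(x+\phi_L(x)y)$. $Q_A(L)$ is the smallest subset of $M_A(L)$ that contains $\gamma_D(A(D))$ and is closed under $\triangleright,\triangleright^{-1}$. Up to isomorphism the triple $(M_A(L),\phi_L,Q_A(L))$ does not depend on $D$. A quandle isomorphism is a bijection preserving $\triangleright$ and $\triangleright^{-1}$. *)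

theory Defs
  imports
    "HOL-Analysis.Analysis"
    "HOL-Algebra.Module"
    "HOL-Algebra.AbelCoset"
    "HOL-Library.Poly_Mapping"
    "HOL-Combinatorics.Permutations"
begin

section \<open>Classical links\<close>

abbreviation S3 :: "((real^3) \<times> real) set"
  where "S3 \<equiv> sphere 0 1"

text \<open>Inverse stereographic projection, identifying \<open>\<real>\<^sup>3\<close> with \<open>S3\<close> minus a point.\<close>

definition inv_stereo :: "real^3 \<Rightarrow> (real^3) \<times> real"
  where "inv_stereo p =
    ((2 / ((norm p)\<^sup>2 + 1)) *\<^sub>R p, ((norm p)\<^sup>2 - 1) / ((norm p)\<^sup>2 + 1))"

text \<open>
  The components of an oriented link are indexed by their position in a list (so indices start
  at \<open>0\<close>) and oriented by their parametrization over \<open>[0,1]\<close>.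
\<close>

type_synonym link = "(real \<Rightarrow> (real^3) \<times> real) list"

definition oriented_link :: "link \<Rightarrow> bool"
  where "oriented_link L \<longleftrightarrow>
    L \<noteq> [] \<and>
    (\<forall>K\<in>set L. simple_path K \<and> pathfinish K = pathstart K \<and> path_image K \<subseteq> S3) \<and>
    (\<forall>i<length L. \<forall>j<length L. i \<noteq> j \<longrightarrow> path_image (L ! i) \<inter> path_image (L ! j) = {})"

text \<open>
  A closed polygon with \<open>n\<close> vertices is parametrized over the reals with period \<open>n\<close>; it is at
  its \<open>k\<close>-th vertex (cyclically) at the integer parameter \<open>k\<close>, and it is affine in between.
\<close>

type_synonym polygon = "(real^3) list"

definition vertex :: "polygon \<Rightarrow> int \<Rightarrow> real^3"
  where "vertex vs k = vs ! nat (k mod int (length vs))"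

definition polygon_at :: "polygon \<Rightarrow> real \<Rightarrow> real^3"
  where "polygon_at vs u =
    (1 - frac u) *\<^sub>R vertex vs \<lfloor>u\<rfloor> + frac u *\<^sub>R vertex vs (\<lfloor>u\<rfloor> + 1)"

text \<open>A position on a list of polygons: a component together with a parameter in one period.\<close>

type_synonym position = "nat \<times> real"

definition positions :: "polygon list \<Rightarrow> position set"
  where "positions P = {(i, u). i < length P \<and> 0 \<le> u \<and> u < real (length (P ! i))}"

definition point_at :: "polygon list \<Rightarrow> position \<Rightarrow> real^3"
  where "point_at P x = polygon_at (P ! fst x) (snd x)"

definition polygonal_link :: "polygon list \<Rightarrow> bool"
  where "polygonal_link P \<longleftrightarrow>
    P \<noteq> [] \<and> (\<forall>vs\<in>set P. 3 \<le> length vs) \<and> inj_on (point_at P) (positions P)"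

text \<open>
  Ambient isotopy in \<open>S3\<close> from a link to a polygonal link, respecting indices and orientations
  of components. The functions \<open>f\<close> are orientation-preserving reparametrizations of the circle.
\<close>

definition isotopic_to_polygons :: "link \<Rightarrow> polygon list \<Rightarrow> bool"
  where "isotopic_to_polygons L P \<longleftrightarrow>
    length P = length L \<and>
    (\<exists>H :: real \<Rightarrow> (real^3) \<times> real \<Rightarrow> (real^3) \<times> real.
      continuous_on ({0..1} \<times> S3) (\<lambda>(s, p). H s p) \<and>
      (\<forall>s\<in>{0..1}. \<exists>G. homeomorphism S3 S3 (H s) G) \<and>
      (\<forall>p\<in>S3. H 0 p = p) \<and>
      (\<forall>i<length L. \<exists>f :: real \<Rightarrow> real.
        continuous_on {0..1} f \<and> strict_mono_on {0..1} f \<and>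
        f 1 = f 0 + real (length (P ! i)) \<and>
        (\<forall>s\<in>{0..1}. H 1 ((L ! i) s) = inv_stereo (polygon_at (P ! i) (f s)))))"

definition classical_link :: "link \<Rightarrow> bool"
  where "classical_link L \<longleftrightarrow>
    oriented_link L \<and> (\<exists>P. polygonal_link P \<and> isotopic_to_polygons L P)"


section \<open>Diagrams\<close>

text \<open>
  Diagrams are polygonal links in regular position with respect to the projection to the first
  two coordinates; the third coordinate is the height. A crossing is a pair consisting of its
  over position and its under position.
\<close>

definition proj :: "real^3 \<Rightarrow> real \<times> real"
  where "proj p = (p $ 1, p $ 2)"

type_synonym crossing = "position \<times> position"

definition crossings :: "polygon list \<Rightarrow> crossing set"
  where "crossings P = {(x, y). x \<in> positions P \<and> y \<in> positions P \<and>
    proj (point_at P x) = proj (point_at P y) \<and> point_at P x $ 3 > point_at P y $ 3}"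

text \<open>
  Finitely many multiple points, all of which are double points, none being the image of a vertex
  (vertices are the integer parameters). Finiteness excludes vertical or overlapping edges, so the
  double points are transverse crossings of two edges.
\<close>

definition regular_position :: "polygon list \<Rightarrow> bool"
  where "regular_position P \<longleftrightarrow>
    finite (crossings P) \<and>
    (\<forall>x\<in>positions P. \<forall>y\<in>positions P. \<forall>z\<in>positions P.
      proj (point_at P x) = proj (point_at P y) \<and> proj (point_at P y) = proj (point_at P z)
        \<longrightarrow> x = y \<or> y = z \<or> x = z) \<and>
    (\<forall>(x, y)\<in>crossings P. snd x \<notin> \<int> \<and> snd y \<notin> \<int>)"

definition diagram_of :: "polygon list \<Rightarrow> link \<Rightarrow> bool"
  where "diagram_of D L \<longleftrightarrow>
    polygonal_link D \<and> regular_position D \<and> isotopic_to_polygons L D"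

text \<open>
  Arcs run from one under position of a component to the next one. An arc is represented by the
  under position at which it starts; a component without under positions is a single arc, which
  is represented by its position \<open>0\<close>. The function \<open>arc_at\<close> gives the arc through a position (at
  an under position: the outgoing arc), \<open>arc_before\<close> gives the arc arriving at a position.
\<close>

definition under_params :: "polygon list \<Rightarrow> nat \<Rightarrow> real set"
  where "under_params D i = {v. (i, v) \<in> snd ` crossings D}"

definition arc_at :: "polygon list \<Rightarrow> position \<Rightarrow> position"
  where "arc_at D = (\<lambda>(i, u). let V = under_params D i in
    if V = {} then (i, 0)
    else if \<exists>v\<in>V. v \<le> u then (i, Max {v\<in>V. v \<le> u})
    else (i, Max V))"

definition arc_before :: "polygon list \<Rightarrow> position \<Rightarrow> position"
  where "arc_before D = (\<lambda>(i, u). let V = under_params D i in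
    if V = {} then (i, 0)
    else if \<exists>v\<in>V. v < u then (i, Max {v\<in>V. v < u})
    else (i, Max V))"

definition arcs :: "polygon list \<Rightarrow> position set"
  where "arcs D = arc_at D ` positions D"

abbreviation arc_component :: "position \<Rightarrow> nat"
  where "arc_component a \<equiv> fst a"

text \<open>
  The edge direction at a position, projected to the plane. At a crossing the under strand passes
  from the right to the left of the over strand if and only if the determinant of the over
  direction and the under direction is positive.
\<close>

definition direction :: "polygon list \<Rightarrow> position \<Rightarrow> real \<times> real"
  where "direction D = (\<lambda>(i, u). proj (vertex (D ! i) (\<lfloor>u\<rfloor> + 1) - vertex (D ! i) \<lfloor>u\<rfloor>))"

definition under_right_to_left :: "polygon list \<Rightarrow> crossing \<Rightarrow> bool"
  where "under_right_to_left D = (\<lambda>(x, y).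
    fst (direction D x) * snd (direction D y) - snd (direction D x) * fst (direction D y) > 0)"

definition over_arc :: "polygon list \<Rightarrow> crossing \<Rightarrow> position"
  where "over_arc D c = arc_at D (fst c)"

definition left_arc :: "polygon list \<Rightarrow> crossing \<Rightarrow> position"
  where "left_arc D c =
    (if under_right_to_left D c then arc_at D (snd c) else arc_before D (snd c))"

definition right_arc :: "polygon list \<Rightarrow> crossing \<Rightarrow> position"
  where "right_arc D c =
    (if under_right_to_left D c then arc_before D (snd c) else arc_at D (snd c))"


section \<open>Laurent polynomials and modules\<close>

text \<open>
  A Laurent polynomial maps exponents, i.e. finitely supported functions from variable indices to
  integers, to coefficients; multiplication is convolution. Inside the ring in infinitely many
  variables \<open>tvar i\<close>, the ring in \<open>\<mu>\<close> variables involves only those with \<open>i < \<mu>\<close>.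
\<close>

type_synonym laurent = "(nat \<Rightarrow>\<^sub>0 int) \<Rightarrow>\<^sub>0 int"

definition tvar :: "nat \<Rightarrow> laurent"
  where "tvar i = Poly_Mapping.single (Poly_Mapping.single i 1) 1"

definition laurent_ring :: "nat \<Rightarrow> laurent ring"
  where "laurent_ring \<mu> =
    \<lparr>carrier = {p. \<forall>m\<in>Poly_Mapping.keys p. Poly_Mapping.keys m \<subseteq> {..<\<mu>}},
     mult = (*), one = 1, zero = 0, add = (+)\<rparr>"

text \<open>Module records inherit the ring fields, but \<open>mult\<close> and \<open>one\<close> have no meaning for modules.\<close>

definition free_module :: "laurent ring \<Rightarrow> 'x set \<Rightarrow> (laurent, 'x \<Rightarrow> laurent) module"
  where "free_module R X =
    \<lparr>carrier = {v. (\<forall>x\<in>X. v x \<in> carrier R) \<and> (\<forall>x. x \<notin> X \<longrightarrow> v x = 0)},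
     mult = undefined, one = undefined, zero = (\<lambda>_. 0), add = (\<lambda>v w x. v x + w x),
     smult = (\<lambda>r v x. r * v x)\<rparr>"

definition basis_vector :: "'x \<Rightarrow> 'x \<Rightarrow> laurent"
  where "basis_vector x = (\<lambda>y. if y = x then 1 else 0)"

definition quotient_module :: "('r, 'm) module \<Rightarrow> 'm set \<Rightarrow> ('r, 'm set) module"
  where "quotient_module M N =
    \<lparr>carrier = a_rcosets\<^bsub>M\<^esub> N,
     mult = undefined, one = undefined, zero = N, add = set_add M,
     smult = (\<lambda>r X. \<Union>x\<in>X. N +>\<^bsub>M\<^esub> (r \<odot>\<^bsub>M\<^esub> x))\<rparr>"

definition linear_iso ::
    "'r ring \<Rightarrow> ('r, 'm) module \<Rightarrow> ('r, 'n) module \<Rightarrow> ('m \<Rightarrow> 'n) \<Rightarrow> bool"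
  where "linear_iso R M N g \<longleftrightarrow>
    bij_betw g (carrier M) (carrier N) \<and>
    (\<forall>x\<in>carrier M. \<forall>y\<in>carrier M. g (x \<oplus>\<^bsub>M\<^esub> y) = g x \<oplus>\<^bsub>N\<^esub> g y) \<and>
    (\<forall>r\<in>carrier R. \<forall>x\<in>carrier M. g (r \<odot>\<^bsub>M\<^esub> x) = r \<odot>\<^bsub>N\<^esub> g x)"


section \<open>The Alexander module and the Crowell map\<close>

abbreviation \<Lambda> :: "polygon list \<Rightarrow> laurent ring"
  where "\<Lambda> D \<equiv> laurent_ring (length D)"

abbreviation arc_module :: "polygon list \<Rightarrow> (laurent, position \<Rightarrow> laurent) module"
  where "arc_module D \<equiv> free_module (\<Lambda> D) (arcs D)"

abbreviation crossing_module :: "polygon list \<Rightarrow> (laurent, crossing \<Rightarrow> laurent) module"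
  where "crossing_module D \<equiv> free_module (\<Lambda> D) (crossings D)"

definition crossing_relation :: "polygon list \<Rightarrow> crossing \<Rightarrow> position \<Rightarrow> laurent"
  where "crossing_relation D c = (\<lambda>a.
    (1 - tvar (arc_component (left_arc D c))) * basis_vector (over_arc D c) a
    + tvar (arc_component (over_arc D c)) * basis_vector (right_arc D c) a
    - basis_vector (left_arc D c) a)"

definition \<rho> :: "polygon list \<Rightarrow> (crossing \<Rightarrow> laurent) \<Rightarrow> position \<Rightarrow> laurent"
  where "\<rho> D w = (\<lambda>a. \<Sum>c\<in>crossings D. w c * crossing_relation D c a)"

definition alexander_module :: "polygon list \<Rightarrow> (laurent, (position \<Rightarrow> laurent) set) module"
  where "alexander_module D =
    quotient_module (arc_module D) (\<rho> D ` carrier (crossing_module D))"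

definition \<gamma> :: "polygon list \<Rightarrow> (position \<Rightarrow> laurent) \<Rightarrow> (position \<Rightarrow> laurent) set"
  where "\<gamma> D v = \<rho> D ` carrier (crossing_module D) +>\<^bsub>arc_module D\<^esub> v"

text \<open>
  The linear map on the free module that sends each arc \<open>a\<close> to \<open>tvar (arc_component a) - 1\<close> vanishes
  on the image of \<open>\<rho>\<close>, hence is constant on cosets; the Crowell map is the induced map.
\<close>

definition crowell_map :: "polygon list \<Rightarrow> (position \<Rightarrow> laurent) set \<Rightarrow> laurent" ("\<phi>")
  where "\<phi> D X = the_elem ((\<lambda>v. \<Sum>a\<in>arcs D. v a * (tvar (arc_component a) - 1)) ` X)"

definition crowell_equivalent :: "polygon list \<Rightarrow> polygon list \<Rightarrow> bool"
  where "crowell_equivalent D D' \<longleftrightarrow>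
    length D = length D' \<and>
    (\<exists>g. linear_iso (\<Lambda> D) (alexander_module D) (alexander_module D') g \<and>
      (\<forall>x\<in>carrier (alexander_module D). \<phi> D x = \<phi> D' (g x)))"


section \<open>The fundamental multivariate Alexander quandle\<close>

type_synonym alexander_element = "(position \<Rightarrow> laurent) set"

definition tri :: "polygon list \<Rightarrow> alexander_element \<Rightarrow> alexander_element \<Rightarrow> alexander_element"
  where "tri D x y =
    ((\<phi> D y + 1) \<odot>\<^bsub>alexander_module D\<^esub> x)
      \<ominus>\<^bsub>alexander_module D\<^esub> (\<phi> D x \<odot>\<^bsub>alexander_module D\<^esub> y)"

definition tri_inv :: "polygon list \<Rightarrow> alexander_element \<Rightarrow> alexander_element \<Rightarrow> alexander_element"
  where "tri_inv D x y =
    inv\<^bsub>\<Lambda> D\<^esub> (\<phi> D y + 1) \<odot>\<^bsub>alexander_module D\<^esub>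
      (x \<oplus>\<^bsub>alexander_module D\<^esub> (\<phi> D x \<odot>\<^bsub>alexander_module D\<^esub> y))"

inductive_set Q\<^sub>A :: "polygon list \<Rightarrow> alexander_element set"
  for D :: "polygon list"
  where
    arc: "a \<in> arcs D \<Longrightarrow> \<gamma> D (basis_vector a) \<in> Q\<^sub>A D"
  | tri: "x \<in> Q\<^sub>A D \<Longrightarrow> y \<in> Q\<^sub>A D \<Longrightarrow> tri D x y \<in> Q\<^sub>A D"
  | tri_inv: "x \<in> Q\<^sub>A D \<Longrightarrow> y \<in> Q\<^sub>A D \<Longrightarrow> \<phi> D y + 1 \<in> Units (\<Lambda> D) \<Longrightarrow>
      tri_inv D x y \<in> Q\<^sub>A D"

definition quandle_isomorphic :: "polygon list \<Rightarrow> polygon list \<Rightarrow> bool"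
  where "quandle_isomorphic D D' \<longleftrightarrow>
    (\<exists>f. bij_betw f (Q\<^sub>A D) (Q\<^sub>A D') \<and>
      (\<forall>x\<in>Q\<^sub>A D. \<forall>y\<in>Q\<^sub>A D. f (tri D x y) = tri D' (f x) (f y)) \<and>
      (\<forall>x\<in>Q\<^sub>A D. \<forall>y\<in>Q\<^sub>A D. f (tri_inv D x y) = tri_inv D' (f x) (f y)))"

end

theory Submission
  imports Defs
begin

text \<open>
  At a crossing, the relation of the Alexander module says that the meridian of the left arc is
  \<open>right \<triangleright> over\<close> (\<open>\<gamma>_left_arc\<close>). So the quandle contains the relations of the module as well as its
  generators, and a quandle homomorphism that is compatible with the Crowell maps extends to the
  modules (\<open>quandle_hom_extends\<close>). Compatibility is automatic up to names: walking along a component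
  one meets its arcs in one orbit of the quandle, and the operations do not change the value of the
  left argument under the Crowell map, so the orbits are the components (\<open>orbit_invariant\<close>). An
  isomorphism of quandles therefore permutes the components and extends to a map of modules that is
  linear up to the corresponding permutation of the variables. The inverse extends likewise, and
  re-indexing one of the links makes the maps linear (\<open>quandle_isomorphic_imp_crowell_equivalent\<close>).

  That the converse fails is due to the fact that the module sequence does not know which elements are
  meridians. Take a knot \<open>K\<close> and an unknotted circle \<open>U\<close> around two oppositely oriented strands of \<open>K\<close>
  next to a crossing. A full twist along the disc bounded by \<open>U\<close> changes the crossing and maps the
  complement of the link homeomorphically to that of the new link. As \<open>U\<close> and \<open>K\<close> have linking number
  \<open>0\<close>, the meridian of \<open>U\<close> changes by a longitude that is null-homologous, and the homeomorphism respects
  the module sequences (\<open>crowell_equivalent_trefoil_unknot\<close>). Here \<open>K\<close> is a trefoil before and an unknot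
  after the twist. The quandle sees the difference: forgetting \<open>U\<close>, it maps onto the colours of a
  nonconstant Fox 3-colouring of the trefoil, whereas both components of the second link are unknots
  and have only constant colourings (\<open>not_quandle_isomorphic_trefoil_unknot\<close>). In the proof, the
  homeomorphism appears only through its effect on meridians, which is checked against the crossing
  relations.

  The two links are polygons with integer vertices. Their crossings are found by an integer
  computation, which is correct by Cramer's rule (\<open>checked_diagram\<close>).
\<close>

section \<open>Laurent polynomials\<close>

definition evaluate :: "((nat \<Rightarrow>\<^sub>0 int) \<Rightarrow> 'r::comm_ring_1) \<Rightarrow> laurent \<Rightarrow> 'r"
  where "evaluate \<psi> p = (\<Sum>m\<in>Poly_Mapping.keys p. of_int (Poly_Mapping.lookup p m) * \<psi> m)"

lemma evaluate_eq_sum: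
  assumes "finite A" "Poly_Mapping.keys p \<subseteq> A"
  shows "evaluate \<psi> p = (\<Sum>m\<in>A. of_int (Poly_Mapping.lookup p m) * \<psi> m)"
  unfolding evaluate_def using assms
  by (intro sum.mono_neutral_left) (auto simp: in_keys_iff)

lemma evaluate_add: "evaluate \<psi> (p + q) = evaluate \<psi> p + evaluate \<psi> q"
proof -
  let ?A = "Poly_Mapping.keys p \<union> Poly_Mapping.keys q"
  have *: "evaluate \<psi> r = (\<Sum>m\<in>?A. of_int (Poly_Mapping.lookup r m) * \<psi> m)"
    if "Poly_Mapping.keys r \<subseteq> ?A" for r
    using that by (intro evaluate_eq_sum) auto
  show ?thesis
    by (simp add: * keys_add lookup_add sum.distrib ring_distribs)
qed

lemma evaluate_0 [simp]: "evaluate \<psi> 0 = 0"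
  by (simp add: evaluate_def)

lemma evaluate_single [simp]:
  "evaluate \<psi> (Poly_Mapping.single m k) = of_int k * \<psi> m"
  by (simp add: evaluate_def)

lemma evaluate_uminus: "evaluate \<psi> (- p) = - evaluate \<psi> p"
  using evaluate_add[of \<psi> p "- p"] by (simp add: eq_neg_iff_add_eq_0 add.commute)

lemma evaluate_diff: "evaluate \<psi> (p - q) = evaluate \<psi> p - evaluate \<psi> q"
  using evaluate_add[of \<psi> p "- q"] by (simp add: evaluate_uminus)

lemma evaluate_sum: "evaluate \<psi> (sum f A) = (\<Sum>a\<in>A. evaluate \<psi> (f a))"
  by (induction A rule: infinite_finite_induct) (auto simp: evaluate_add)

lemma sum_of_monomials:
  "p = (\<Sum>m\<in>Poly_Mapping.keys p. Poly_Mapping.single m (Poly_Mapping.lookup p m))"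
  by (rule poly_mapping_eqI) (simp add: lookup_sum lookup_single when_def in_keys_iff)

text \<open>
  A Laurent polynomial is a combination of monomials, so a character \<open>\<psi>\<close> of the group of exponents
  extends to a ring homomorphism. Both the renaming of variables and the substitution of \<open>1\<close> and
  \<open>-1\<close> for the variables arise in this way.
\<close>

lemma evaluate_mult:
  assumes "\<And>m n. \<psi> (m + n) = \<psi> m * \<psi> n"
  shows "evaluate \<psi> (p * q) = evaluate \<psi> p * evaluate \<psi> q"
proof -
  let ?s = "\<lambda>p m. Poly_Mapping.single m (Poly_Mapping.lookup p m)"
  have "p * q = (\<Sum>m\<in>Poly_Mapping.keys p. ?s p m) * (\<Sum>n\<in>Poly_Mapping.keys q. ?s q n)"
    by (simp flip: sum_of_monomials)
  also have "\<dots> = (\<Sum>m\<in>Poly_Mapping.keys p. \<Sum>n\<in>Poly_Mapping.keys q. ?s p m * ?s q n)"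
    by (simp add: sum_product)
  finally show ?thesis
    by (simp add: evaluate_sum mult_single assms evaluate_def[of \<psi> p] evaluate_def[of \<psi> q]
        sum_product mult_ac)
qed

lemma evaluate_1: "\<psi> 0 = 1 \<Longrightarrow> evaluate \<psi> 1 = 1"
  by (simp flip: single_one)

lemma evaluate_of_int: "\<psi> 0 = 1 \<Longrightarrow> evaluate \<psi> (of_int k) = of_int k"
  by (simp flip: single_of_int)

lemma evaluate_tvar: "evaluate \<psi> (tvar i) = \<psi> (Poly_Mapping.single i 1)"
  by (simp add: tvar_def)

lemma tvar_inject [simp]: "tvar i = tvar j \<longleftrightarrow> i = j"
proof
  assume "tvar i = tvar j"
  then have "Poly_Mapping.keys (tvar i) = Poly_Mapping.keys (tvar j)" by simp
  then have "Poly_Mapping.single i (1::int) = Poly_Mapping.single j 1"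
    by (simp add: tvar_def)
  then have "Poly_Mapping.keys (Poly_Mapping.single i (1::int)) = Poly_Mapping.keys (Poly_Mapping.single j (1::int))" by simp
  then show "i = j" by simp
qed simp

definition tvar_inverse :: "nat \<Rightarrow> laurent"
  where "tvar_inverse i = Poly_Mapping.single (Poly_Mapping.single i (- 1)) 1"

lemma tvar_mult_inverse [simp]: "tvar i * tvar_inverse i = 1" "tvar_inverse i * tvar i = 1"
  by (simp_all add: tvar_def tvar_inverse_def mult_single flip: single_add)

subsection \<open>The ring in finitely many variables\<close>

abbreviation scalars :: "nat \<Rightarrow> laurent set"
  where "scalars \<mu> \<equiv> carrier (laurent_ring \<mu>)"

lemma laurent_ring_simps [simp]:
  "x \<otimes>\<^bsub>laurent_ring \<mu>\<^esub> y = x * y" "x \<oplus>\<^bsub>laurent_ring \<mu>\<^esub> y = x + y"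
  "\<one>\<^bsub>laurent_ring \<mu>\<^esub> = 1" "\<zero>\<^bsub>laurent_ring \<mu>\<^esub> = 0"
  by (simp_all add: laurent_ring_def)

lemma scalars_iff: "p \<in> scalars \<mu> \<longleftrightarrow> (\<forall>m\<in>Poly_Mapping.keys p. Poly_Mapping.keys m \<subseteq> {..<\<mu>})"
  by (simp add: laurent_ring_def)

lemma scalars_0 [simp]: "0 \<in> scalars \<mu>"
  and scalars_1 [simp]: "1 \<in> scalars \<mu>"
  by (simp_all add: scalars_iff)

lemma scalars_add [simp]: "p \<in> scalars \<mu> \<Longrightarrow> q \<in> scalars \<mu> \<Longrightarrow> p + q \<in> scalars \<mu>"
  using keys_add[of p q] by (auto simp: scalars_iff)

lemma scalars_uminus [simp]: "p \<in> scalars \<mu> \<Longrightarrow> - p \<in> scalars \<mu>"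
  by (simp add: scalars_iff)

lemma scalars_diff [simp]: "p \<in> scalars \<mu> \<Longrightarrow> q \<in> scalars \<mu> \<Longrightarrow> p - q \<in> scalars \<mu>"
  using scalars_add[of p \<mu> "- q"] by simp

lemma scalars_mult [simp]: "p \<in> scalars \<mu> \<Longrightarrow> q \<in> scalars \<mu> \<Longrightarrow> p * q \<in> scalars \<mu>"
proof (unfold scalars_iff, intro ballI)
  fix m assume p: "\<forall>m\<in>Poly_Mapping.keys p. Poly_Mapping.keys m \<subseteq> {..<\<mu>}"
    and q: "\<forall>m\<in>Poly_Mapping.keys q. Poly_Mapping.keys m \<subseteq> {..<\<mu>}"
    and "m \<in> Poly_Mapping.keys (p * q)"
  then obtain a b where "m = a + b" "a \<in> Poly_Mapping.keys p" "b \<in> Poly_Mapping.keys q"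
    using keys_mult[of p q] by auto
  then show "Poly_Mapping.keys m \<subseteq> {..<\<mu>}"
    using p q keys_add[of a b] by blast
qed

lemma scalars_sum: "(\<And>a. a \<in> A \<Longrightarrow> f a \<in> scalars \<mu>) \<Longrightarrow> sum f A \<in> scalars \<mu>"
  by (induction A rule: infinite_finite_induct) auto

lemma scalars_tvar [simp]: "i < \<mu> \<Longrightarrow> tvar i \<in> scalars \<mu>"
  and scalars_tvar_inverse [simp]: "i < \<mu> \<Longrightarrow> tvar_inverse i \<in> scalars \<mu>"
  by (simp_all add: scalars_iff tvar_def tvar_inverse_def)

lemma comm_monoid_laurent_ring: "comm_monoid (laurent_ring \<mu>)"
  by (rule comm_monoidI) (auto simp: mult_ac)

lemma tvar_Units: "i < \<mu> \<Longrightarrow> tvar i \<in> Units (laurent_ring \<mu>)"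
  unfolding Units_def by (auto intro!: bexI[of _ "tvar_inverse i"])

lemma inv_tvar: "i < \<mu> \<Longrightarrow> inv\<^bsub>laurent_ring \<mu>\<^esub> (tvar i) = tvar_inverse i"
  by (rule comm_monoid.comm_inv_char[OF comm_monoid_laurent_ring]) auto

text \<open>
  All Laurent polynomials live in one type, so \<open>\<theta>\<close> is defined on polynomials in arbitrarily many
  variables; the numbers \<open>\<mu>\<close> and \<open>\<nu>\<close> enter only through the subrings of the two links.
\<close>

definition scalar_hom :: "nat \<Rightarrow> nat \<Rightarrow> (laurent \<Rightarrow> laurent) \<Rightarrow> bool"
  where "scalar_hom \<mu> \<nu> \<theta> \<longleftrightarrow>
    (\<forall>p q. \<theta> (p + q) = \<theta> p + \<theta> q) \<and> (\<forall>p q. \<theta> (p * q) = \<theta> p * \<theta> q) \<and> \<theta> 1 = 1 \<and>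
    \<theta> ` scalars \<mu> \<subseteq> scalars \<nu>"

lemma scalar_hom_id: "scalar_hom \<mu> \<mu> (\<lambda>p. p)"
  by (simp add: scalar_hom_def)

context
  fixes \<mu> \<nu> \<theta> assumes hom: "scalar_hom \<mu> \<nu> \<theta>"
begin

lemma scalar_hom_add: "\<theta> (p + q) = \<theta> p + \<theta> q"
  and scalar_hom_mult: "\<theta> (p * q) = \<theta> p * \<theta> q"
  and scalar_hom_1: "\<theta> 1 = 1"
  and scalar_hom_closed: "p \<in> scalars \<mu> \<Longrightarrow> \<theta> p \<in> scalars \<nu>"
  using hom by (auto simp: scalar_hom_def)

lemma scalar_hom_0: "\<theta> 0 = 0"
  using scalar_hom_add[of 0 0] by simp

lemma scalar_hom_uminus: "\<theta> (- p) = - \<theta> p"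
  using scalar_hom_add[of p "- p"] by (simp add: scalar_hom_0 eq_neg_iff_add_eq_0 add.commute)

lemma scalar_hom_diff: "\<theta> (p - q) = \<theta> p - \<theta> q"
  using scalar_hom_add[of p "- q"] by (simp add: scalar_hom_uminus)

lemma scalar_hom_sum: "\<theta> (sum f A) = (\<Sum>a\<in>A. \<theta> (f a))"
  by (induction A rule: infinite_finite_induct) (auto simp: scalar_hom_0 scalar_hom_add)

end

text \<open>
  Variable \<open>i\<close> becomes variable \<open>\<pi> i\<close>. An exponent is a function of the index of the variable, so it
  is composed with the inverse permutation.
\<close>

definition rename :: "(nat \<Rightarrow> nat) \<Rightarrow> laurent \<Rightarrow> laurent"
  where "rename \<pi> = evaluate (\<lambda>m. Poly_Mapping.single (Poly_Mapping.map_key (inv_into UNIV \<pi>) m) 1)"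

lemma lookup_map_key: "inj f \<Longrightarrow> Poly_Mapping.lookup (Poly_Mapping.map_key f p) k = Poly_Mapping.lookup p (f k)"
  by (simp add: map_key.rep_eq)

context
  fixes \<pi> :: "nat \<Rightarrow> nat" and \<mu> :: nat
  assumes \<pi>: "\<pi> permutes {..<\<mu>}"
begin

lemma inj_inv_permutation: "inj (inv_into UNIV \<pi>)"
  using \<pi> by (metis bij_imp_bij_inv bij_is_inj permutes_bij)

lemma rename_mult: "rename \<pi> (p * q) = rename \<pi> p * rename \<pi> q"
  unfolding rename_def
  by (rule evaluate_mult) (simp add: map_key_plus inj_inv_permutation mult_single)

lemma rename_tvar: "rename \<pi> (tvar i) = tvar (\<pi> i)"
proof -
  have "Poly_Mapping.map_key (inv_into UNIV \<pi>) (Poly_Mapping.single i (1::int)) = Poly_Mapping.single (\<pi> i) 1"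
    using map_key_single[OF inj_inv_permutation, of "\<pi> i" "1::int"] \<pi> by (simp add: permutes_inverses)
  then show ?thesis by (simp add: rename_def evaluate_tvar) (simp add: tvar_def)
qed

lemma scalar_hom_rename: "scalar_hom \<mu> \<mu> (rename \<pi>)"
  unfolding scalar_hom_def
proof (intro conjI allI)
  show "rename \<pi> 1 = 1"
    by (simp add: rename_def evaluate_1 map_key_zero inj_inv_permutation)
  show "rename \<pi> ` scalars \<mu> \<subseteq> scalars \<mu>"
  proof clarify
    fix p assume p: "p \<in> scalars \<mu>"
    have "Poly_Mapping.single (Poly_Mapping.map_key (inv_into UNIV \<pi>) m) k \<in> scalars \<mu>"
      if "m \<in> Poly_Mapping.keys p" for m and k :: int
    proof -
      have "Poly_Mapping.keys m \<subseteq> {..<\<mu>}" using p that by (auto simp: scalars_iff)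
      then have "Poly_Mapping.keys (Poly_Mapping.map_key (inv_into UNIV \<pi>) m) \<subseteq> {..<\<mu>}"
        unfolding keys_map_key[OF inj_inv_permutation]
        using \<pi> permutes_in_image[OF permutes_inv[OF \<pi>]] by blast
      then show ?thesis by (auto simp: scalars_iff)
    qed
    then show "rename \<pi> p \<in> scalars \<mu>"
      unfolding rename_def evaluate_def
      by (intro scalars_sum) (simp add: mult_single flip: single_of_int)
  qed
qed (auto simp: rename_def evaluate_add rename_mult[unfolded rename_def])

end

lemma rename_inverse:
  assumes "\<pi> permutes {..<\<mu>}" shows "rename (inv_into UNIV \<pi>) (rename \<pi> p) = p"
proof -
  have \<pi>: "inv_into UNIV \<pi> permutes {..<\<mu>}" using assms by (rule permutes_inv)
  have *: "Poly_Mapping.map_key (inv_into UNIV (inv_into UNIV \<pi>)) (Poly_Mapping.map_key (inv_into UNIV \<pi>) m) = m" for m :: "nat \<Rightarrow>\<^sub>0 int"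
    using inj_inv_permutation[OF assms] inj_inv_permutation[OF \<pi>] assms
    by (intro poly_mapping_eqI) (simp add: lookup_map_key permutes_inv_inv permutes_inverses)
  have "rename (inv_into UNIV \<pi>) (rename \<pi> p) = (\<Sum>m\<in>Poly_Mapping.keys p. of_int (Poly_Mapping.lookup p m) *
      rename (inv_into UNIV \<pi>) (Poly_Mapping.single (Poly_Mapping.map_key (inv_into UNIV \<pi>) m) 1))"
  proof -
    have of_int: "rename (inv_into UNIV \<pi>) (of_int k) = of_int k" for k
      by (simp add: rename_def evaluate_of_int map_key_zero inj_inv_permutation[OF \<pi>])
    show ?thesis
      by (subst (2) rename_def, subst evaluate_def)
        (simp only: scalar_hom_sum[OF scalar_hom_rename[OF \<pi>]] rename_mult[OF \<pi>] of_int)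
  qed
  also have "\<dots> = (\<Sum>m\<in>Poly_Mapping.keys p. Poly_Mapping.single m (Poly_Mapping.lookup p m))"
    by (intro sum.cong refl) (simp add: rename_def * mult_single flip: single_of_int)
  finally show ?thesis by (simp flip: sum_of_monomials)
qed

section \<open>The Alexander module as a quotient\<close>

abbreviation formal_sums :: "polygon list \<Rightarrow> (position \<Rightarrow> laurent) set"
  where "formal_sums D \<equiv> carrier (arc_module D)"

abbreviation relations :: "polygon list \<Rightarrow> (position \<Rightarrow> laurent) set"
  where "relations D \<equiv> \<rho> D ` carrier (crossing_module D)"

abbreviation elements :: "polygon list \<Rightarrow> alexander_element set"
  where "elements D \<equiv> carrier (alexander_module D)"

text \<open>
  The Crowell map before passing to the quotient. That it vanishes on the crossing relations rests on
  the left and the right arc of a crossing belonging to the same component.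
\<close>

definition augment :: "polygon list \<Rightarrow> (position \<Rightarrow> laurent) \<Rightarrow> laurent"
  where "augment D v = (\<Sum>a\<in>arcs D. v a * (tvar (arc_component a) - 1))"

lemma formal_sums_iff:
  "v \<in> formal_sums D \<longleftrightarrow> (\<forall>a\<in>arcs D. v a \<in> scalars (length D)) \<and> (\<forall>a. a \<notin> arcs D \<longrightarrow> v a = 0)"
  by (simp add: free_module_def)

lemma formal_sums_value: "v \<in> formal_sums D \<Longrightarrow> v a \<in> scalars (length D)"
  by (cases "a \<in> arcs D") (simp_all add: formal_sums_iff del: split_paired_All)

lemma formal_sums_0 [simp]: "(\<lambda>_. 0) \<in> formal_sums D"
  and formal_sums_add [simp]: "v \<in> formal_sums D \<Longrightarrow> w \<in> formal_sums D \<Longrightarrow> (\<lambda>a. v a + w a) \<in> formal_sums D"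
  and formal_sums_diff [simp]: "v \<in> formal_sums D \<Longrightarrow> w \<in> formal_sums D \<Longrightarrow> (\<lambda>a. v a - w a) \<in> formal_sums D"
  and formal_sums_scale [simp]: "r \<in> scalars (length D) \<Longrightarrow> v \<in> formal_sums D \<Longrightarrow> (\<lambda>a. r * v a) \<in> formal_sums D"
  by (auto simp: formal_sums_iff)

lemma formal_sums_sum:
  "(\<And>i. i \<in> A \<Longrightarrow> f i \<in> formal_sums D) \<Longrightarrow> (\<lambda>a. \<Sum>i\<in>A. f i a) \<in> formal_sums D"
  by (auto simp: formal_sums_iff intro!: scalars_sum sum.neutral)

lemma formal_sums_basis_vector [simp]: "a \<in> arcs D \<Longrightarrow> basis_vector a \<in> formal_sums D"
  by (auto simp: formal_sums_iff basis_vector_def)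

lemma arc_component_arc_at [simp]: "arc_component (arc_at D x) = fst x"
  and arc_component_arc_before [simp]: "arc_component (arc_before D x) = fst x"
  by (auto simp: arc_at_def arc_before_def Let_def split: prod.splits)

lemma arc_component_left_right: "arc_component (left_arc D c) = arc_component (right_arc D c)"
  by (simp add: left_arc_def right_arc_def)

lemma arc_component_less: "a \<in> arcs D \<Longrightarrow> arc_component a < length D"
  by (auto simp: arcs_def positions_def)

lemma arc_at_in_arcs: "x \<in> positions D \<Longrightarrow> arc_at D x \<in> arcs D"
  by (simp add: arcs_def)

lemma arc_at_under: "finite (under_params D i) \<Longrightarrow> v \<in> under_params D i \<Longrightarrow> arc_at D (i, v) = (i, v)"
  by (auto simp: arc_at_def Let_def intro!: Max_eqI)

lemma under_position: "v \<in> under_params D i \<Longrightarrow> (i, v) \<in> positions D"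
  by (auto simp: under_params_def crossings_def)

text \<open>
  With finitely many crossings there are finitely many arcs, so that the sums over crossings in \<open>\<rho>\<close>
  and over arcs in the Crowell map are what they should be (infinite sums would count as \<open>0\<close>).
\<close>

locale finite_diagram =
  fixes D :: "polygon list"
  assumes finite_crossings: "finite (crossings D)"
begin

lemma finite_under_params: "finite (under_params D i)"
proof -
  have "under_params D i \<subseteq> snd ` snd ` crossings D"
    by (force simp: under_params_def)
  then show ?thesis
    using finite_crossings by (meson finite_imageI finite_subset)
qed

lemma arc_at_cases:
  obtains v where "v \<in> under_params D i" "arc_at D (i, u) = (i, v)"
  | "under_params D i = {}" "arc_at D (i, u) = (i, 0)"
proof (cases "under_params D i = {}")
  case True
  then show ?thesis using that(2) by (simp add: arc_at_def)
next
  case False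
  define W where "W = (if \<exists>v\<in>under_params D i. v \<le> u then {v \<in> under_params D i. v \<le> u} else under_params D i)"
  have "finite W" "W \<noteq> {}" using False finite_under_params by (auto simp: W_def)
  then have "Max W \<in> W" by simp
  moreover have "arc_at D (i, u) = (i, Max W)" using False by (simp add: arc_at_def W_def Let_def)
  ultimately show ?thesis using that(1) by (auto simp: W_def split: if_splits)
qed

lemma arc_before_under:
  assumes "v \<in> under_params D i"
  obtains w where "w \<in> under_params D i" "arc_before D (i, v) = (i, w)"
proof -
  define W where "W = (if \<exists>w\<in>under_params D i. w < v then {w \<in> under_params D i. w < v} else under_params D i)"
  have "finite W" "W \<noteq> {}" using assms finite_under_params by (auto simp: W_def)
  then have "Max W \<in> W" by simp
  moreover have "arc_before D (i, v) = (i, Max W)" using assms by (auto simp: arc_before_def W_def Let_def)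
  ultimately show ?thesis using that by (auto simp: W_def split: if_splits)
qed

lemma finite_arcs: "finite (arcs D)"
proof -
  have "arcs D \<subseteq> snd ` crossings D \<union> (\<lambda>i. (i, 0)) ` {..<length D}"
  proof
    fix a assume "a \<in> arcs D"
    then obtain i u where "a = arc_at D (i, u)" "i < length D" by (auto simp: arcs_def positions_def)
    then show "a \<in> snd ` crossings D \<union> (\<lambda>i. (i, 0)) ` {..<length D}"
      by (cases rule: arc_at_cases[of i u]) (auto simp: under_params_def)
  qed
  then show ?thesis by (rule finite_subset) (simp add: finite_crossings)
qed

lemma under_arc: "v \<in> under_params D i \<Longrightarrow> (i, v) \<in> arcs D"
  by (metis arc_at_in_arcs arc_at_under finite_under_params under_position)

lemma crossing_arcs [simp]:
  assumes "c \<in> crossings D"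
  shows "over_arc D c \<in> arcs D" "left_arc D c \<in> arcs D" "right_arc D c \<in> arcs D"
proof -
  obtain x i v where c: "c = (x, (i, v))" by (metis surj_pair)
  have v: "v \<in> under_params D i" using assms by (force simp: under_params_def c)
  show "over_arc D c \<in> arcs D"
    using assms by (auto simp: over_arc_def crossings_def arc_at_in_arcs)
  have "arc_at D (i, v) \<in> arcs D" "arc_before D (i, v) \<in> arcs D"
    using arc_at_under[OF finite_under_params v] under_arc[OF v] arc_before_under[OF v] under_arc by metis+
  then show "left_arc D c \<in> arcs D" "right_arc D c \<in> arcs D"
    by (auto simp: left_arc_def right_arc_def c)
qed

lemma relations_0: "(\<lambda>_. 0) \<in> relations D"
  by (rule image_eqI[of _ _ "\<lambda>_. 0"]) (auto simp: \<rho>_def free_module_def)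

lemma relations_add: "v \<in> relations D \<Longrightarrow> w \<in> relations D \<Longrightarrow> (\<lambda>a. v a + w a) \<in> relations D"
proof (elim imageE)
  fix x y assume "v = \<rho> D x" "w = \<rho> D y" "x \<in> carrier (crossing_module D)" "y \<in> carrier (crossing_module D)"
  then show ?thesis
    by (intro image_eqI[of _ _ "\<lambda>c. x c + y c"])
      (auto simp: \<rho>_def free_module_def ring_distribs sum.distrib)
qed

lemma relations_scale: "r \<in> scalars (length D) \<Longrightarrow> v \<in> relations D \<Longrightarrow> (\<lambda>a. r * v a) \<in> relations D"
proof (elim imageE)
  fix x assume "r \<in> scalars (length D)" "v = \<rho> D x" "x \<in> carrier (crossing_module D)"
  then show ?thesis
    by (intro image_eqI[of _ _ "\<lambda>c. r * x c"])
      (auto simp: \<rho>_def free_module_def sum_distrib_left mult_ac)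
qed

lemma relations_uminus: "v \<in> relations D \<Longrightarrow> (\<lambda>a. - v a) \<in> relations D"
  using relations_scale[of "-1" v] by simp

lemma relations_diff: "v \<in> relations D \<Longrightarrow> w \<in> relations D \<Longrightarrow> (\<lambda>a. v a - w a) \<in> relations D"
  using relations_add[of v "\<lambda>a. - w a"] relations_uminus[of w] by simp

lemma crossing_relation_in_relations:
  assumes "c \<in> crossings D"
  shows "crossing_relation D c \<in> relations D"
proof (rule image_eqI)
  show "(\<lambda>c'. if c' = c then 1 else 0) \<in> carrier (crossing_module D)"
    using assms by (auto simp: free_module_def)
  show "crossing_relation D c = \<rho> D (\<lambda>c'. if c' = c then 1 else 0)"
    using assms finite_crossings by (auto simp: \<rho>_def if_distrib[of "\<lambda>x. x * _"] cong: if_cong)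
qed

lemma augment_add: "augment D (\<lambda>a. v a + w a) = augment D v + augment D w"
  and augment_diff: "augment D (\<lambda>a. v a - w a) = augment D v - augment D w"
  and augment_scale: "augment D (\<lambda>a. r * v a) = r * augment D v"
  by (simp_all add: augment_def ring_distribs sum.distrib sum_subtractf sum_distrib_left mult_ac)

lemma augment_basis_vector: "a \<in> arcs D \<Longrightarrow> augment D (basis_vector a) = tvar (arc_component a) - 1"
  using finite_arcs by (simp add: augment_def basis_vector_def if_distrib[of "\<lambda>x. x * _"] cong: if_cong)

lemma augment_in_scalars: "v \<in> formal_sums D \<Longrightarrow> augment D v \<in> scalars (length D)"
  unfolding augment_def
  by (intro scalars_sum scalars_mult scalars_diff scalars_tvar) (auto simp: formal_sums_value arc_component_less)

lemma augment_crossing_relation: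
  "c \<in> crossings D \<Longrightarrow> augment D (crossing_relation D c) = 0"
  unfolding crossing_relation_def augment_diff augment_add augment_scale
  by (simp add: augment_basis_vector arc_component_left_right algebra_simps)

lemma augment_relations: "v \<in> relations D \<Longrightarrow> augment D v = 0"
proof (elim imageE)
  fix w assume v: "v = \<rho> D w"
  have "augment D (\<rho> D w) = (\<Sum>c\<in>crossings D. w c * augment D (crossing_relation D c))"
    unfolding \<rho>_def augment_def
    by (simp add: sum_distrib_right sum_distrib_left mult_ac) (rule sum.swap)
  then show ?thesis by (simp add: v augment_crossing_relation)
qed

lemma \<gamma>_eq: "\<gamma> D v = {w. (\<lambda>a. w a - v a) \<in> relations D}"
proof -
  have "\<gamma> D v = {w. \<exists>n\<in>relations D. w = (\<lambda>a. n a + v a)}"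
    by (auto simp: \<gamma>_def a_r_coset_def' free_module_def)
  moreover have "(\<exists>n\<in>relations D. w = (\<lambda>a. n a + v a)) \<longleftrightarrow> (\<lambda>a. w a - v a) \<in> relations D" for w
  proof
    assume "(\<lambda>a. w a - v a) \<in> relations D"
    then show "\<exists>n\<in>relations D. w = (\<lambda>a. n a + v a)" by (rule bexI[rotated]) simp
  next
    assume "\<exists>n\<in>relations D. w = (\<lambda>a. n a + v a)"
    then obtain n where "n \<in> relations D" "w = (\<lambda>a. n a + v a)" by blast
    then show "(\<lambda>a. w a - v a) \<in> relations D" by simp
  qed
  ultimately show ?thesis by simp
qed

lemma \<gamma>_eq_iff: "\<gamma> D v = \<gamma> D w \<longleftrightarrow> (\<lambda>a. v a - w a) \<in> relations D"
proof
  assume "\<gamma> D v = \<gamma> D w"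
  moreover have "v \<in> \<gamma> D v" using relations_0 by (simp add: \<gamma>_eq)
  ultimately show "(\<lambda>a. v a - w a) \<in> relations D" by (simp add: \<gamma>_eq)
next
  assume vw: "(\<lambda>a. v a - w a) \<in> relations D"
  show "\<gamma> D v = \<gamma> D w"
  proof (intro Set.set_eqI iffI)
    fix x assume "x \<in> \<gamma> D v"
    then have "(\<lambda>a. (x a - v a) + (v a - w a)) \<in> relations D"
      using vw by (intro relations_add) (simp_all add: \<gamma>_eq)
    then show "x \<in> \<gamma> D w" by (simp add: \<gamma>_eq)
  next
    fix x assume "x \<in> \<gamma> D w"
    then have "(\<lambda>a. (x a - w a) - (v a - w a)) \<in> relations D"
      using vw by (rule_tac relations_diff) (simp_all add: \<gamma>_eq)
    then show "x \<in> \<gamma> D v" by (simp add: \<gamma>_eq)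
  qed
qed

lemma self_in_\<gamma>: "v \<in> \<gamma> D v"
  using relations_0 by (simp add: \<gamma>_eq)

lemma elements_eq: "elements D = \<gamma> D ` formal_sums D"
  by (auto simp: alexander_module_def quotient_module_def A_RCOSETS_def' \<gamma>_def)

lemma \<gamma>_in_elements: "v \<in> formal_sums D \<Longrightarrow> \<gamma> D v \<in> elements D"
  by (simp add: elements_eq)

lemma \<gamma>_add:
  assumes "v \<in> formal_sums D" "w \<in> formal_sums D"
  shows "\<gamma> D v \<oplus>\<^bsub>alexander_module D\<^esub> \<gamma> D w = \<gamma> D (\<lambda>a. v a + w a)"
proof -
  have "\<gamma> D v \<oplus>\<^bsub>alexander_module D\<^esub> \<gamma> D w = {\<lambda>a. x a + y a | x y. x \<in> \<gamma> D v \<and> y \<in> \<gamma> D w}"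
    by (auto simp: alexander_module_def quotient_module_def set_add_def' free_module_def)
  also have "\<dots> = \<gamma> D (\<lambda>a. v a + w a)"
  proof (intro Set.set_eqI iffI)
    fix z assume "z \<in> {\<lambda>a. x a + y a | x y. x \<in> \<gamma> D v \<and> y \<in> \<gamma> D w}"
    then obtain x y where z: "z = (\<lambda>a. x a + y a)" and "x \<in> \<gamma> D v" "y \<in> \<gamma> D w" by auto
    then have "(\<lambda>a. (x a - v a) + (y a - w a)) \<in> relations D"
      by (intro relations_add) (simp_all add: \<gamma>_eq)
    then show "z \<in> \<gamma> D (\<lambda>a. v a + w a)" by (simp add: \<gamma>_eq z algebra_simps)
  next
    fix z assume "z \<in> \<gamma> D (\<lambda>a. v a + w a)"
    then have "(\<lambda>a. z a - w a) \<in> \<gamma> D v" by (simp add: \<gamma>_eq algebra_simps)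
    then show "z \<in> {\<lambda>a. x a + y a | x y. x \<in> \<gamma> D v \<and> y \<in> \<gamma> D w}"
      using self_in_\<gamma>[of w] by force
  qed
  finally show ?thesis .
qed

lemma \<gamma>_scale:
  assumes "r \<in> scalars (length D)" "v \<in> formal_sums D"
  shows "r \<odot>\<^bsub>alexander_module D\<^esub> \<gamma> D v = \<gamma> D (\<lambda>a. r * v a)"
proof -
  have "r \<odot>\<^bsub>alexander_module D\<^esub> \<gamma> D v = (\<Union>x\<in>\<gamma> D v. \<gamma> D (\<lambda>a. r * x a))"
    by (simp add: alexander_module_def quotient_module_def \<gamma>_def)
      (simp add: free_module_def)
  also have "\<gamma> D (\<lambda>a. r * x a) = \<gamma> D (\<lambda>a. r * v a)" if "x \<in> \<gamma> D v" for x
    using relations_scale[OF assms(1), of "\<lambda>a. x a - v a"] that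
    by (simp add: \<gamma>_eq_iff) (simp add: \<gamma>_eq algebra_simps)
  then have "(\<Union>x\<in>\<gamma> D v. \<gamma> D (\<lambda>a. r * x a)) = \<gamma> D (\<lambda>a. r * v a)"
    using self_in_\<gamma>[of v] by blast
  finally show ?thesis .
qed

lemma zero_eq_\<gamma>: "\<zero>\<^bsub>alexander_module D\<^esub> = \<gamma> D (\<lambda>_. 0)"
  by (simp add: alexander_module_def quotient_module_def \<gamma>_eq)

lemma abelian_group_alexander_module: "abelian_group (alexander_module D)"
proof (rule abelian_groupI)
  fix x assume "x \<in> elements D"
  then obtain v where v: "v \<in> formal_sums D" "x = \<gamma> D v" by (auto simp: elements_eq)
  have "(\<lambda>a. - v a) \<in> formal_sums D" using v formal_sums_diff[OF formal_sums_0 v(1)] by simp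
  then show "\<exists>y\<in>elements D. y \<oplus>\<^bsub>alexander_module D\<^esub> x = \<zero>\<^bsub>alexander_module D\<^esub>"
    using v by (intro bexI[of _ "\<gamma> D (\<lambda>a. - v a)"]) (simp_all add: \<gamma>_add zero_eq_\<gamma> elements_eq)
qed (auto simp: elements_eq \<gamma>_add zero_eq_\<gamma> ac_simps)

lemma \<gamma>_diff:
  assumes "v \<in> formal_sums D" "w \<in> formal_sums D"
  shows "\<gamma> D v \<ominus>\<^bsub>alexander_module D\<^esub> \<gamma> D w = \<gamma> D (\<lambda>a. v a - w a)"
proof -
  have w: "(\<lambda>a. - w a) \<in> formal_sums D" using formal_sums_diff[OF formal_sums_0 assms(2)] by simp
  have "\<ominus>\<^bsub>alexander_module D\<^esub> \<gamma> D w = \<gamma> D (\<lambda>a. - w a)"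
    using assms w
    by (intro abelian_group.minus_equality[OF abelian_group_alexander_module])
      (simp_all add: \<gamma>_add zero_eq_\<gamma> \<gamma>_in_elements)
  then show ?thesis using assms w by (simp add: a_minus_def \<gamma>_add)
qed

lemma \<phi>_\<gamma>: "\<phi> D (\<gamma> D v) = augment D v"
proof -
  have "augment D w = augment D v" if "w \<in> \<gamma> D v" for w
    using augment_relations[of "\<lambda>a. w a - v a"] that by (simp add: \<gamma>_eq augment_diff)
  then have "augment D ` \<gamma> D v = (\<lambda>_. augment D v) ` \<gamma> D v"
    by (rule image_cong[OF refl])
  then have *: "augment D ` \<gamma> D v = {augment D v}"
    by (simp only: image_constant[OF self_in_\<gamma>])
  have "augment D = (\<lambda>v. \<Sum>a\<in>arcs D. v a * (tvar (arc_component a) - 1))"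
    by (rule ext) (rule augment_def)
  then have "\<phi> D (\<gamma> D v) = the_elem (augment D ` \<gamma> D v)"
    by (simp only: crowell_map_def)
  then show ?thesis by (simp only: * the_elem_eq)
qed

lemma \<phi>_in_scalars: "x \<in> elements D \<Longrightarrow> \<phi> D x \<in> scalars (length D)"
  by (auto simp: elements_eq \<phi>_\<gamma> augment_in_scalars)

lemma tri_\<gamma>:
  assumes "v \<in> formal_sums D" "w \<in> formal_sums D"
  shows "tri D (\<gamma> D v) (\<gamma> D w) = \<gamma> D (\<lambda>a. (augment D w + 1) * v a - augment D v * w a)"
  unfolding tri_def using assms by (simp add: \<phi>_\<gamma> augment_in_scalars \<gamma>_scale \<gamma>_diff)

text \<open>
  Solved for the left arc, the crossing relation expresses it through the quandle operation.
\<close>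

lemma \<gamma>_left_arc:
  assumes "c \<in> crossings D"
  shows "\<gamma> D (basis_vector (left_arc D c)) =
    tri D (\<gamma> D (basis_vector (right_arc D c))) (\<gamma> D (basis_vector (over_arc D c)))"
proof -
  have "(\<lambda>a. - crossing_relation D c a) \<in> relations D"
    by (intro relations_uminus crossing_relation_in_relations assms)
  then show ?thesis
    using assms by (simp add: tri_\<gamma> augment_basis_vector \<gamma>_eq_iff)
      (simp add: crossing_relation_def arc_component_left_right algebra_simps)
qed

end

subsection \<open>Semilinear maps\<close>

text \<open>
  A quandle isomorphism can permute the components, hence the variables. The maps of modules that it
  induces are therefore linear only along a homomorphism \<open>\<theta>\<close> of the rings of scalars.
\<close>

definition semilinear :: "polygon list \<Rightarrow> polygon list \<Rightarrow> (laurent \<Rightarrow> laurent) \<Rightarrow>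
    (alexander_element \<Rightarrow> alexander_element) \<Rightarrow> bool"
  where "semilinear D D' \<theta> g \<longleftrightarrow>
    (\<forall>x\<in>elements D. g x \<in> elements D') \<and>
    (\<forall>x\<in>elements D. \<forall>y\<in>elements D. g (x \<oplus>\<^bsub>alexander_module D\<^esub> y) = g x \<oplus>\<^bsub>alexander_module D'\<^esub> g y) \<and>
    (\<forall>r\<in>scalars (length D). \<forall>x\<in>elements D. g (r \<odot>\<^bsub>alexander_module D\<^esub> x) = \<theta> r \<odot>\<^bsub>alexander_module D'\<^esub> g x)"

abbreviation meridian :: "polygon list \<Rightarrow> position \<Rightarrow> alexander_element"
  where "meridian D a \<equiv> \<gamma> D (basis_vector a)"

context
  fixes D D' :: "polygon list" and \<theta> :: "laurent \<Rightarrow> laurent"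
  assumes D: "finite_diagram D" and D': "finite_diagram D'"
    and \<theta>: "scalar_hom (length D) (length D') \<theta>"
begin

interpretation D: finite_diagram D by (rule D)
interpretation D': finite_diagram D' by (rule D')

lemma semilinear_0: "semilinear D D' \<theta> g \<Longrightarrow> g (\<gamma> D (\<lambda>_. 0)) = \<gamma> D' (\<lambda>_. 0)"
proof -
  assume g: "semilinear D D' \<theta> g"
  have 0: "\<gamma> D (\<lambda>_. 0) \<in> elements D" by (simp add: D.\<gamma>_in_elements)
  then obtain v where v: "v \<in> formal_sums D'" "g (\<gamma> D (\<lambda>_. 0)) = \<gamma> D' v"
    using g by (auto simp: semilinear_def D'.elements_eq)
  have "g (0 \<odot>\<^bsub>alexander_module D\<^esub> \<gamma> D (\<lambda>_. 0)) = \<theta> 0 \<odot>\<^bsub>alexander_module D'\<^esub> g (\<gamma> D (\<lambda>_. 0))"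
    using g 0 by (simp add: semilinear_def)
  then show ?thesis using v by (simp add: D.\<gamma>_scale D'.\<gamma>_scale scalar_hom_0[OF \<theta>])
qed

text \<open>
  The meridians generate the Alexander module.
\<close>

lemma semilinear_eqI:
  assumes g: "semilinear D D' \<theta> g" and h: "semilinear D D' \<theta> h"
    and eq: "\<And>a. a \<in> arcs D \<Longrightarrow> g (meridian D a) = h (meridian D a)"
    and "x \<in> elements D"
  shows "g x = h x"
proof -
  obtain v where v: "v \<in> formal_sums D" "x = \<gamma> D v" using \<open>x \<in> elements D\<close> by (auto simp: D.elements_eq)
  have "g (\<gamma> D (\<lambda>b. \<Sum>a\<in>A. v a * basis_vector a b)) = h (\<gamma> D (\<lambda>b. \<Sum>a\<in>A. v a * basis_vector a b))"
    if "finite A" "A \<subseteq> arcs D" for A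
    using that
  proof (induction A rule: finite_induct)
    case empty
    then show ?case using semilinear_0[OF g] semilinear_0[OF h] by simp
  next
    case (insert a A)
    have a: "a \<in> arcs D" "A \<subseteq> arcs D" using insert by auto
    have A: "(\<lambda>b. \<Sum>a\<in>A. v a * basis_vector a b) \<in> formal_sums D"
      using v a by (intro formal_sums_sum formal_sums_scale) (auto simp: formal_sums_value)
    have step: "f (\<gamma> D (\<lambda>b. \<Sum>a\<in>insert a A. v a * basis_vector a b)) =
      \<theta> (v a) \<odot>\<^bsub>alexander_module D'\<^esub> f (meridian D a) \<oplus>\<^bsub>alexander_module D'\<^esub>
      f (\<gamma> D (\<lambda>b. \<Sum>a\<in>A. v a * basis_vector a b))"
      if f: "semilinear D D' \<theta> f" for f
    proof -
      have "\<gamma> D (\<lambda>b. \<Sum>a\<in>insert a A. v a * basis_vector a b) =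
        v a \<odot>\<^bsub>alexander_module D\<^esub> meridian D a \<oplus>\<^bsub>alexander_module D\<^esub> \<gamma> D (\<lambda>b. \<Sum>a\<in>A. v a * basis_vector a b)"
        using insert(1,2) A a v(1) by (simp add: D.\<gamma>_scale D.\<gamma>_add formal_sums_value)
      moreover have "v a \<odot>\<^bsub>alexander_module D\<^esub> meridian D a \<in> elements D"
        using a v(1) by (simp add: D.\<gamma>_scale D.\<gamma>_in_elements formal_sums_value)
      ultimately show ?thesis
        using f a v(1) A by (simp add: semilinear_def D.\<gamma>_in_elements formal_sums_value)
    qed
    show ?case unfolding step[OF g] step[OF h] using insert(3) a eq by simp
  qed
  from this[OF D.finite_arcs] have "g (\<gamma> D (\<lambda>b. \<Sum>a\<in>arcs D. v a * basis_vector a b)) =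
    h (\<gamma> D (\<lambda>b. \<Sum>a\<in>arcs D. v a * basis_vector a b))" by simp
  moreover have "(\<lambda>b. \<Sum>a\<in>arcs D. v a * basis_vector a b) = v"
    using D.finite_arcs v(1) by (auto simp: basis_vector_def formal_sums_iff if_distrib cong: if_cong)
  ultimately show ?thesis using v by simp
qed

lemma semilinear_\<phi>:
  assumes g: "semilinear D D' \<theta> g"
    and \<phi>: "\<And>a. a \<in> arcs D \<Longrightarrow> \<phi> D' (g (meridian D a)) = \<theta> (tvar (arc_component a) - 1)"
    and "x \<in> elements D"
  shows "\<phi> D' (g x) = \<theta> (\<phi> D x)"
proof -
  obtain v where v: "v \<in> formal_sums D" "x = \<gamma> D v" using \<open>x \<in> elements D\<close> by (auto simp: D.elements_eq)
  have "\<phi> D' (g (\<gamma> D (\<lambda>b. \<Sum>a\<in>A. v a * basis_vector a b))) =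
      (\<Sum>a\<in>A. \<theta> (v a * (tvar (arc_component a) - 1)))"
    if "finite A" "A \<subseteq> arcs D" for A
    using that
  proof (induction A rule: finite_induct)
    case empty
    then show ?case using semilinear_0[OF g] by (simp add: D'.\<phi>_\<gamma> augment_def)
  next
    case (insert a A)
    have a: "a \<in> arcs D" "A \<subseteq> arcs D" using insert by auto
    have A: "(\<lambda>b. \<Sum>a\<in>A. v a * basis_vector a b) \<in> formal_sums D"
      using v a by (intro formal_sums_sum formal_sums_scale) (auto simp: formal_sums_value)
    obtain w where w: "w \<in> formal_sums D'" "g (meridian D a) = \<gamma> D' w"
      using g D.\<gamma>_in_elements[of "basis_vector a"] a by (auto simp: semilinear_def D'.elements_eq)
    obtain u where u: "u \<in> formal_sums D'" "g (\<gamma> D (\<lambda>b. \<Sum>a\<in>A. v a * basis_vector a b)) = \<gamma> D' u"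
      using g D.\<gamma>_in_elements[OF A] by (auto simp: semilinear_def D'.elements_eq)
    have "\<gamma> D (\<lambda>b. \<Sum>a\<in>insert a A. v a * basis_vector a b) =
      v a \<odot>\<^bsub>alexander_module D\<^esub> meridian D a \<oplus>\<^bsub>alexander_module D\<^esub> \<gamma> D (\<lambda>b. \<Sum>a\<in>A. v a * basis_vector a b)"
      using insert(1,2) A a v(1) by (simp add: D.\<gamma>_scale D.\<gamma>_add formal_sums_value)
    moreover have "v a \<odot>\<^bsub>alexander_module D\<^esub> meridian D a \<in> elements D"
      using a v(1) by (simp add: D.\<gamma>_scale D.\<gamma>_in_elements formal_sums_value)
    ultimately have "g (\<gamma> D (\<lambda>b. \<Sum>a\<in>insert a A. v a * basis_vector a b)) =
      \<gamma> D' (\<lambda>b. \<theta> (v a) * w b + u b)"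
      using g a v(1) A u w
      by (simp add: semilinear_def D.\<gamma>_in_elements formal_sums_value D'.\<gamma>_scale D'.\<gamma>_add scalar_hom_closed[OF \<theta>])
    moreover have "augment D' w = \<theta> (tvar (arc_component a) - 1)"
      using \<phi>[OF a(1)] w by (simp add: D'.\<phi>_\<gamma>)
    ultimately show ?case
      using insert u by (simp add: D'.\<phi>_\<gamma> D'.augment_add D'.augment_scale scalar_hom_mult[OF \<theta>])
  qed
  from this[OF D.finite_arcs] have "\<phi> D' (g (\<gamma> D (\<lambda>b. \<Sum>a\<in>arcs D. v a * basis_vector a b))) =
    \<theta> (augment D v)" by (simp add: augment_def scalar_hom_sum[OF \<theta>])
  moreover have "(\<lambda>b. \<Sum>a\<in>arcs D. v a * basis_vector a b) = v"
    using D.finite_arcs v(1) by (auto simp: basis_vector_def formal_sums_iff if_distrib cong: if_cong)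
  ultimately show ?thesis using v by (simp add: D.\<phi>_\<gamma>)
qed

text \<open>
  A map of modules is the same as a choice of values for the arcs that satisfies the crossing
  relations.
\<close>

lemma semilinear_extension_formal_sums:
  assumes \<psi>: "\<And>a. a \<in> arcs D \<Longrightarrow> \<psi> a \<in> formal_sums D'"
    and crossing: "\<And>c. c \<in> crossings D \<Longrightarrow>
      (\<lambda>b. (1 - \<theta> (tvar (arc_component (left_arc D c)))) * \<psi> (over_arc D c) b +
        \<theta> (tvar (arc_component (over_arc D c))) * \<psi> (right_arc D c) b - \<psi> (left_arc D c) b) \<in> relations D'"
  obtains g where "semilinear D D' \<theta> g"
    "\<And>v. v \<in> formal_sums D \<Longrightarrow> g (\<gamma> D v) = \<gamma> D' (\<lambda>b. \<Sum>a\<in>arcs D. \<theta> (v a) * \<psi> a b)"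
    "\<And>a. a \<in> arcs D \<Longrightarrow> g (meridian D a) = \<gamma> D' (\<psi> a)"
proof -
  define e where "e v b = (\<Sum>a\<in>arcs D. \<theta> (v a) * \<psi> a b)" for v b
  have e_formal_sums: "e v \<in> formal_sums D'" if "v \<in> formal_sums D" for v
    unfolding e_def[abs_def] using that
    by (intro formal_sums_sum formal_sums_scale \<psi>) (auto simp: formal_sums_value scalar_hom_closed[OF \<theta>])
  have e_add: "e (\<lambda>a. v a + w a) = (\<lambda>b. e v b + e w b)" for v w
    by (rule ext) (simp add: e_def scalar_hom_add[OF \<theta>] ring_distribs sum.distrib)
  have e_diff: "e (\<lambda>a. v a - w a) = (\<lambda>b. e v b - e w b)" for v w
    by (rule ext) (simp add: e_def scalar_hom_diff[OF \<theta>] ring_distribs sum_subtractf)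
  have e_scale: "e (\<lambda>a. r * v a) = (\<lambda>b. \<theta> r * e v b)" for r v
    by (rule ext) (simp add: e_def scalar_hom_mult[OF \<theta>] sum_distrib_left mult_ac)
  have e_basis: "e (basis_vector a) = \<psi> a" if "a \<in> arcs D" for a
    using that D.finite_arcs
    by (auto simp: e_def basis_vector_def if_distrib[of \<theta>] if_distrib[of "\<lambda>x. x * _"]
        scalar_hom_0[OF \<theta>] scalar_hom_1[OF \<theta>] cong: if_cong)
  have e_crossing: "e (crossing_relation D c) \<in> relations D'" if c: "c \<in> crossings D" for c
  proof -
    have "e (crossing_relation D c) = (\<lambda>b. (1 - \<theta> (tvar (arc_component (left_arc D c)))) * \<psi> (over_arc D c) b +
        \<theta> (tvar (arc_component (over_arc D c))) * \<psi> (right_arc D c) b - \<psi> (left_arc D c) b)"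
      using c unfolding crossing_relation_def e_diff e_add e_scale
      by (simp add: e_basis scalar_hom_diff[OF \<theta>] scalar_hom_1[OF \<theta>])
    then show ?thesis using crossing[OF c] by simp
  qed
  have e_relations: "e v \<in> relations D'" if "v \<in> relations D" for v
  proof -
    obtain w where w: "w \<in> carrier (crossing_module D)" and v: "v = \<rho> D w" using \<open>v \<in> relations D\<close> by auto
    have "e (\<lambda>b. \<Sum>c\<in>C. w c * crossing_relation D c b) \<in> relations D'" if "finite C" "C \<subseteq> crossings D" for C
      using that
    proof (induction C rule: finite_induct)
      case empty
      then show ?case using D'.relations_0 by (simp add: e_def[abs_def] scalar_hom_0[OF \<theta>])
    next
      case (insert c C)
      have "\<theta> (w c) \<in> scalars (length D')"
        using w insert by (auto simp: free_module_def scalar_hom_closed[OF \<theta>])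
      then show ?case
        using insert e_crossing[of c] by (simp add: e_add e_scale D'.relations_add D'.relations_scale)
    qed
    from this[OF D.finite_crossings] show ?thesis by (simp add: v \<rho>_def[abs_def])
  qed
  define g where "g x = \<gamma> D' (e (SOME v. v \<in> x))" for x
  have g: "g (\<gamma> D v) = \<gamma> D' (e v)" if "v \<in> formal_sums D" for v
  proof -
    have "(SOME w. w \<in> \<gamma> D v) \<in> \<gamma> D v" by (rule someI[of _ v]) (rule D.self_in_\<gamma>)
    then have "(\<lambda>a. (SOME w. w \<in> \<gamma> D v) a - v a) \<in> relations D" by (simp add: D.\<gamma>_eq)
    then have "e (\<lambda>a. (SOME w. w \<in> \<gamma> D v) a - v a) \<in> relations D'" by (rule e_relations)
    then show ?thesis by (simp add: g_def D'.\<gamma>_eq_iff e_diff)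
  qed
  show ?thesis
  proof
    show "semilinear D D' \<theta> g"
      by (auto simp: semilinear_def D.elements_eq g e_formal_sums D.\<gamma>_add D.\<gamma>_scale D'.\<gamma>_add D'.\<gamma>_scale
          D'.\<gamma>_in_elements e_add e_scale scalar_hom_closed[OF \<theta>])
    show "g (\<gamma> D v) = \<gamma> D' (\<lambda>b. \<Sum>a\<in>arcs D. \<theta> (v a) * \<psi> a b)" if "v \<in> formal_sums D" for v
      using g[OF that] by (simp add: e_def[abs_def])
    show "g (meridian D a) = \<gamma> D' (\<psi> a)" if "a \<in> arcs D" for a
      using that by (simp add: g e_basis)
  qed
qed

text \<open>
  The crossing relations say exactly that \<open>left = right \<triangleright> over\<close>. So, for values with the right images
  under the Crowell map, they can be checked in terms of the quandle operation.
\<close>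

lemma semilinear_extension:
  assumes m: "\<And>a. a \<in> arcs D \<Longrightarrow> m a \<in> elements D'"
    and m\<phi>: "\<And>a. a \<in> arcs D \<Longrightarrow> \<phi> D' (m a) = \<theta> (tvar (arc_component a) - 1)"
    and crossing: "\<And>c. c \<in> crossings D \<Longrightarrow>
      m (left_arc D c) = tri D' (m (right_arc D c)) (m (over_arc D c))"
  obtains g where "semilinear D D' \<theta> g" "\<And>a. a \<in> arcs D \<Longrightarrow> g (meridian D a) = m a"
proof -
  have "\<forall>a\<in>arcs D. \<exists>w. w \<in> formal_sums D' \<and> m a = \<gamma> D' w"
    using m unfolding D'.elements_eq by blast
  then obtain \<psi> where \<psi>: "\<And>a. a \<in> arcs D \<Longrightarrow> \<psi> a \<in> formal_sums D'" "\<And>a. a \<in> arcs D \<Longrightarrow> m a = \<gamma> D' (\<psi> a)"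
    by metis
  have rel: "(\<lambda>b. (1 - \<theta> (tvar (arc_component (left_arc D c)))) * \<psi> (over_arc D c) b +
        \<theta> (tvar (arc_component (over_arc D c))) * \<psi> (right_arc D c) b - \<psi> (left_arc D c) b) \<in> relations D'"
    if c: "c \<in> crossings D" for c
  proof -
    let ?l = "left_arc D c" and ?r = "right_arc D c" and ?o = "over_arc D c"
    have aug: "augment D' (\<psi> a) = \<theta> (tvar (arc_component a)) - 1" if "a \<in> arcs D" for a
      using m\<phi>[OF that] \<psi>[OF that] by (simp add: D'.\<phi>_\<gamma> scalar_hom_diff[OF \<theta>] scalar_hom_1[OF \<theta>])
    have "\<gamma> D' (\<lambda>b. \<theta> (tvar (arc_component ?o)) * \<psi> ?r b - (\<theta> (tvar (arc_component ?r)) - 1) * \<psi> ?o b) = \<gamma> D' (\<psi> ?l)"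
      using crossing[OF c] c by (simp add: \<psi> D'.tri_\<gamma> aug)
    then have "(\<lambda>b. (\<theta> (tvar (arc_component ?o)) * \<psi> ?r b - (\<theta> (tvar (arc_component ?r)) - 1) * \<psi> ?o b) - \<psi> ?l b)
      \<in> relations D'"
      unfolding D'.\<gamma>_eq_iff .
    then show ?thesis by (simp add: arc_component_left_right algebra_simps)
  qed
  show ?thesis
    by (rule semilinear_extension_formal_sums[of \<psi>, OF \<psi>(1) rel]) (use that \<psi>(2) in auto)
qed

end

lemma semilinear_compose:
  assumes "semilinear D D' \<theta> g" "semilinear D' D'' \<theta>' h" "scalar_hom (length D) (length D') \<theta>"
  shows "semilinear D D'' (\<lambda>p. \<theta>' (\<theta> p)) (\<lambda>x. h (g x))"
  using assms by (auto simp: semilinear_def scalar_hom_closed)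

lemma semilinear_id: "semilinear D D (\<lambda>p. p) (\<lambda>x. x)"
  by (simp add: semilinear_def)

section \<open>The fundamental multivariate Alexander quandle\<close>

text \<open>
  The Crowell map sends the meridians of component \<open>i\<close> to \<open>tvar i - 1\<close>, and the quandle operations do
  not change the value of the left argument. So this value says to which component an element of the
  quandle belongs.
\<close>

definition component :: "polygon list \<Rightarrow> alexander_element \<Rightarrow> nat"
  where "component D x = (THE i. \<phi> D x = tvar i - 1)"

lemma component_eqI: "\<phi> D x = tvar i - 1 \<Longrightarrow> component D x = i"
  unfolding component_def by (rule the_equality) auto

context finite_diagram
begin

lemma elements_add [simp]: "x \<in> elements D \<Longrightarrow> y \<in> elements D \<Longrightarrow> x \<oplus>\<^bsub>alexander_module D\<^esub> y \<in> elements D"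
  and elements_scale [simp]: "r \<in> scalars (length D) \<Longrightarrow> x \<in> elements D \<Longrightarrow> r \<odot>\<^bsub>alexander_module D\<^esub> x \<in> elements D"
  by (auto simp: elements_eq \<gamma>_add \<gamma>_scale)

lemma \<phi>_add: "x \<in> elements D \<Longrightarrow> y \<in> elements D \<Longrightarrow> \<phi> D (x \<oplus>\<^bsub>alexander_module D\<^esub> y) = \<phi> D x + \<phi> D y"
  and \<phi>_scale: "r \<in> scalars (length D) \<Longrightarrow> x \<in> elements D \<Longrightarrow> \<phi> D (r \<odot>\<^bsub>alexander_module D\<^esub> x) = r * \<phi> D x"
  by (auto simp: elements_eq \<gamma>_add \<gamma>_scale \<phi>_\<gamma> augment_add augment_scale)

lemma tri_eq:
  assumes "x \<in> elements D" "y \<in> elements D"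
  shows "tri D x y =
    ((\<phi> D y + 1) \<odot>\<^bsub>alexander_module D\<^esub> x) \<oplus>\<^bsub>alexander_module D\<^esub> ((- \<phi> D x) \<odot>\<^bsub>alexander_module D\<^esub> y)"
proof -
  obtain v w where "v \<in> formal_sums D" "w \<in> formal_sums D" "x = \<gamma> D v" "y = \<gamma> D w"
    using assms by (auto simp: elements_eq)
  then show ?thesis
    by (simp add: tri_\<gamma> \<phi>_\<gamma> \<gamma>_add \<gamma>_scale augment_in_scalars del: mult_minus_left)
      (simp only: mult_minus_left diff_conv_add_uminus)
qed

lemma tri_in_elements: "x \<in> elements D \<Longrightarrow> y \<in> elements D \<Longrightarrow> tri D x y \<in> elements D"
  by (simp add: tri_eq \<phi>_in_scalars)

lemma \<phi>_tri: "x \<in> elements D \<Longrightarrow> y \<in> elements D \<Longrightarrow> \<phi> D (tri D x y) = \<phi> D x"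
  by (simp add: tri_eq \<phi>_in_scalars \<phi>_add \<phi>_scale algebra_simps)

lemma tri_inv_eq:
  assumes "\<phi> D y = tvar i - 1" "i < length D"
  shows "tri_inv D x y = tvar_inverse i \<odot>\<^bsub>alexander_module D\<^esub>
    (x \<oplus>\<^bsub>alexander_module D\<^esub> (\<phi> D x \<odot>\<^bsub>alexander_module D\<^esub> y))"
  using assms by (simp add: tri_inv_def inv_tvar)

lemma \<phi>_tri_inv:
  assumes "x \<in> elements D" "y \<in> elements D" "\<phi> D y = tvar i - 1" "i < length D"
  shows "\<phi> D (tri_inv D x y) = \<phi> D x"
proof -
  have "\<phi> D (tri_inv D x y) = tvar_inverse i * (\<phi> D x + \<phi> D x * \<phi> D y)"
    using assms by (simp add: tri_inv_eq \<phi>_add \<phi>_scale \<phi>_in_scalars)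
  also have "\<dots> = (tvar_inverse i * tvar i) * \<phi> D x"
    by (simp only: assms(3)) (simp add: ring_distribs)
  finally show ?thesis by simp
qed

lemma tri_inv_in_elements:
  assumes "x \<in> elements D" "y \<in> elements D" "\<phi> D y = tvar i - 1" "i < length D"
  shows "tri_inv D x y \<in> elements D"
  using assms by (simp add: tri_inv_eq \<phi>_in_scalars del: assms(3))

lemma meridian_in_elements [simp]: "a \<in> arcs D \<Longrightarrow> meridian D a \<in> elements D"
  by (simp add: \<gamma>_in_elements)

lemma \<phi>_meridian [simp]: "a \<in> arcs D \<Longrightarrow> \<phi> D (meridian D a) = tvar (arc_component a) - 1"
  by (simp add: \<phi>_\<gamma> augment_basis_vector)

lemma quandle_element:
  assumes "x \<in> Q\<^sub>A D"
  shows "x \<in> elements D \<and> (\<exists>i<length D. \<phi> D x = tvar i - 1)"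
  using assms
proof induction
  case (tri x y)
  then show ?case by (simp add: tri_in_elements \<phi>_tri)
next
  case (tri_inv x y)
  then obtain i where "i < length D" "\<phi> D y = tvar i - 1" by auto
  with tri_inv show ?case by (simp add: tri_inv_in_elements \<phi>_tri_inv)
qed (auto simp: arc_component_less)

lemma quandle_in_elements: "x \<in> Q\<^sub>A D \<Longrightarrow> x \<in> elements D"
  using quandle_element by blast

lemma component_less: "x \<in> Q\<^sub>A D \<Longrightarrow> component D x < length D"
  and \<phi>_quandle: "x \<in> Q\<^sub>A D \<Longrightarrow> \<phi> D x = tvar (component D x) - 1"
  using quandle_element[of x] component_eqI by auto

lemma component_tri: "x \<in> Q\<^sub>A D \<Longrightarrow> y \<in> Q\<^sub>A D \<Longrightarrow> component D (tri D x y) = component D x"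
  by (simp add: component_def \<phi>_tri quandle_in_elements)

lemma component_tri_inv: "x \<in> Q\<^sub>A D \<Longrightarrow> y \<in> Q\<^sub>A D \<Longrightarrow> component D (tri_inv D x y) = component D x"
  using quandle_element[of y] by (auto simp: component_def \<phi>_tri_inv quandle_in_elements)

lemma component_meridian: "a \<in> arcs D \<Longrightarrow> component D (meridian D a) = arc_component a"
  by (simp add: component_eqI)

lemma tri_inv_in_quandle: "x \<in> Q\<^sub>A D \<Longrightarrow> y \<in> Q\<^sub>A D \<Longrightarrow> tri_inv D x y \<in> Q\<^sub>A D"
  by (rule Q\<^sub>A.tri_inv) (simp_all add: \<phi>_quandle tvar_Units component_less)

lemma component_has_arc:
  assumes "i < length D" "\<forall>vs\<in>set D. vs \<noteq> []"
  obtains a where "a \<in> arcs D" "arc_component a = i"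
proof
  have "(i, 0) \<in> positions D" using assms by (simp add: positions_def)
  then show "arc_at D (i, 0) \<in> arcs D" by (rule arc_at_in_arcs)
qed simp

text \<open>
  Passing under another arc acts on a meridian by the quandle operation. So running once along a
  component one meets all its arcs in a single orbit, and the orbits of the quandle are the
  components of the link.
\<close>

lemma orbit_invariant_arcs:
  assumes h: "\<And>x y. x \<in> Q\<^sub>A D \<Longrightarrow> y \<in> Q\<^sub>A D \<Longrightarrow> h (tri D x y) = h x"
    and a: "a \<in> arcs D" and b: "b \<in> arcs D" and "arc_component a = arc_component b"
  shows "h (meridian D a) = h (meridian D b)"
proof -
  obtain i where i: "arc_component a = i" "arc_component b = i" using assms by auto
  have step: "h (meridian D (left_arc D c)) = h (meridian D (right_arc D c))" if "c \<in> crossings D" for c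
    using h Q\<^sub>A.arc crossing_arcs[OF that] by (simp add: \<gamma>_left_arc[OF that])
  have before: "h (meridian D (i, v)) = h (meridian D (arc_before D (i, v)))" if v: "v \<in> under_params D i" for v
  proof -
    obtain x where "(x, (i, v)) \<in> crossings D" using v by (auto simp: under_params_def)
    from step[OF this] show ?thesis
      by (auto simp: left_arc_def right_arc_def arc_at_under[OF finite_under_params v] split: if_splits)
  qed
  have const: "h (meridian D (i, v)) = h (meridian D (i, Min (under_params D i)))" if "v \<in> under_params D i" for v
    using that
  proof (induction "card {w \<in> under_params D i. w < v}" arbitrary: v rule: less_induct)
    case less
    let ?W = "{w \<in> under_params D i. w < v}"
    show ?case
    proof (cases "?W = {}")
      case True
      then have "Min (under_params D i) = v"
        using less.prems finite_under_params by (intro Min_eqI) (auto simp: not_less)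
      then show ?thesis by simp
    next
      case False
      have fin: "finite ?W" using finite_under_params by auto
      then have M: "Max ?W \<in> ?W" using False by (rule Max_in)
      have "arc_before D (i, v) = (i, Max ?W)"
        using False less.prems by (auto simp: arc_before_def Let_def)
      then have "h (meridian D (i, v)) = h (meridian D (i, Max ?W))"
        using before[OF less.prems] by simp
      also have "\<dots> = h (meridian D (i, Min (under_params D i)))"
      proof (rule less.hyps)
        show "card {w \<in> under_params D i. w < Max ?W} < card ?W"
          using M by (intro psubset_card_mono fin) auto
        show "Max ?W \<in> under_params D i" using M by blast
      qed
      finally show ?thesis .
    qed
  qed
  have "h (meridian D c) = h (meridian D (if under_params D i = {} then (i, 0) else (i, Min (under_params D i))))"
    if "c \<in> arcs D" "arc_component c = i" for c
  proof -
    obtain u where c: "c = arc_at D (i, u)" using \<open>c \<in> arcs D\<close> \<open>arc_component c = i\<close> by (auto simp: arcs_def)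
    show ?thesis by (cases rule: arc_at_cases[of i u]) (auto simp: c const)
  qed
  then show ?thesis using a b i by simp
qed

lemma orbit_invariant:
  assumes h: "\<And>x y. x \<in> Q\<^sub>A D \<Longrightarrow> y \<in> Q\<^sub>A D \<Longrightarrow> h (tri D x y) = h x"
    and h_inv: "\<And>x y. x \<in> Q\<^sub>A D \<Longrightarrow> y \<in> Q\<^sub>A D \<Longrightarrow> h (tri_inv D x y) = h x"
    and x: "x \<in> Q\<^sub>A D" and y: "y \<in> Q\<^sub>A D" and "component D x = component D y"
  shows "h x = h y"
proof -
  have "\<exists>a\<in>arcs D. arc_component a = component D x \<and> h x = h (meridian D a)" if "x \<in> Q\<^sub>A D" for x
    using that
  proof induction
    case (arc a)
    then show ?case by (auto simp: component_meridian)
  qed (simp_all add: h h_inv component_tri component_tri_inv)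
  from this[OF x] this[OF y] show ?thesis
    using orbit_invariant_arcs[of h, OF h] \<open>component D x = component D y\<close> by metis
qed

end

context
  fixes D D' :: "polygon list" and \<theta> :: "laurent \<Rightarrow> laurent"
  assumes D: "finite_diagram D" and D': "finite_diagram D'"
    and \<theta>: "scalar_hom (length D) (length D') \<theta>"
begin

interpretation D: finite_diagram D by (rule D)
interpretation D': finite_diagram D' by (rule D')

lemma semilinear_tri:
  assumes g: "semilinear D D' \<theta> g" and \<phi>: "\<And>x. x \<in> elements D \<Longrightarrow> \<phi> D' (g x) = \<theta> (\<phi> D x)"
    and x: "x \<in> elements D" and y: "y \<in> elements D"
  shows "g (tri D x y) = tri D' (g x) (g y)"
proof -
  have "g x \<in> elements D'" "g y \<in> elements D'" using g x y by (auto simp: semilinear_def)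
  then show ?thesis
    using g x y by (simp add: D.tri_eq D'.tri_eq semilinear_def D.\<phi>_in_scalars \<phi>
        scalar_hom_add[OF \<theta>] scalar_hom_1[OF \<theta>] scalar_hom_uminus[OF \<theta>])
qed

lemma semilinear_tri_inv:
  assumes g: "semilinear D D' \<theta> g" and \<phi>: "\<And>x. x \<in> elements D \<Longrightarrow> \<phi> D' (g x) = \<theta> (\<phi> D x)"
    and x: "x \<in> elements D" and y: "y \<in> elements D"
    and i: "\<phi> D y = tvar i - 1" "i < length D" and j: "\<phi> D' (g y) = tvar j - 1" "j < length D'"
  shows "g (tri_inv D x y) = tri_inv D' (g x) (g y)"
proof -
  have "\<theta> (tvar i) = tvar j"
    using \<phi>[OF y] i(1) j(1) by (simp add: scalar_hom_diff[OF \<theta>] scalar_hom_1[OF \<theta>])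
  then have "tvar_inverse j * (tvar j * \<theta> (tvar_inverse i)) = tvar_inverse j"
    by (metis mult.right_neutral scalar_hom_1[OF \<theta>] scalar_hom_mult[OF \<theta>] tvar_mult_inverse(1))
  then have "\<theta> (tvar_inverse i) = tvar_inverse j"
    by (simp flip: mult.assoc)
  moreover have "g x \<in> elements D'" "g y \<in> elements D'" using g x y by (auto simp: semilinear_def)
  ultimately show ?thesis
    using g x y i(2) by (simp add: D.tri_inv_eq[OF i] D'.tri_inv_eq[OF j] semilinear_def D.\<phi>_in_scalars \<phi>)
qed

text \<open>
  The quandle carries the crossing relations and generates the module, so a quandle homomorphism
  that is compatible with the Crowell maps is the restriction of a map of modules.
\<close>

lemma quandle_hom_extends:
  assumes f: "\<And>x. x \<in> Q\<^sub>A D \<Longrightarrow> f x \<in> Q\<^sub>A D'"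
    and tri: "\<And>x y. x \<in> Q\<^sub>A D \<Longrightarrow> y \<in> Q\<^sub>A D \<Longrightarrow> f (tri D x y) = tri D' (f x) (f y)"
    and tri_inv: "\<And>x y. x \<in> Q\<^sub>A D \<Longrightarrow> y \<in> Q\<^sub>A D \<Longrightarrow> f (tri_inv D x y) = tri_inv D' (f x) (f y)"
    and \<phi>: "\<And>x. x \<in> Q\<^sub>A D \<Longrightarrow> \<phi> D' (f x) = \<theta> (\<phi> D x)"
  obtains g where "semilinear D D' \<theta> g" "\<And>x. x \<in> Q\<^sub>A D \<Longrightarrow> g x = f x"
    "\<And>x. x \<in> elements D \<Longrightarrow> \<phi> D' (g x) = \<theta> (\<phi> D x)"
proof -
  obtain g where g: "semilinear D D' \<theta> g" and gf: "\<And>a. a \<in> arcs D \<Longrightarrow> g (meridian D a) = f (meridian D a)"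
  proof (rule semilinear_extension[OF D D' \<theta>, where m = "\<lambda>a. f (meridian D a)"])
    fix a assume "a \<in> arcs D"
    then show "f (meridian D a) \<in> elements D'" "\<phi> D' (f (meridian D a)) = \<theta> (tvar (arc_component a) - 1)"
      using f \<phi> by (simp_all add: D'.quandle_in_elements Q\<^sub>A.arc)
  next
    fix c assume "c \<in> crossings D"
    then show "f (meridian D (left_arc D c)) = tri D' (f (meridian D (right_arc D c))) (f (meridian D (over_arc D c)))"
      by (simp add: D.\<gamma>_left_arc tri Q\<^sub>A.arc)
  qed blast
  have g\<phi>: "\<phi> D' (g x) = \<theta> (\<phi> D x)" if "x \<in> elements D" for x
    using that by (intro semilinear_\<phi>[OF D D' \<theta> g]) (simp_all add: gf \<phi> Q\<^sub>A.arc)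
  have "g x = f x" if "x \<in> Q\<^sub>A D" for x
    using that
  proof induction
    case (tri x y)
    then show ?case using assms(2) by (simp add: semilinear_tri[OF g g\<phi>] D.quandle_in_elements)
  next
    case (tri_inv x y)
    have "g (tri_inv D x y) = tri_inv D' (g x) (g y)"
      using tri_inv f[of y] D'.quandle_element[of "f y"]
      by (intro semilinear_tri_inv[OF g g\<phi> _ _ D.\<phi>_quandle D.component_less D'.\<phi>_quandle D'.component_less])
        (simp_all add: D.quandle_in_elements)
    with tri_inv assms(3) show ?case by simp
  qed (rule gf)
  with that g g\<phi> show ?thesis by blast
qed

end

section \<open>Re-indexing components\<close>

text \<open>
  In the re-indexed diagram \<open>permute_list \<tau> D\<close> component \<open>i\<close> is component \<open>\<tau> i\<close> of \<open>D\<close>. So \<open>reindex \<tau>\<close> takes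
  positions on the re-indexed diagram to positions on \<open>D\<close>.
\<close>

definition reindex :: "(nat \<Rightarrow> nat) \<Rightarrow> position \<Rightarrow> position"
  where "reindex \<tau> = apfst \<tau>"

lemma under_params_iff: "v \<in> under_params D i \<longleftrightarrow> (\<exists>x. (x, (i, v)) \<in> crossings D)"
proof
  assume "v \<in> under_params D i"
  then obtain c where "c \<in> crossings D" "snd c = (i, v)" by (auto simp: under_params_def)
  then show "\<exists>x. (x, (i, v)) \<in> crossings D" by (metis prod.collapse)
qed (auto simp: under_params_def intro: image_eqI[rotated])

locale permuted_diagram =
  fixes D :: "polygon list" and \<tau> :: "nat \<Rightarrow> nat"
  assumes \<tau>: "\<tau> permutes {..<length D}"
begin

abbreviation P where "P \<equiv> permute_list \<tau> D"

lemma nth_P [simp]: "i < length D \<Longrightarrow> P ! i = D ! \<tau> i"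
  using \<tau> by (rule permute_list_nth)

lemma \<tau>_less [simp]: "\<tau> i < length D \<longleftrightarrow> i < length D"
  using permutes_in_image[OF \<tau>, of i] by simp

lemma fst_reindex [simp]: "fst (reindex \<tau> x) = \<tau> (fst x)"
  and snd_reindex [simp]: "snd (reindex \<tau> x) = snd x"
  by (simp_all add: reindex_def)

lemma bij_reindex: "bij (reindex \<tau>)"
proof (rule o_bij)
  show "reindex (inv_into UNIV \<tau>) \<circ> reindex \<tau> = id" "reindex \<tau> \<circ> reindex (inv_into UNIV \<tau>) = id"
    using permutes_inverses[OF \<tau>] by (auto simp: reindex_def)
qed

lemma reindex_eq_iff [simp]: "reindex \<tau> x = reindex \<tau> y \<longleftrightarrow> x = y"
  using bij_reindex by (simp add: bij_def inj_eq)

lemma positions_P: "x \<in> positions P \<longleftrightarrow> reindex \<tau> x \<in> positions D"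
  by (cases x) (auto simp: positions_def reindex_def)

lemma point_at_P: "x \<in> positions P \<Longrightarrow> point_at P x = point_at D (reindex \<tau> x)"
  by (cases x) (auto simp: positions_def point_at_def)

lemma direction_P: "x \<in> positions P \<Longrightarrow> direction P x = direction D (reindex \<tau> x)"
  by (cases x) (auto simp: positions_def direction_def reindex_def)

lemma crossings_P: "(x, y) \<in> crossings P \<longleftrightarrow> (reindex \<tau> x, reindex \<tau> y) \<in> crossings D"
  by (auto simp: crossings_def positions_P point_at_P)

lemma under_params_P: "under_params P i = under_params D (\<tau> i)"
proof -
  have "(\<exists>x. (x, (i, v)) \<in> crossings P) \<longleftrightarrow> (\<exists>x. (x, (\<tau> i, v)) \<in> crossings D)" for v
  proof
    assume "\<exists>x. (x, (\<tau> i, v)) \<in> crossings D"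
    then obtain x where "(x, (\<tau> i, v)) \<in> crossings D" ..
    moreover obtain y where "x = reindex \<tau> y" using bij_reindex by (metis bij_pointE)
    ultimately show "\<exists>x. (x, (i, v)) \<in> crossings P"
      by (intro exI[of _ y]) (simp add: crossings_P reindex_def)
  qed (auto simp: crossings_P reindex_def)
  then show ?thesis
    by (intro Set.set_eqI) (simp only: under_params_iff)
qed

lemma reindex_arc_at: "reindex \<tau> (arc_at P x) = arc_at D (reindex \<tau> x)"
  and reindex_arc_before: "reindex \<tau> (arc_before P x) = arc_before D (reindex \<tau> x)"
  by (cases x; simp add: arc_at_def arc_before_def Let_def under_params_P reindex_def)+

lemma reindex_arcs: "a \<in> arcs P \<longleftrightarrow> reindex \<tau> a \<in> arcs D"
proof
  assume "reindex \<tau> a \<in> arcs D"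
  then obtain x where x: "x \<in> positions D" "reindex \<tau> a = arc_at D x" by (auto simp: arcs_def)
  moreover obtain y where "x = reindex \<tau> y" using bij_reindex by (metis bij_pointE)
  ultimately show "a \<in> arcs P" unfolding arcs_def by (auto simp: positions_P simp flip: reindex_arc_at)
qed (auto simp: arcs_def positions_P reindex_arc_at)

lemma reindex_crossing:
  assumes "(x, y) \<in> crossings P"
  shows "reindex \<tau> (over_arc P (x, y)) = over_arc D (reindex \<tau> x, reindex \<tau> y)"
    "reindex \<tau> (left_arc P (x, y)) = left_arc D (reindex \<tau> x, reindex \<tau> y)"
    "reindex \<tau> (right_arc P (x, y)) = right_arc D (reindex \<tau> x, reindex \<tau> y)"
proof -
  have "x \<in> positions P" "y \<in> positions P" using assms by (auto simp: crossings_def)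
  then have "under_right_to_left P (x, y) = under_right_to_left D (reindex \<tau> x, reindex \<tau> y)"
    by (simp add: under_right_to_left_def direction_P)
  then show "reindex \<tau> (over_arc P (x, y)) = over_arc D (reindex \<tau> x, reindex \<tau> y)"
    "reindex \<tau> (left_arc P (x, y)) = left_arc D (reindex \<tau> x, reindex \<tau> y)"
    "reindex \<tau> (right_arc P (x, y)) = right_arc D (reindex \<tau> x, reindex \<tau> y)"
    by (simp_all add: over_arc_def left_arc_def right_arc_def reindex_arc_at reindex_arc_before)
qed

lemma finite_crossings_P: "finite (crossings D) \<Longrightarrow> finite (crossings P)"
proof -
  assume "finite (crossings D)"
  moreover have "crossings P = map_prod (reindex \<tau>) (reindex \<tau>) -` crossings D"
    by (auto simp: crossings_P)
  moreover have "inj (map_prod (reindex \<tau>) (reindex \<tau>))"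
    using bij_reindex by (simp add: bij_is_inj prod.inj_map)
  ultimately show "finite (crossings P)" by (simp add: finite_vimageI)
qed

lemma polygonal_link_P:
  assumes "polygonal_link D" shows "polygonal_link P"
  unfolding polygonal_link_def
proof (intro conjI)
  show "P \<noteq> []" using assms by (metis length_0_conv length_permute_list polygonal_link_def)
  show "\<forall>vs\<in>set P. 3 \<le> length vs" using assms \<tau> by (simp add: polygonal_link_def)
  show "inj_on (point_at P) (positions P)"
  proof (rule inj_onI)
    fix x y assume xy: "x \<in> positions P" "y \<in> positions P" "point_at P x = point_at P y"
    moreover have "inj_on (point_at D) (positions D)" using assms by (simp add: polygonal_link_def)
    ultimately have "reindex \<tau> x = reindex \<tau> y"
      by (simp only: positions_P point_at_P inj_on_eq_iff)
    then show "x = y" by simp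
  qed
qed

lemma regular_position_P:
  assumes "regular_position D" shows "regular_position P"
  unfolding regular_position_def
proof (intro conjI ballI impI)
  show "finite (crossings P)"
    using assms by (simp add: regular_position_def finite_crossings_P)
  fix x y z assume "x \<in> positions P" "y \<in> positions P" "z \<in> positions P"
    "proj (point_at P x) = proj (point_at P y) \<and> proj (point_at P y) = proj (point_at P z)"
  then have "reindex \<tau> x = reindex \<tau> y \<or> reindex \<tau> y = reindex \<tau> z \<or> reindex \<tau> x = reindex \<tau> z"
    using assms unfolding regular_position_def by (simp only: positions_P point_at_P)
  then show "x = y \<or> y = z \<or> x = z" by simp
next
  fix c assume "c \<in> crossings P"
  then show "case c of (x, y) \<Rightarrow> snd x \<notin> \<int> \<and> snd y \<notin> \<int>"
    using assms unfolding regular_position_def by (force simp: crossings_P)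
qed

lemma diagram_of_P:
  assumes "diagram_of D L"
  shows "diagram_of P (permute_list \<tau> L)"
proof -
  have len: "length L = length D" and iso: "isotopic_to_polygons L D"
    using assms by (auto simp: diagram_of_def isotopic_to_polygons_def)
  have nth: "permute_list \<tau> L ! i = L ! \<tau> i" if "i < length L" for i
    using \<tau> that by (simp add: permute_list_nth len)
  obtain H :: "real \<Rightarrow> (real^3) \<times> real \<Rightarrow> (real^3) \<times> real" where
    H: "continuous_on ({0..1} \<times> S3) (\<lambda>(s, p). H s p)" "\<forall>s\<in>{0..1}. \<exists>G. homeomorphism S3 S3 (H s) G"
      "\<forall>p\<in>S3. H 0 p = p" and
    comp: "\<forall>i<length L. \<exists>f :: real \<Rightarrow> real.
        continuous_on {0..1} f \<and> strict_mono_on {0..1} f \<and>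
        f 1 = f 0 + real (length (D ! i)) \<and>
        (\<forall>s\<in>{0..1}. H 1 ((L ! i) s) = inv_stereo (polygon_at (D ! i) (f s)))"
    using iso unfolding isotopic_to_polygons_def by blast
  have "\<forall>i<length (permute_list \<tau> L). \<exists>f :: real \<Rightarrow> real.
        continuous_on {0..1} f \<and> strict_mono_on {0..1} f \<and>
        f 1 = f 0 + real (length (P ! i)) \<and>
        (\<forall>s\<in>{0..1}. H 1 ((permute_list \<tau> L ! i) s) = inv_stereo (polygon_at (P ! i) (f s)))"
    using comp by (simp add: nth len)
  with H have "isotopic_to_polygons (permute_list \<tau> L) P"
    unfolding isotopic_to_polygons_def by (simp add: len) blast
  then show ?thesis
    using assms by (simp add: diagram_of_def polygonal_link_P regular_position_P)
qed

text \<open>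
  Re-indexing changes the Alexander module only by the names of the variables.
\<close>

lemma reindex_semilinear:
  assumes "finite (crossings D)"
  obtains g where "semilinear P D (rename \<tau>) g"
    "\<And>a. a \<in> arcs P \<Longrightarrow> g (meridian P a) = meridian D (reindex \<tau> a)"
proof -
  interpret D: finite_diagram D using assms by unfold_locales
  have P: "finite_diagram P" using assms by unfold_locales (rule finite_crossings_P)
  have \<theta>: "scalar_hom (length P) (length D) (rename \<tau>)" using scalar_hom_rename[OF \<tau>] by simp
  show thesis
  proof (rule semilinear_extension[OF P D.finite_diagram_axioms \<theta>, where m = "\<lambda>a. meridian D (reindex \<tau> a)"])
    fix a assume "a \<in> arcs P"
    then show "meridian D (reindex \<tau> a) \<in> elements D"
      "\<phi> D (meridian D (reindex \<tau> a)) = rename \<tau> (tvar (arc_component a) - 1)"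
      by (simp_all add: reindex_arcs scalar_hom_diff[OF \<theta>] scalar_hom_1[OF \<theta>] rename_tvar[OF \<tau>])
  next
    fix c assume c: "c \<in> crossings P"
    obtain x y where xy: "c = (x, y)" by (cases c)
    show "meridian D (reindex \<tau> (left_arc P c)) =
        tri D (meridian D (reindex \<tau> (right_arc P c))) (meridian D (reindex \<tau> (over_arc P c)))"
      using c by (simp add: xy reindex_crossing) (rule D.\<gamma>_left_arc, simp add: crossings_P)
  qed (use that in blast)
qed

end

section \<open>The quandle determines the module sequence up to re-indexing\<close>

text \<open>
  The composite fixes the generators, and it is linear because the two ring homomorphisms cancel.
\<close>

lemma mutually_inverse_semilinear:
  assumes D: "finite_diagram D" and D': "finite_diagram D'"
    and \<theta>: "scalar_hom (length D) (length D') \<theta>" and "\<And>p. \<theta>' (\<theta> p) = p"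
    and g: "semilinear D D' \<theta> g" and h: "semilinear D' D \<theta>' h"
    and hg: "\<And>a. a \<in> arcs D \<Longrightarrow> h (g (meridian D a)) = meridian D a"
    and "x \<in> elements D"
  shows "h (g x) = x"
proof (rule semilinear_eqI[OF D D scalar_hom_id])
  show "semilinear D D (\<lambda>p. p) (\<lambda>x. h (g x))"
    using semilinear_compose[OF g h \<theta>] assms(4) by simp
qed (use assms semilinear_id in auto)

lemma crowell_equivalentI:
  assumes D: "finite_diagram D" and D': "finite_diagram D'" and "length D = length D'"
    and g: "semilinear D D' (\<lambda>p. p) g" and h: "semilinear D' D (\<lambda>p. p) h"
    and hg: "\<And>a. a \<in> arcs D \<Longrightarrow> h (g (meridian D a)) = meridian D a"
    and gh: "\<And>a. a \<in> arcs D' \<Longrightarrow> g (h (meridian D' a)) = meridian D' a"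
    and \<phi>: "\<And>a. a \<in> arcs D \<Longrightarrow> \<phi> D' (g (meridian D a)) = tvar (arc_component a) - 1"
  shows "crowell_equivalent D D'"
  unfolding crowell_equivalent_def linear_iso_def
proof (intro conjI exI[of _ g])
  have id: "scalar_hom (length D) (length D') (\<lambda>p. p)" "scalar_hom (length D') (length D) (\<lambda>p. p)"
    using scalar_hom_id \<open>length D = length D'\<close> by metis+
  show "bij_betw g (elements D) (elements D')"
  proof (rule bij_betw_byWitness[where f' = h])
    show "\<forall>x\<in>elements D. h (g x) = x"
      using mutually_inverse_semilinear[OF D D' id(1) _ g h hg] by simp
    show "\<forall>x\<in>elements D'. g (h x) = x"
      using mutually_inverse_semilinear[OF D' D id(2) _ h g gh] by simp
    show "g ` elements D \<subseteq> elements D'" "h ` elements D' \<subseteq> elements D"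
      using g h by (auto simp: semilinear_def)
  qed
  show "\<forall>x\<in>elements D. \<phi> D x = \<phi> D' (g x)"
    using semilinear_\<phi>[OF D D' id(1) g] \<phi> by simp
qed (use assms in \<open>auto simp: semilinear_def\<close>)

lemma bij_betw_lessThan_imp_eq:
  fixes p :: "nat \<Rightarrow> nat"
  assumes "bij_betw p {..<m} {..<n}" shows "m = n"
  using bij_betw_same_card[OF assms] by simp

text \<open>
  Both an isomorphism and its inverse preserve the operations and, since components are orbits, the
  partition into components.
\<close>

lemma quandle_isomorphicE:
  assumes "finite_diagram D" "finite_diagram D'" and iso: "quandle_isomorphic D D'"
  obtains f f' where
    "\<And>x. x \<in> Q\<^sub>A D \<Longrightarrow> f x \<in> Q\<^sub>A D'" "\<And>x. x \<in> Q\<^sub>A D' \<Longrightarrow> f' x \<in> Q\<^sub>A D"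
    "\<And>x. x \<in> Q\<^sub>A D' \<Longrightarrow> f (f' x) = x" "\<And>x. x \<in> Q\<^sub>A D \<Longrightarrow> f' (f x) = x"
    "\<And>x y. x \<in> Q\<^sub>A D \<Longrightarrow> y \<in> Q\<^sub>A D \<Longrightarrow> f (tri D x y) = tri D' (f x) (f y)"
    "\<And>x y. x \<in> Q\<^sub>A D \<Longrightarrow> y \<in> Q\<^sub>A D \<Longrightarrow> f (tri_inv D x y) = tri_inv D' (f x) (f y)"
    "\<And>x y. x \<in> Q\<^sub>A D' \<Longrightarrow> y \<in> Q\<^sub>A D' \<Longrightarrow> f' (tri D' x y) = tri D (f' x) (f' y)"
    "\<And>x y. x \<in> Q\<^sub>A D' \<Longrightarrow> y \<in> Q\<^sub>A D' \<Longrightarrow> f' (tri_inv D' x y) = tri_inv D (f' x) (f' y)"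
    "\<And>x y. x \<in> Q\<^sub>A D \<Longrightarrow> y \<in> Q\<^sub>A D \<Longrightarrow> component D x = component D y \<Longrightarrow> component D' (f x) = component D' (f y)"
    "\<And>x y. x \<in> Q\<^sub>A D' \<Longrightarrow> y \<in> Q\<^sub>A D' \<Longrightarrow> component D' x = component D' y \<Longrightarrow> component D (f' x) = component D (f' y)"
proof -
  interpret D: finite_diagram D by fact
  interpret D': finite_diagram D' by fact
  obtain f where bij: "bij_betw f (Q\<^sub>A D) (Q\<^sub>A D')"
    and tri: "\<And>x y. x \<in> Q\<^sub>A D \<Longrightarrow> y \<in> Q\<^sub>A D \<Longrightarrow> f (tri D x y) = tri D' (f x) (f y)"
    and tri_inv: "\<And>x y. x \<in> Q\<^sub>A D \<Longrightarrow> y \<in> Q\<^sub>A D \<Longrightarrow> f (tri_inv D x y) = tri_inv D' (f x) (f y)"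
    using iso unfolding quandle_isomorphic_def by blast
  define f' where "f' = inv_into (Q\<^sub>A D) f"
  have f: "f x \<in> Q\<^sub>A D'" if "x \<in> Q\<^sub>A D" for x using bij that by (auto simp: bij_betw_def)
  have f': "f' x \<in> Q\<^sub>A D" if "x \<in> Q\<^sub>A D'" for x
    using bij_betw_inv_into[OF bij] that by (auto simp: bij_betw_def f'_def)
  have ff': "f (f' x) = x" if "x \<in> Q\<^sub>A D'" for x using bij that by (simp add: f'_def bij_betw_inv_into_right)
  have f'f: "f' (f x) = x" if "x \<in> Q\<^sub>A D" for x using bij that by (simp add: f'_def bij_betw_inv_into_left)
  have tri': "f' (tri D' x y) = tri D (f' x) (f' y)" if "x \<in> Q\<^sub>A D'" "y \<in> Q\<^sub>A D'" for x y
    using tri[of "f' x" "f' y"] f'f[of "tri D (f' x) (f' y)"] that f' by (simp add: ff' Q\<^sub>A.tri)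
  have tri_inv': "f' (tri_inv D' x y) = tri_inv D (f' x) (f' y)" if "x \<in> Q\<^sub>A D'" "y \<in> Q\<^sub>A D'" for x y
    using tri_inv[of "f' x" "f' y"] f'f[of "tri_inv D (f' x) (f' y)"] that f'
    by (simp add: ff' D.tri_inv_in_quandle)
  have inv: "component D' (f x) = component D' (f y)"
    if "x \<in> Q\<^sub>A D" "y \<in> Q\<^sub>A D" "component D x = component D y" for x y
    by (rule D.orbit_invariant[of "\<lambda>x. component D' (f x)", OF _ _ that])
      (simp_all add: tri tri_inv f D'.component_tri D'.component_tri_inv)
  have inv': "component D (f' x) = component D (f' y)"
    if "x \<in> Q\<^sub>A D'" "y \<in> Q\<^sub>A D'" "component D' x = component D' y" for x y
    by (rule D'.orbit_invariant[of "\<lambda>x. component D (f' x)", OF _ _ that])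
      (simp_all add: tri' tri_inv' f' D.component_tri D.component_tri_inv)
  show thesis by (rule that[of f f', OF f f' ff' f'f tri tri_inv tri' tri_inv' inv inv'])
qed

text \<open>
  A quandle isomorphism matches orbits, i.e. components, and thus gives a permutation of the
  variables. It extends to a map of Alexander modules which is linear up to this permutation; after
  re-indexing one of the two links, it becomes linear.
\<close>

theorem quandle_isomorphic_imp_crowell_equivalent:
  assumes "polygonal_link D" "finite (crossings D)" "polygonal_link D'" "finite (crossings D')"
    and iso: "quandle_isomorphic D D'"
  obtains \<tau> where "length D = length D'" "\<tau> permutes {..<length D'}"
    "crowell_equivalent D (permute_list \<tau> D')"
proof -
  interpret D: finite_diagram D using assms(2) by unfold_locales
  interpret D': finite_diagram D' using assms(4) by unfold_locales
  obtain f f' where f: "\<And>x. x \<in> Q\<^sub>A D \<Longrightarrow> f x \<in> Q\<^sub>A D'" and f': "\<And>x. x \<in> Q\<^sub>A D' \<Longrightarrow> f' x \<in> Q\<^sub>A D"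
    and ff': "\<And>x. x \<in> Q\<^sub>A D' \<Longrightarrow> f (f' x) = x" and f'f: "\<And>x. x \<in> Q\<^sub>A D \<Longrightarrow> f' (f x) = x"
    and tri: "\<And>x y. x \<in> Q\<^sub>A D \<Longrightarrow> y \<in> Q\<^sub>A D \<Longrightarrow> f (tri D x y) = tri D' (f x) (f y)"
    and tri_inv: "\<And>x y. x \<in> Q\<^sub>A D \<Longrightarrow> y \<in> Q\<^sub>A D \<Longrightarrow> f (tri_inv D x y) = tri_inv D' (f x) (f y)"
    and tri': "\<And>x y. x \<in> Q\<^sub>A D' \<Longrightarrow> y \<in> Q\<^sub>A D' \<Longrightarrow> f' (tri D' x y) = tri D (f' x) (f' y)"
    and tri_inv': "\<And>x y. x \<in> Q\<^sub>A D' \<Longrightarrow> y \<in> Q\<^sub>A D' \<Longrightarrow> f' (tri_inv D' x y) = tri_inv D (f' x) (f' y)"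
    and inv: "\<And>x y. x \<in> Q\<^sub>A D \<Longrightarrow> y \<in> Q\<^sub>A D \<Longrightarrow> component D x = component D y \<Longrightarrow>
      component D' (f x) = component D' (f y)"
    and inv': "\<And>x y. x \<in> Q\<^sub>A D' \<Longrightarrow> y \<in> Q\<^sub>A D' \<Longrightarrow> component D' x = component D' y \<Longrightarrow>
      component D (f' x) = component D (f' y)"
    by (rule quandle_isomorphicE[OF D.finite_diagram_axioms D'.finite_diagram_axioms iso]) (rule that; assumption)
  \<comment> \<open>Every component has a meridian, so mapping orbits to orbits gives a bijection \<open>\<pi>\<close> of indices.\<close>
  have ne: "\<forall>vs\<in>set D. vs \<noteq> []" "\<forall>vs\<in>set D'. vs \<noteq> []"
    using assms(1,3) by (auto simp: polygonal_link_def)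
  have ex: "\<exists>x\<in>Q\<^sub>A D. component D x = i" if i: "i < length D" for i
  proof -
    obtain a where "a \<in> arcs D" "arc_component a = i" using D.component_has_arc[OF i ne(1)] .
    then show ?thesis by (intro bexI[of _ "meridian D a"]) (simp_all add: D.component_meridian Q\<^sub>A.arc)
  qed
  have ex': "\<exists>x\<in>Q\<^sub>A D'. component D' x = i" if i: "i < length D'" for i
  proof -
    obtain a where "a \<in> arcs D'" "arc_component a = i" using D'.component_has_arc[OF i ne(2)] .
    then show ?thesis by (intro bexI[of _ "meridian D' a"]) (simp_all add: D'.component_meridian Q\<^sub>A.arc)
  qed
  define \<pi> where "\<pi> i = (if i < length D then component D' (f (SOME x. x \<in> Q\<^sub>A D \<and> component D x = i)) else i)" for i
  have \<pi>: "component D' (f x) = \<pi> (component D x)" if "x \<in> Q\<^sub>A D" for x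
  proof -
    have "(SOME y. y \<in> Q\<^sub>A D \<and> component D y = component D x) \<in> Q\<^sub>A D \<and>
      component D (SOME y. y \<in> Q\<^sub>A D \<and> component D y = component D x) = component D x"
      by (rule someI[of _ x]) (simp add: that)
    then have "component D' (f x) = component D' (f (SOME y. y \<in> Q\<^sub>A D \<and> component D y = component D x))"
      by (intro inv that) simp_all
    then show ?thesis by (simp only: \<pi>_def D.component_less[OF that] if_True)
  qed
  have "bij_betw \<pi> {..<length D} {..<length D'}"
    unfolding bij_betw_def
  proof (intro conjI inj_onI)
    fix i j assume "i \<in> {..<length D}" "j \<in> {..<length D}" and eq: "\<pi> i = \<pi> j"
    then obtain x y where "x \<in> Q\<^sub>A D" "component D x = i" "y \<in> Q\<^sub>A D" "component D y = j"
      using ex by blast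
    moreover from this eq have "component D' (f x) = component D' (f y)" by (simp add: \<pi>)
    ultimately show "i = j" using inv'[OF f f, of x y] by (simp add: f'f)
  next
    have "\<pi> i < length D'" if i: "i < length D" for i
    proof -
      obtain x where "x \<in> Q\<^sub>A D" "component D x = i" using ex[OF i] by blast
      then show ?thesis using D'.component_less[OF f, of x] by (simp add: \<pi>)
    qed
    moreover have "\<exists>i<length D. j = \<pi> i" if j: "j < length D'" for j
    proof -
      obtain y where y: "y \<in> Q\<^sub>A D'" "component D' y = j" using ex'[OF j] by blast
      show ?thesis
        using \<pi>[OF f', OF y(1)] D.component_less[OF f', OF y(1)] y by (simp only: ff') blast
    qed
    ultimately show "\<pi> ` {..<length D} = {..<length D'}" by (auto simp: image_iff)
  qed
  then have bij_\<pi>: "bij_betw \<pi> {..<length D} {..<length D'}" .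
  have len: "length D = length D'" using bij_betw_lessThan_imp_eq[OF bij_\<pi>] .
  have \<pi>_perm: "\<pi> permutes {..<length D'}"
    using bij_\<pi> len by (intro bij_imp_permutes) (simp_all add: \<pi>_def)
  \<comment> \<open>The isomorphism and its inverse extend along the renaming of variables by \<open>\<pi>\<close> and its inverse.\<close>
  let ?\<theta> = "rename \<pi>" and ?\<theta>' = "rename (inv_into UNIV \<pi>)"
  have \<pi>': "inv_into UNIV \<pi> permutes {..<length D'}" using \<pi>_perm by (rule permutes_inv)
  have inv_inv: "inv_into UNIV (inv_into UNIV \<pi>) = \<pi>" using \<pi>_perm by (rule permutes_inv_inv)
  have \<theta>: "scalar_hom (length D) (length D') ?\<theta>" using scalar_hom_rename[OF \<pi>_perm] len by simp
  have \<theta>': "scalar_hom (length D') (length D) ?\<theta>'" using scalar_hom_rename[OF \<pi>'] len by simp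
  have \<theta>'\<theta>: "?\<theta>' (?\<theta> p) = p" "?\<theta> (?\<theta>' p) = p" for p
    using rename_inverse[OF \<pi>_perm] rename_inverse[OF \<pi>'] by (simp_all add: inv_inv)
  have \<phi>f: "\<phi> D' (f x) = ?\<theta> (\<phi> D x)" if "x \<in> Q\<^sub>A D" for x
    using that f by (simp add: D.\<phi>_quandle D'.\<phi>_quandle \<pi> scalar_hom_diff[OF \<theta>] scalar_hom_1[OF \<theta>]
        rename_tvar[OF \<pi>_perm])
  have \<phi>f': "\<phi> D (f' x) = ?\<theta>' (\<phi> D' x)" if "x \<in> Q\<^sub>A D'" for x
    using \<phi>f[OF f'[OF that]] that by (simp add: ff' \<theta>'\<theta>)
  obtain g where g: "semilinear D D' ?\<theta> g" "\<And>x. x \<in> Q\<^sub>A D \<Longrightarrow> g x = f x"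
      "\<And>x. x \<in> elements D \<Longrightarrow> \<phi> D' (g x) = ?\<theta> (\<phi> D x)"
    by (rule quandle_hom_extends[OF D.finite_diagram_axioms D'.finite_diagram_axioms \<theta>, where f = f]) (rule that f tri tri_inv \<phi>f; assumption)+
  obtain g' where g': "semilinear D' D ?\<theta>' g'" "\<And>x. x \<in> Q\<^sub>A D' \<Longrightarrow> g' x = f' x"
    by (rule quandle_hom_extends[OF D'.finite_diagram_axioms D.finite_diagram_axioms \<theta>', where f = f']) (rule that f' tri' tri_inv' \<phi>f'; assumption)+
  \<comment> \<open>Re-indexing the second link undoes the permutation of the variables.\<close>
  interpret R: permuted_diagram D' \<pi> using \<pi>_perm by unfold_locales
  interpret P: finite_diagram R.P
    using R.finite_crossings_P assms(4) by unfold_locales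
  interpret R': permuted_diagram R.P "inv_into UNIV \<pi>" using \<pi>' by unfold_locales simp
  have PP: "R'.P = D'"
    using permute_list_compose[OF \<pi>', of \<pi>] \<pi>_perm by (simp add: permutes_inv_o)
  obtain r where r: "semilinear R.P D' ?\<theta> r" "\<And>a. a \<in> arcs R.P \<Longrightarrow> r (meridian R.P a) = meridian D' (reindex \<pi> a)"
    by (rule R.reindex_semilinear[OF assms(4)]) (rule that; assumption)
  obtain r' where r': "semilinear D' R.P ?\<theta>' r'"
      "\<And>a. a \<in> arcs D' \<Longrightarrow> r' (meridian D' a) = meridian R.P (reindex (inv_into UNIV \<pi>) a)"
    by (rule R'.reindex_semilinear[OF P.finite_crossings, unfolded PP]) (rule that; assumption)
  have \<theta>P: "scalar_hom (length R.P) (length D') ?\<theta>" "scalar_hom (length D') (length R.P) ?\<theta>'"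
    using \<theta> \<theta>' len by simp_all
  have re: "reindex (inv_into UNIV \<pi>) (reindex \<pi> a) = a" "reindex \<pi> (reindex (inv_into UNIV \<pi>) a) = a" for a
    using permutes_inverses[OF \<pi>_perm] by (cases a; simp add: reindex_def)+
  have arcs: "reindex \<pi> a \<in> arcs D'" if "a \<in> arcs R.P" for a using that R.reindex_arcs by blast
  have arcs': "reindex (inv_into UNIV \<pi>) a \<in> arcs R.P" if "a \<in> arcs D'" for a
    using that R'.reindex_arcs unfolding PP by blast
  have rr': "r (r' x) = x" if "x \<in> elements D'" for x
    using that by (rule_tac mutually_inverse_semilinear[OF D'.finite_diagram_axioms P.finite_diagram_axioms \<theta>P(2) _ r'(1) r(1)])
      (simp_all add: \<theta>'\<theta> r r' arcs' re)
  have r'r: "r' (r x) = x" if "x \<in> elements R.P" for x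
    using that by (rule_tac mutually_inverse_semilinear[OF P.finite_diagram_axioms D'.finite_diagram_axioms \<theta>P(1) _ r(1) r'(1)])
      (simp_all add: \<theta>'\<theta> r r' arcs re)
  have g'g: "g' (g x) = x" if "x \<in> elements D" for x
    using that by (rule_tac mutually_inverse_semilinear[OF D.finite_diagram_axioms D'.finite_diagram_axioms \<theta> _ g(1) g'(1)])
      (simp_all add: \<theta>'\<theta> g g' Q\<^sub>A.arc f f'f)
  have gg': "g (g' x) = x" if "x \<in> elements D'" for x
    using that by (rule_tac mutually_inverse_semilinear[OF D'.finite_diagram_axioms D.finite_diagram_axioms \<theta>' _ g'(1) g(1)])
      (simp_all add: \<theta>'\<theta> g g' Q\<^sub>A.arc f' ff')
  have maps: "g x \<in> elements D'" if "x \<in> elements D" for x using g(1) that by (simp add: semilinear_def)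
  have maps_r: "r x \<in> elements D'" if "x \<in> elements R.P" for x using r(1) that by (simp add: semilinear_def)
  have r'\<phi>: "\<phi> R.P (r' x) = ?\<theta>' (\<phi> D' x)" if "x \<in> elements D'" for x
    using that arcs' by (intro semilinear_\<phi>[OF D'.finite_diagram_axioms P.finite_diagram_axioms \<theta>P(2) r'(1)])
      (simp_all add: r' rename_tvar[OF \<pi>'] scalar_hom_diff[OF \<theta>'] scalar_hom_1[OF \<theta>'] reindex_def)
  have "crowell_equivalent D R.P"
  proof (rule crowell_equivalentI[OF D.finite_diagram_axioms P.finite_diagram_axioms])
    show "semilinear D R.P (\<lambda>p. p) (\<lambda>x. r' (g x))"
      using semilinear_compose[OF g(1) r'(1) \<theta>] by (simp add: \<theta>'\<theta>)
    show "semilinear R.P D (\<lambda>p. p) (\<lambda>x. g' (r x))"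
      using semilinear_compose[OF r(1) g'(1) \<theta>P(1)] by (simp add: \<theta>'\<theta>)
  qed (simp_all add: len rr' r'r gg' g'g maps maps_r r'\<phi> g(3) \<theta>'\<theta>)
  then show ?thesis using that len \<pi>_perm by blast
qed

section \<open>Polygons with integer vertices\<close>

type_synonym lattice_point = "int \<times> int \<times> int"

definition lattice_vec :: "lattice_point \<Rightarrow> real^3"
  where "lattice_vec = (\<lambda>(x, y, z). vector [of_int x, of_int y, of_int z])"

definition polygons :: "lattice_point list list \<Rightarrow> polygon list"
  where "polygons Z = map (map lattice_vec) Z"

definition corner :: "lattice_point list list \<Rightarrow> nat \<Rightarrow> nat \<Rightarrow> lattice_point"
  where "corner Z i k = Z ! i ! (k mod length (Z ! i))"

text \<open>The quadruple \<open>(i, k, a, c)\<close> stands for the position at the fraction \<open>a / c\<close> of edge \<open>k\<close> of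
  component \<open>i\<close>.\<close>

type_synonym edge_point = "nat \<times> nat \<times> int \<times> int"

definition edge_position :: "edge_point \<Rightarrow> position"
  where "edge_position = (\<lambda>(i, k, a, c). (i, real k + of_int a / of_int c))"

definition corner_x :: "lattice_point list list \<Rightarrow> nat \<Rightarrow> nat \<Rightarrow> int" where "corner_x Z i k = fst (corner Z i k)"
definition corner_y :: "lattice_point list list \<Rightarrow> nat \<Rightarrow> nat \<Rightarrow> int" where "corner_y Z i k = fst (snd (corner Z i k))"
definition corner_z :: "lattice_point list list \<Rightarrow> nat \<Rightarrow> nat \<Rightarrow> int" where "corner_z Z i k = snd (snd (corner Z i k))"

lemma lattice_vec_nth [simp]:
  "lattice_vec p $ 1 = of_int (fst p)" "lattice_vec p $ 2 = of_int (fst (snd p))"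
  "lattice_vec p $ 3 = of_int (snd (snd p))"
  by (simp_all add: lattice_vec_def split: prod.splits)

lemma length_polygons [simp]: "length (polygons Z) = length Z"
  by (simp add: polygons_def)

lemma nth_polygons [simp]: "i < length Z \<Longrightarrow> polygons Z ! i = map lattice_vec (Z ! i)"
  by (simp add: polygons_def)

lemma vertex_polygons:
  assumes "i < length Z" "Z ! i \<noteq> []"
  shows "vertex (polygons Z ! i) (int k) = lattice_vec (corner Z i k)"
proof -
  have "nat (int k mod int (length (Z ! i))) = k mod length (Z ! i)"
    by (metis nat_int zmod_int)
  then show ?thesis using assms by (simp add: vertex_def corner_def)
qed

lemma floor_edge: "0 \<le> s \<Longrightarrow> s < 1 \<Longrightarrow> \<lfloor>real k + s\<rfloor> = int k" for s :: real
  by linarith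

lemma point_at_edge:
  assumes "i < length Z" "Z ! i \<noteq> []" "0 \<le> s" "s < 1"
  shows "point_at (polygons Z) (i, real k + s) =
    (1 - s) *\<^sub>R lattice_vec (corner Z i k) + s *\<^sub>R lattice_vec (corner Z i (Suc k))"
proof -
  have "frac (real k + s) = s" using assms(3,4) by (simp only: frac_def floor_edge)
  moreover have "int k + 1 = int (Suc k)" by simp
  ultimately show ?thesis
    using assms vertex_polygons[OF assms(1,2), of k] vertex_polygons[OF assms(1,2), of "Suc k"]
    by (simp only: point_at_def polygon_at_def fst_conv snd_conv floor_edge)
qed

lemma positions_polygons:
  assumes "x \<in> positions (polygons Z)"
  obtains i k s where "x = (i, real k + s)" "i < length Z" "k < length (Z ! i)" "0 \<le> s" "s < 1"
proof -
  obtain i u where x: "x = (i, u)" "i < length Z" "0 \<le> u" "u < real (length (Z ! i))"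
    using assms by (auto simp: positions_def)
  show ?thesis
  proof
    show "x = (i, real (nat \<lfloor>u\<rfloor>) + frac u)" using x by (simp add: frac_def)
    show "nat \<lfloor>u\<rfloor> < length (Z ! i)" using x by linarith
  qed (use x frac_lt_1 in auto)
qed

subsection \<open>A decision procedure for the crossings\<close>

text \<open>
  The determinants of Cramer's rule for the intersection of the lines through two projected edges:
  \<open>turn\<close> is the cross product of the two directions, \<open>offset_turn\<close> that of the offset between the two
  starting points with the direction of an edge.
\<close>

definition turn :: "lattice_point list list \<Rightarrow> nat \<Rightarrow> nat \<Rightarrow> nat \<Rightarrow> nat \<Rightarrow> int"
  where "turn Z i k j l =
    (corner_x Z i (Suc k) - corner_x Z i k) * (corner_y Z j (Suc l) - corner_y Z j l) -
    (corner_y Z i (Suc k) - corner_y Z i k) * (corner_x Z j (Suc l) - corner_x Z j l)"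

definition offset_turn :: "lattice_point list list \<Rightarrow> nat \<Rightarrow> nat \<Rightarrow> nat \<Rightarrow> nat \<Rightarrow> nat \<Rightarrow> nat \<Rightarrow> int"
  where "offset_turn Z i k j l j' l' =
    (corner_x Z j l - corner_x Z i k) * (corner_y Z j' (Suc l') - corner_y Z j' l') -
    (corner_y Z j l - corner_y Z i k) * (corner_x Z j' (Suc l') - corner_x Z j' l')"

text \<open>
  The lines meet at the fractions \<open>m / d\<close> and \<open>n / d\<close> of the edges. Multiplication by \<open>d * d\<close> decides
  whether these lie in \<open>{0..<1}\<close> without a case distinction on the sign of \<open>d\<close>. Parallel edges have
  \<open>d = 0\<close>, and then \<open>m \<noteq> 0\<close> says that they do not lie on one line.
\<close>

definition edge_pair_ok :: "lattice_point list list \<Rightarrow> (edge_point \<times> edge_point) list \<Rightarrow>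
    nat \<Rightarrow> nat \<Rightarrow> nat \<Rightarrow> nat \<Rightarrow> bool"
  where "edge_pair_ok Z X i k j l \<longleftrightarrow>
    (if i = j \<and> k = l then
       corner_x Z i (Suc k) \<noteq> corner_x Z i k \<or> corner_y Z i (Suc k) \<noteq> corner_y Z i k
     else let d = turn Z i k j l; m = offset_turn Z i k j l j l; n = offset_turn Z i k j l i k in
       if d = 0 then m \<noteq> 0
       else m * d < 0 \<or> d * d \<le> m * d \<or> n * d < 0 \<or> d * d \<le> n * d \<or>
         (\<exists>((i', k', a, c), (j', l', b, e))\<in>set X.
           (i' = i \<and> k' = k \<and> j' = j \<and> l' = l \<and> m * c = a * d \<and> n * e = b * d) \<or>
           (i' = j \<and> k' = l \<and> j' = i \<and> l' = k \<and> n * c = a * d \<and> m * e = b * d)))"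

text \<open>
  The over position comes first. The equations say that the two projections agree and the inequality
  compares the heights, all multiplied by the denominators \<open>c * e\<close>.
\<close>

definition crossing_ok :: "lattice_point list list \<Rightarrow> edge_point \<times> edge_point \<Rightarrow> bool"
  where "crossing_ok Z = (\<lambda>((i, k, a, c), (j, l, b, e)).
    i < length Z \<and> k < length (Z ! i) \<and> j < length Z \<and> l < length (Z ! j) \<and>
    0 < a \<and> a < c \<and> 0 < b \<and> b < e \<and>
    e * ((c - a) * corner_x Z i k + a * corner_x Z i (Suc k)) =
      c * ((e - b) * corner_x Z j l + b * corner_x Z j (Suc l)) \<and>
    e * ((c - a) * corner_y Z i k + a * corner_y Z i (Suc k)) =
      c * ((e - b) * corner_y Z j l + b * corner_y Z j (Suc l)) \<and>
    e * ((c - a) * corner_z Z i k + a * corner_z Z i (Suc k)) >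
      c * ((e - b) * corner_z Z j l + b * corner_z Z j (Suc l)))"

definition diagram_ok :: "lattice_point list list \<Rightarrow> (edge_point \<times> edge_point) list \<Rightarrow> bool"
  where "diagram_ok Z X \<longleftrightarrow> Z \<noteq> [] \<and> (\<forall>zs\<in>set Z. 3 \<le> length zs) \<and> (\<forall>c\<in>set X. crossing_ok Z c) \<and>
    (\<forall>i\<in>set [0..<length Z]. \<forall>k\<in>set [0..<length (Z ! i)].
      \<forall>j\<in>set [0..<length Z]. \<forall>l\<in>set [0..<length (Z ! j)]. edge_pair_ok Z X i k j l)"

definition crossing_list :: "(edge_point \<times> edge_point) list \<Rightarrow> crossing list"
  where "crossing_list X = map (map_prod edge_position edge_position) X"

lemma proj_edge:
  fixes s :: real
  shows
  "proj ((1 - s) *\<^sub>R lattice_vec (corner Z i k) + s *\<^sub>R lattice_vec (corner Z i (Suc k))) =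
    (corner_x Z i k + s * (corner_x Z i (Suc k) - corner_x Z i k),
     corner_y Z i k + s * (corner_y Z i (Suc k) - corner_y Z i k))"
  by (simp add: proj_def corner_x_def corner_y_def algebra_simps)

lemma cramer:
  fixes s t :: real
  assumes "p + s * d = q + t * g" "p' + s * d' = q' + t * g'"
  shows "s * (d * g' - d' * g) = (q - p) * g' - (q' - p') * g"
    "t * (d * g' - d' * g) = (q - p) * d' - (q' - p') * d"
proof -
  have *: "s * d = q - p + t * g" "s * d' = q' - p' + t * g'"
    "t * g = s * d - (q - p)" "t * g' = s * d' - (q' - p')" using assms by simp_all
  have "s * (d * g' - d' * g) = (s * d) * g' - (s * d') * g" by (simp add: algebra_simps)
  then show "s * (d * g' - d' * g) = (q - p) * g' - (q' - p') * g" unfolding *(1,2) by (simp add: algebra_simps)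
  have "t * (d * g' - d' * g) = d * (t * g') - d' * (t * g)" by (simp add: algebra_simps)
  then show "t * (d * g' - d' * g) = (q - p) * d' - (q' - p') * d" unfolding *(3,4) by (simp add: algebra_simps)
qed

text \<open>
  By Cramer's rule the integer test accounts for every point where the projections of two edges meet.
\<close>

lemma edge_pair_ok_cases:
  fixes s t :: real
  assumes ok: "edge_pair_ok Z X i k j l"
    and x: "corner_x Z i k + s * (corner_x Z i (Suc k) - corner_x Z i k) =
       corner_x Z j l + t * (corner_x Z j (Suc l) - corner_x Z j l)"
    and y: "corner_y Z i k + s * (corner_y Z i (Suc k) - corner_y Z i k) =
       corner_y Z j l + t * (corner_y Z j (Suc l) - corner_y Z j l)"
    and X: "\<forall>c\<in>set X. crossing_ok Z c"
    and s: "0 \<le> s" "s < 1" and t: "0 \<le> t" "t < 1"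
  shows "(i, real k + s) = (j, real l + t) \<or>
    ((i, real k + s), (j, real l + t)) \<in> set (crossing_list X) \<or>
    ((j, real l + t), (i, real k + s)) \<in> set (crossing_list X)"
proof (cases "i = j \<and> k = l")
  case True
  define dx dy where "dx = corner_x Z i (Suc k) - corner_x Z i k" and "dy = corner_y Z i (Suc k) - corner_y Z i k"
  have "dx \<noteq> 0 \<or> dy \<noteq> 0" using ok True by (simp add: edge_pair_ok_def dx_def dy_def)
  moreover have "(s - t) * real_of_int dx = 0" "(s - t) * real_of_int dy = 0"
    using x y True unfolding dx_def dy_def of_int_diff by (simp_all add: left_diff_distrib)
  ultimately show ?thesis using True by auto
next
  case False
  define d m n where "d = turn Z i k j l" and "m = offset_turn Z i k j l j l" and "n = offset_turn Z i k j l i k"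
  have sd: "s * d = m" and td: "t * d = n"
    using cramer[OF x y] by (simp_all only: d_def m_def n_def turn_def offset_turn_def of_int_diff of_int_mult)
  have sdd: "s * (real_of_int d * real_of_int d) = real_of_int m * real_of_int d"
    "t * (real_of_int d * real_of_int d) = real_of_int n * real_of_int d"
    by (simp_all flip: sd td)
  have ne: "d \<noteq> 0"
  proof
    assume "d = 0"
    with sd have "m = 0" by simp
    with ok False \<open>d = 0\<close> show False by (simp add: edge_pair_ok_def d_def m_def)
  qed
  then have pos: "0 < real_of_int d * real_of_int d" by (simp add: zero_less_mult_iff) linarith
  have "0 \<le> u * (real_of_int d * real_of_int d)" "u * (real_of_int d * real_of_int d) < real_of_int d * real_of_int d"
    if "0 \<le> u" "u < 1" for u :: real
    using that pos mult_strict_right_mono[of u 1 "real_of_int d * real_of_int d"] by simp_all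
  from this[OF s] this[OF t]
  have "0 \<le> real_of_int (m * d)" "real_of_int (m * d) < real_of_int (d * d)"
    "0 \<le> real_of_int (n * d)" "real_of_int (n * d) < real_of_int (d * d)"
    by (simp_all only: sdd of_int_mult)
  then have nots: "\<not> m * d < 0" "\<not> n * d < 0" "\<not> d * d \<le> m * d" "\<not> d * d \<le> n * d"
    by linarith+
  have "\<exists>((i', k', a, c), (j', l', b, e))\<in>set X.
    (i' = i \<and> k' = k \<and> j' = j \<and> l' = l \<and> m * c = a * d \<and> n * e = b * d) \<or>
    (i' = j \<and> k' = l \<and> j' = i \<and> l' = k \<and> n * c = a * d \<and> m * e = b * d)"
    using ok ne nots
    unfolding edge_pair_ok_def if_not_P[OF False] Let_def d_def[symmetric] m_def[symmetric] n_def[symmetric]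
    by (simp only: if_False simp_thms)
  then obtain p where p: "p \<in> set X" "(\<lambda>((i', k', a, c), (j', l', b, e)).
    (i' = i \<and> k' = k \<and> j' = j \<and> l' = l \<and> m * c = a * d \<and> n * e = b * d) \<or>
    (i' = j \<and> k' = l \<and> j' = i \<and> l' = k \<and> n * c = a * d \<and> m * e = b * d)) p"
    by (rule bexE)
  obtain i' k' a c j' l' b e where p_eq: "p = ((i', k', a, c), (j', l', b, e))"
    by (metis surj_pair)
  have X': "((i', k', a, c), (j', l', b, e)) \<in> set X" using p(1) by (simp only: p_eq)
  have disj: "(i' = i \<and> k' = k \<and> j' = j \<and> l' = l \<and> m * c = a * d \<and> n * e = b * d) \<or>
           (i' = j \<and> k' = l \<and> j' = i \<and> l' = k \<and> n * c = a * d \<and> m * e = b * d)"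
    using p(2) by (simp only: p_eq prod.case)
  have c: "c > 0" "e > 0" using X X' by (auto simp: crossing_ok_def)
  have frac: "u = of_int f / of_int g" if "u * of_int d = of_int r" "r * g = f * d" "g > 0" for u :: real and f g r
  proof -
    have "u * of_int g * of_int d = of_int f * of_int d"
      using that(1,2) by (metis (no_types, opaque_lifting) mult.assoc mult.commute of_int_mult)
    then show ?thesis using ne that(3) by (simp add: field_simps)
  qed
  from disj show ?thesis
  proof (elim disjE conjE)
    assume eq: "i' = i" "k' = k" "j' = j" "l' = l" and "m * c = a * d" "n * e = b * d"
    then have st: "s = a / c" "t = b / e" using frac[OF sd] frac[OF td] c by simp_all
    have "map_prod edge_position edge_position ((i', k', a, c), (j', l', b, e)) \<in> set (crossing_list X)"
      unfolding crossing_list_def set_map using X' by (rule imageI)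
    then show ?thesis unfolding edge_position_def by (simp add: eq st)
  next
    assume eq: "i' = j" "k' = l" "j' = i" "l' = k" and "n * c = a * d" "m * e = b * d"
    then have st: "s = b / e" "t = a / c" using frac[OF sd] frac[OF td] c by simp_all
    have "map_prod edge_position edge_position ((i', k', a, c), (j', l', b, e)) \<in> set (crossing_list X)"
      unfolding crossing_list_def set_map using X' by (rule imageI)
    then show ?thesis unfolding edge_position_def by (simp add: eq st)
  qed
qed

lemma disjoint_pairs:
  assumes "distinct (concat (map (\<lambda>(x, y). [x, y]) xs))"
    and "(x, y) \<in> set xs" "(x', y') \<in> set xs" "{x, y} \<inter> {x', y'} \<noteq> {}"
  shows "x = x' \<and> y = y' \<and> x \<noteq> y"
  using assms by (induction xs) auto

locale checked_diagram =
  fixes Z :: "lattice_point list list" and X :: "(edge_point \<times> edge_point) list"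
  assumes ok: "diagram_ok Z X"
    and distinct: "distinct (concat (map (\<lambda>(x, y). [x, y]) (crossing_list X)))"
begin

abbreviation D where "D \<equiv> polygons Z"

lemma nonempty: "i < length Z \<Longrightarrow> Z ! i \<noteq> []"
proof -
  assume "i < length Z"
  then have "3 \<le> length (Z ! i)" using ok nth_mem unfolding diagram_ok_def by blast
  then show "Z ! i \<noteq> []" by auto
qed

lemma X_ok: "\<forall>c\<in>set X. crossing_ok Z c"
  using ok unfolding diagram_ok_def by blast

lemma meeting:
  assumes "x \<in> positions D" "y \<in> positions D" "proj (point_at D x) = proj (point_at D y)"
  shows "x = y \<or> (x, y) \<in> set (crossing_list X) \<or> (y, x) \<in> set (crossing_list X)"
proof -
  obtain i k s where x: "x = (i, real k + s)" "i < length Z" "k < length (Z ! i)" "0 \<le> s" "s < 1"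
    using assms(1) by (rule positions_polygons)
  obtain j l t where y: "y = (j, real l + t)" "j < length Z" "l < length (Z ! j)" "0 \<le> t" "t < 1"
    using assms(2) by (rule positions_polygons)
  have "edge_pair_ok Z X i k j l"
    using ok x(2,3) y(2,3) unfolding diagram_ok_def by simp
  moreover have "corner_x Z i k + s * (corner_x Z i (Suc k) - corner_x Z i k) =
       corner_x Z j l + t * (corner_x Z j (Suc l) - corner_x Z j l)"
     "corner_y Z i k + s * (corner_y Z i (Suc k) - corner_y Z i k) =
       corner_y Z j l + t * (corner_y Z j (Suc l) - corner_y Z j l)"
    using assms(3)
    unfolding x(1) y(1) point_at_edge[OF x(2) nonempty[OF x(2)] x(4,5)] point_at_edge[OF y(2) nonempty[OF y(2)] y(4,5)]
      proj_edge by simp_all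
  ultimately show ?thesis
    unfolding x(1) y(1) using X_ok x(4,5) y(4,5) by (rule edge_pair_ok_cases)
qed

lemma listed_crossing:
  assumes "(x, y) \<in> set (crossing_list X)"
  shows "(x, y) \<in> crossings D" "snd x \<notin> \<int>" "snd y \<notin> \<int>"
proof -
  obtain i k a c j l b e where X': "((i, k, a, c), (j, l, b, e)) \<in> set X"
    and x: "x = (i, real k + a / c)" and y: "y = (j, real l + b / e)"
    using assms by (auto simp: crossing_list_def edge_position_def)
  from X' X_ok have ok: "crossing_ok Z ((i, k, a, c), (j, l, b, e))" by blast
  then have pos: "0 < a" "a < c" "0 < b" "b < e" and
    i: "i < length Z" "k < length (Z ! i)" "j < length Z" "l < length (Z ! j)"
    by (auto simp: crossing_ok_def)
  define s t :: real where "s = a / c" and "t = b / e"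
  have s: "0 < s" "s < 1" and t: "0 < t" "t < 1" using pos by (auto simp: s_def t_def)
  have notint: "real k + s \<notin> \<int>" if "0 < s" "s < 1" for k and s :: real
  proof
    assume "real k + s \<in> \<int>"
    then obtain r :: int where "real k + s = of_int r" by (rule Ints_cases)
    then have "0 < real_of_int (r - int k)" "real_of_int (r - int k) < real_of_int 1" using that by simp_all
    then show False unfolding of_int_0_less_iff of_int_less_iff by simp
  qed
  have xs: "x = (i, real k + s)" and yt: "y = (j, real l + t)" by (simp_all add: x y s_def t_def)
  show "snd x \<notin> \<int>" "snd y \<notin> \<int>" 
    unfolding xs yt snd_conv by (rule notint[OF s], rule notint[OF t])
  have "real k + s < real (length (Z ! i))" "real l + t < real (length (Z ! j))" using i s t by linarith+
  then have positions: "x \<in> positions D" "y \<in> positions D"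
    using i s t by (simp_all add: positions_def xs yt)
  have px: "point_at D x = (1 - s) *\<^sub>R lattice_vec (corner Z i k) + s *\<^sub>R lattice_vec (corner Z i (Suc k))"
    unfolding xs using i s by (intro point_at_edge nonempty) simp_all
  have py: "point_at D y = (1 - t) *\<^sub>R lattice_vec (corner Z j l) + t *\<^sub>R lattice_vec (corner Z j (Suc l))"
    unfolding yt using i t by (intro point_at_edge nonempty) simp_all
  \<comment> \<open>Clearing the denominators turns the integer conditions into conditions on the points.\<close>
  have cs: "real_of_int c * s = of_int a" and et: "real_of_int e * t = of_int b" using pos by (simp_all add: s_def t_def)
  have scale_s: "real_of_int c * (real_of_int e * ((1 - s) * of_int p + s * of_int q)) = of_int (e * ((c - a) * p + a * q))" for p q
  proof -
    have "real_of_int c * (of_int e * ((1 - s) * of_int p + s * of_int q)) =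
      of_int e * ((of_int c - of_int c * s) * of_int p + (of_int c * s) * of_int q)" by (simp add: algebra_simps)
    then show ?thesis by (simp add: cs)
  qed
  have scale_t: "real_of_int c * (real_of_int e * ((1 - t) * of_int p + t * of_int q)) = of_int (c * ((e - b) * p + b * q))" for p q
  proof -
    have "real_of_int c * (of_int e * ((1 - t) * of_int p + t * of_int q)) =
      of_int c * ((of_int e - of_int e * t) * of_int p + (of_int e * t) * of_int q)" by (simp add: algebra_simps)
    then show ?thesis by (simp add: et)
  qed
  have c: "real_of_int c > 0" "real_of_int e > 0" using pos by simp_all
  have eq: "(1 - s) * of_int p + s * of_int q = (1 - t) * of_int p' + t * of_int q'"
    if "e * ((c - a) * p + a * q) = c * ((e - b) * p' + b * q')" for p q p' q'
    using arg_cong[OF that, of real_of_int] c unfolding scale_s[symmetric] scale_t[symmetric] by simp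
  have less: "(1 - t) * of_int p' + t * of_int q' < (1 - s) * of_int p + s * of_int q"
    if "c * ((e - b) * p' + b * q') < e * ((c - a) * p + a * q)" for p q p' q'
    using that[folded of_int_less_iff[where 'a = real]] c
    unfolding scale_s[symmetric] scale_t[symmetric] mult_less_cancel_left_pos[OF c(1)] mult_less_cancel_left_pos[OF c(2)]
    by blast
  have "(1 - s) * corner_x Z i k + s * corner_x Z i (Suc k) = (1 - t) * corner_x Z j l + t * corner_x Z j (Suc l)"
    "(1 - s) * corner_y Z i k + s * corner_y Z i (Suc k) = (1 - t) * corner_y Z j l + t * corner_y Z j (Suc l)"
    "(1 - t) * corner_z Z j l + t * corner_z Z j (Suc l) < (1 - s) * corner_z Z i k + s * corner_z Z i (Suc k)"
    using ok unfolding crossing_ok_def prod.case by (blast intro: eq less)+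
  then show "(x, y) \<in> crossings D"
    using positions by (simp add: crossings_def px py proj_def corner_x_def corner_y_def corner_z_def)
qed

lemma crossings_eq: "crossings D = set (crossing_list X)"
proof (intro Set.set_eqI iffI; clarify?)
  fix x y assume xy: "(x, y) \<in> crossings D"
  then have "x \<noteq> y" "(y, x) \<notin> crossings D" by (auto simp: crossings_def)
  moreover have "x \<in> positions D" "y \<in> positions D" "proj (point_at D x) = proj (point_at D y)"
    using xy by (auto simp: crossings_def)
  ultimately show "(x, y) \<in> set (crossing_list X)" using meeting listed_crossing(1) by blast
qed (rule listed_crossing)

lemma polygonal_link: "polygonal_link D"
  unfolding polygonal_link_def
proof (intro conjI inj_onI)
  show "D \<noteq> []" "\<forall>vs\<in>set D. 3 \<le> length vs" using ok by (auto simp: diagram_ok_def polygons_def)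
  fix x y assume "x \<in> positions D" "y \<in> positions D" and eq: "point_at D x = point_at D y"
  then have "x = y \<or> (x, y) \<in> set (crossing_list X) \<or> (y, x) \<in> set (crossing_list X)" by (intro meeting) simp_all
  moreover have "(x, y) \<notin> crossings D" "(y, x) \<notin> crossings D" using eq by (auto simp: crossings_def)
  ultimately show "x = y" using listed_crossing(1) by blast
qed

lemma regular_position: "regular_position D"
  unfolding regular_position_def
proof (intro conjI ballI impI)
  show "finite (crossings D)" by (simp add: crossings_eq)
  fix x y z assume xyz: "x \<in> positions D" "y \<in> positions D" "z \<in> positions D"
    "proj (point_at D x) = proj (point_at D y) \<and> proj (point_at D y) = proj (point_at D z)"
  show "x = y \<or> y = z \<or> x = z"
  proof (rule ccontr)
    assume ne: "\<not> (x = y \<or> y = z \<or> x = z)"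
    then have "(x, y) \<in> set (crossing_list X) \<or> (y, x) \<in> set (crossing_list X)"
      "(y, z) \<in> set (crossing_list X) \<or> (z, y) \<in> set (crossing_list X)"
      using meeting xyz by metis+
    then show False using disjoint_pairs[OF distinct] ne by (elim disjE) blast+
  qed
next
  fix c assume "c \<in> crossings D"
  then show "case c of (x, y) \<Rightarrow> snd x \<notin> \<int> \<and> snd y \<notin> \<int>"
    using listed_crossing by (auto simp: crossings_eq)
qed

lemma direction_edge:
  assumes "i < length Z" "0 \<le> s" "s < 1"
  shows "direction D (i, real k + s) =
    (of_int (corner_x Z i (Suc k) - corner_x Z i k), of_int (corner_y Z i (Suc k) - corner_y Z i k))"
proof -
  have "int k + 1 = int (Suc k)" by simp
  then show ?thesis
    using assms vertex_polygons[OF assms(1) nonempty[OF assms(1)]]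
    by (simp only: direction_def prod.case floor_edge)
      (simp add: proj_def corner_x_def corner_y_def)
qed

lemma under_right_to_left_iff:
  assumes "((i, k, a, c), (j, l, b, e)) \<in> set X"
  shows "under_right_to_left D (edge_position (i, k, a, c), edge_position (j, l, b, e)) \<longleftrightarrow> 0 < turn Z i k j l"
proof -
  have ok: "crossing_ok Z ((i, k, a, c), (j, l, b, e))" using assms X_ok by blast
  then have "0 < a" "a < c" "0 < b" "b < e" "i < length Z" "j < length Z" by (auto simp: crossing_ok_def)
  then have "direction D (edge_position (i, k, a, c)) =
      (of_int (corner_x Z i (Suc k) - corner_x Z i k), of_int (corner_y Z i (Suc k) - corner_y Z i k))"
    "direction D (edge_position (j, l, b, e)) =
      (of_int (corner_x Z j (Suc l) - corner_x Z j l), of_int (corner_y Z j (Suc l) - corner_y Z j l))"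
    by (simp_all add: edge_position_def direction_edge)
  then have "under_right_to_left D (edge_position (i, k, a, c), edge_position (j, l, b, e)) \<longleftrightarrow>
    0 < real_of_int (turn Z i k j l)"
    unfolding under_right_to_left_def turn_def by simp
  then show ?thesis by simp
qed

end

section \<open>Links of polygons\<close>

text \<open>
  The formula includes both ends of the edge, so continuity can be glued from closed intervals.
\<close>

lemma polygon_at_edge:
  assumes "real k \<le> u" "u \<le> real k + 1"
  shows "polygon_at vs u = (1 - (u - real k)) *\<^sub>R vertex vs (int k) + (u - real k) *\<^sub>R vertex vs (int k + 1)"
proof (cases "u = real k + 1")
  case True
  then have floor: "\<lfloor>u\<rfloor> = int k + 1" and frac: "frac u = 0" by (simp_all add: frac_def)
  show ?thesis unfolding polygon_at_def floor frac using True by simp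
next
  case False
  then have floor: "\<lfloor>u\<rfloor> = int k" using assms by linarith
  show ?thesis unfolding polygon_at_def frac_def floor by simp
qed

lemma continuous_on_polygon_at: "continuous_on {0..real n} (polygon_at vs)"
proof (induction n)
  case (Suc n)
  have "continuous_on {real n..real n + 1} (\<lambda>u. (1 - (u - real n)) *\<^sub>R vertex vs (int n) + (u - real n) *\<^sub>R vertex vs (int n + 1))"
    by (intro continuous_intros)
  then have "continuous_on {real n..real n + 1} (polygon_at vs)"
    by (rule continuous_on_eq) (simp add: polygon_at_edge[of n])
  then have "continuous_on ({0..real n} \<union> {real n..real n + 1}) (polygon_at vs)"
    by (intro continuous_on_closed_Un Suc) auto
  moreover have "{0..real n} \<union> {real n..real n + 1} = {0..real (Suc n)}" by auto
  ultimately show ?case by simp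
qed simp

lemma inv_stereo_sphere: "inv_stereo p \<in> S3"
proof -
  define r where "r = (norm p)\<^sup>2"
  have r: "r + 1 > 0" by (simp add: r_def add_nonneg_pos)
  have "(norm (inv_stereo p))\<^sup>2 = (norm ((2 / (r + 1)) *\<^sub>R p))\<^sup>2 + ((r - 1) / (r + 1))\<^sup>2"
    by (simp add: inv_stereo_def norm_Pair r_def power_divide)
  also have "\<dots> = (2 / (r + 1))\<^sup>2 * r + ((r - 1) / (r + 1))\<^sup>2"
    by (simp add: power_mult_distrib power_divide r_def)
  also have "\<dots> = (4 * r + (r - 1)\<^sup>2) / (r + 1)\<^sup>2"
    by (simp add: power_divide add_divide_distrib)
  also have "4 * r + (r - 1)\<^sup>2 = (r + 1)\<^sup>2" by (simp add: power2_eq_square algebra_simps)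
  finally have "(norm (inv_stereo p))\<^sup>2 = 1" using r by simp
  moreover have "norm (inv_stereo p) = sqrt ((norm (inv_stereo p))\<^sup>2)" by simp
  ultimately have "norm (inv_stereo p) = 1" by (simp only: real_sqrt_one)
  then show ?thesis by simp
qed

lemma continuous_on_inv_stereo: "continuous_on A inv_stereo"
proof -
  have "(norm p)\<^sup>2 + 1 \<noteq> 0" for p :: "real^3"
    by (metis add_nonneg_pos less_irrefl zero_le_power2 zero_less_one)
  then show ?thesis unfolding inv_stereo_def[abs_def] by (intro continuous_intros) auto
qed

lemma inj_inv_stereo: "inj inv_stereo"
proof (rule injI)
  fix p q assume eq: "inv_stereo p = inv_stereo q"
  define r s where "r = (norm p)\<^sup>2" and "s = (norm q)\<^sup>2"
  have pos: "r + 1 > 0" "s + 1 > 0" by (simp_all add: r_def s_def add_nonneg_pos)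
  have "(r - 1) / (r + 1) = (s - 1) / (s + 1)" using eq by (simp add: inv_stereo_def r_def s_def)
  then have "(r - 1) * (s + 1) = (s - 1) * (r + 1)" using pos by (simp add: frac_eq_eq)
  then have rs: "r = s" by (simp add: algebra_simps)
  have "(2 / (r + 1)) *\<^sub>R p = (2 / (s + 1)) *\<^sub>R q" using eq by (simp add: inv_stereo_def r_def s_def)
  then show "p = q" using rs pos by simp
qed

text \<open>
  Since a polygonal link is a link already, the constant isotopy shows that it has itself as a diagram.
\<close>

definition link_of :: "polygon list \<Rightarrow> link"
  where "link_of D = map (\<lambda>vs s. inv_stereo (polygon_at vs (s * real (length vs)))) D"

lemma polygon_at_periodic: "polygon_at vs (real (length vs)) = polygon_at vs 0"
  by (simp add: polygon_at_def vertex_def frac_def)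

lemma oriented_link_of:
  assumes D: "polygonal_link D" shows "oriented_link (link_of D)"
proof -
  have inj: "i = j \<and> u = v"
    if "polygon_at (D ! i) u = polygon_at (D ! j) v" "i < length D" "j < length D"
      "0 \<le> u" "u < real (length (D ! i))" "0 \<le> v" "v < real (length (D ! j))" for i j u v
  proof -
    have "inj_on (point_at D) (positions D)" using D by (simp add: polygonal_link_def)
    then have "(i, u) = (j, v)" by (rule inj_onD) (use that in \<open>auto simp: point_at_def positions_def\<close>)
    then show ?thesis by simp
  qed
  have len: "length (D ! i) > 0" if "i < length D" for i
  proof -
    have "3 \<le> length (D ! i)" using D that nth_mem unfolding polygonal_link_def by blast
    then show ?thesis by linarith
  qed
  let ?K = "\<lambda>i s. inv_stereo (polygon_at (D ! i) (s * real (length (D ! i))))"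
  have comp: "link_of D ! i = ?K i" if "i < length D" for i using that by (simp add: link_of_def)
  have wrap: "\<exists>u. 0 \<le> u \<and> u < real (length (D ! i)) \<and> ?K i s = inv_stereo (polygon_at (D ! i) u) \<and>
      u = (if s = 1 then 0 else s * real (length (D ! i)))"
    if "i < length D" "s \<in> {0..1}" for i s
    using that len[of i] by (auto simp: polygon_at_periodic)
  have K: "simple_path (?K i)" "pathfinish (?K i) = pathstart (?K i)" "path_image (?K i) \<subseteq> S3" if i: "i < length D" for i
  proof -
    show "pathfinish (?K i) = pathstart (?K i)" by (simp add: pathfinish_def pathstart_def polygon_at_periodic)
    show "path_image (?K i) \<subseteq> S3" unfolding path_image_def using inv_stereo_sphere by blast
    have "continuous_on {0..1} (polygon_at (D ! i) \<circ> (\<lambda>s. s * real (length (D ! i))))"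
    proof (rule continuous_on_compose)
      have "(\<lambda>s. s * real (length (D ! i))) ` {0..1} \<subseteq> {0..real (length (D ! i))}"
        using mult_right_mono[of _ 1 "real (length (D ! i))"] by auto
      then show "continuous_on ((\<lambda>s. s * real (length (D ! i))) ` {0..1}) (polygon_at (D ! i))"
        by (rule continuous_on_subset[OF continuous_on_polygon_at])
    qed (intro continuous_intros)
    then have "path (?K i)"
      unfolding path_def o_def by (rule continuous_on_compose2[OF continuous_on_inv_stereo]) (rule subset_UNIV)
    moreover have "s = t \<or> s = 0 \<and> t = 1 \<or> s = 1 \<and> t = 0"
      if st: "s \<in> {0..1}" "t \<in> {0..1}" "?K i s = ?K i t" for s t
    proof -
      obtain u v where uv: "0 \<le> u" "u < real (length (D ! i))" "?K i s = inv_stereo (polygon_at (D ! i) u)"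
        "u = (if s = 1 then 0 else s * real (length (D ! i)))"
        "0 \<le> v" "v < real (length (D ! i))" "?K i t = inv_stereo (polygon_at (D ! i) v)"
        "v = (if t = 1 then 0 else t * real (length (D ! i)))"
        using wrap[OF i st(1)] wrap[OF i st(2)] by blast
      then have "polygon_at (D ! i) u = polygon_at (D ! i) v"
        using st(3) inj_inv_stereo by (metis injD)
      then have "u = v" using inj[OF _ i i] uv by blast
      then show ?thesis using uv(4,8) len[OF i] by (auto split: if_splits)
    qed
    ultimately show "simple_path (?K i)"
      unfolding simple_path_def loop_free_def by blast
  qed
  have disj: "path_image (?K i) \<inter> path_image (?K j) = {}" if "i < length D" "j < length D" "i \<noteq> j" for i j
  proof -
    have False if st: "s \<in> {0..1}" "t \<in> {0..1}" "?K i s = ?K j t" for s t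
    proof -
      obtain u v where uv: "0 \<le> u" "u < real (length (D ! i))" "?K i s = inv_stereo (polygon_at (D ! i) u)"
        "0 \<le> v" "v < real (length (D ! j))" "?K j t = inv_stereo (polygon_at (D ! j) v)"
        using wrap[OF \<open>i < length D\<close> st(1)] wrap[OF \<open>j < length D\<close> st(2)] by blast
      then have "polygon_at (D ! i) u = polygon_at (D ! j) v"
        using st(3) inj_inv_stereo by (metis injD)
      then show False using inj[OF _ \<open>i < length D\<close> \<open>j < length D\<close>] uv \<open>i \<noteq> j\<close> by blast
    qed
    then show ?thesis unfolding path_image_def by blast
  qed
  show ?thesis
    unfolding oriented_link_def
  proof (intro conjI ballI allI impI)
    show "link_of D \<noteq> []" using D by (simp add: link_of_def polygonal_link_def)
    have len': "length (link_of D) = length D" by (simp add: link_of_def)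
    fix k assume "k \<in> set (link_of D)"
    then obtain i where "i < length D" "k = ?K i" by (auto simp: in_set_conv_nth comp len')
    then show "simple_path k" "pathfinish k = pathstart k" "path_image k \<subseteq> S3" using K by auto
  next
    fix i j assume "i < length (link_of D)" "j < length (link_of D)" "i \<noteq> j"
    then show "path_image (link_of D ! i) \<inter> path_image (link_of D ! j) = {}"
      using disj comp by (simp add: link_of_def)
  qed
qed

lemma isotopic_link_of:
  assumes D: "polygonal_link D" shows "isotopic_to_polygons (link_of D) D"
  unfolding isotopic_to_polygons_def
proof (intro conjI exI[of _ "\<lambda>s p. p"] allI impI ballI)
  show "length D = length (link_of D)" by (simp add: link_of_def)
  show "continuous_on ({0..1} \<times> S3) (\<lambda>(s :: real, p). p)"
    by (simp add: case_prod_unfold continuous_on_snd)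
  show "\<exists>G. homeomorphism S3 S3 (\<lambda>p. p) G" using homeomorphism_ident by blast
  fix i assume i: "i < length (link_of D)"
  then have "3 \<le> length (D ! i)"
    using D nth_mem[of i D] unfolding polygonal_link_def link_of_def by auto
  then have "0 < length (D ! i)" by linarith
  then show "\<exists>f :: real \<Rightarrow> real. continuous_on {0..1} f \<and> strict_mono_on {0..1} f \<and>
      f 1 = f 0 + real (length (D ! i)) \<and>
      (\<forall>s\<in>{0..1}. (link_of D ! i) s = inv_stereo (polygon_at (D ! i) (f s)))"
    using i by (intro exI[of _ "\<lambda>s. s * real (length (D ! i))"])
      (auto simp: link_of_def strict_mono_on_def intro!: continuous_intros)
qed simp

lemma classical_link_of: "polygonal_link D \<Longrightarrow> classical_link (link_of D)"
  unfolding classical_link_def using oriented_link_of isotopic_link_of by blast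

lemma diagram_of_link_of: "polygonal_link D \<Longrightarrow> regular_position D \<Longrightarrow> diagram_of D (link_of D)"
  by (simp add: diagram_of_def isotopic_link_of)

section \<open>Two diagrams\<close>

text \<open>
  The projection of the knot has three crossings. For \<open>z = 1\<close> the diagram alternates and is a trefoil;
  lowering the fifth vertex to the height \<open>z = 0\<close> changes exactly one crossing and makes the knot
  trivial.
\<close>

definition knot :: "int \<Rightarrow> lattice_point list"
  where "knot z = [(1, 4, 0), (0, 3, -2), (0, 2, 3), (2, 1, -2), (2, 3, z), (0, 1, 1), (1, 1, 1)]"

text \<open>
  An unknot that bounds a disc next to the changing crossing; the disc meets the knot in two points,
  with opposite signs. A full twist along the disc changes the crossing, so the complements of the two
  links are homeomorphic.
\<close>

definition circle :: "lattice_point list"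
  where "circle = [(3, 1, 0), (6, 6, -1), (0, 4, 0)]"

text \<open>
  The over position of each crossing comes first.
\<close>

definition shared_crossings :: "(edge_point \<times> edge_point) list"
  where "shared_crossings =
    [((1, 2, 1, 6), (0, 0, 1, 2)), ((0, 2, 1, 3), (0, 4, 2, 3)), ((0, 6, 1, 6), (0, 2, 1, 2)),
     ((1, 2, 2, 3), (0, 3, 1, 2)), ((0, 4, 1, 4), (1, 2, 1, 2)), ((0, 6, 2, 3), (1, 2, 1, 3))]"

definition changed_crossing :: "edge_point \<times> edge_point"
  where "changed_crossing = ((0, 4, 1, 2), (0, 6, 1, 3))"

definition trefoil_diagram :: "polygon list"
  where "trefoil_diagram = polygons [knot 1, circle]"

definition unknot_diagram :: "polygon list"
  where "unknot_diagram = polygons [knot 0, circle]"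

lemma trefoil_ok: "diagram_ok [knot 1, circle] (changed_crossing # shared_crossings)"
  by code_simp

lemma unknot_ok: "diagram_ok [knot 0, circle] (prod.swap changed_crossing # shared_crossings)"
  by code_simp

interpretation trefoil: checked_diagram "[knot 1, circle]" "changed_crossing # shared_crossings"
proof
  show "distinct (concat (map (\<lambda>(x, y). [x, y]) (crossing_list (changed_crossing # shared_crossings))))"
    by (simp add: crossing_list_def changed_crossing_def shared_crossings_def edge_position_def)
qed (rule trefoil_ok)

interpretation unknot: checked_diagram "[knot 0, circle]" "prod.swap changed_crossing # shared_crossings"
proof
  show "distinct (concat (map (\<lambda>(x, y). [x, y]) (crossing_list (prod.swap changed_crossing # shared_crossings))))"
    by (simp add: crossing_list_def changed_crossing_def shared_crossings_def edge_position_def)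
qed (rule unknot_ok)

lemma crossings_trefoil: "crossings trefoil_diagram =
    {((0, 9/2), (0, 19/3)), ((1, 13/6), (0, 1/2)), ((0, 7/3), (0, 14/3)), ((0, 37/6), (0, 5/2)),
     ((1, 8/3), (0, 7/2)), ((0, 17/4), (1, 5/2)), ((0, 20/3), (1, 7/3))}"
  using trefoil.crossings_eq
  by (simp add: trefoil_diagram_def crossing_list_def changed_crossing_def shared_crossings_def edge_position_def)

lemma crossings_unknot: "crossings unknot_diagram =
    {((0, 19/3), (0, 9/2)), ((1, 13/6), (0, 1/2)), ((0, 7/3), (0, 14/3)), ((0, 37/6), (0, 5/2)),
     ((1, 8/3), (0, 7/2)), ((0, 17/4), (1, 5/2)), ((0, 20/3), (1, 7/3))}"
  using unknot.crossings_eq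
  by (simp add: unknot_diagram_def crossing_list_def changed_crossing_def shared_crossings_def edge_position_def)

lemma under_params_trefoil:
  "under_params trefoil_diagram 0 = set [1/2, 5/2, 7/2, 14/3, 19/3]"
  "under_params trefoil_diagram 1 = set [7/3, 5/2]"
  by (auto simp: under_params_def crossings_trefoil)

lemma under_params_unknot:
  "under_params unknot_diagram 0 = set [1/2, 5/2, 7/2, 9/2, 14/3]"
  "under_params unknot_diagram 1 = set [7/3, 5/2]"
  by (auto simp: under_params_def crossings_unknot)

lemma turns_trefoil:
  "\<not> 0 < turn [knot 1, circle] 0 4 0 6"
  "\<not> 0 < turn [knot 1, circle] 1 2 0 0"
  "\<not> 0 < turn [knot 1, circle] 0 2 0 4"
  "\<not> 0 < turn [knot 1, circle] 0 6 0 2"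
  "0 < turn [knot 1, circle] 1 2 0 3"
  "0 < turn [knot 1, circle] 0 4 1 2"
  "\<not> 0 < turn [knot 1, circle] 0 6 1 2"
  by code_simp+

lemma orientations_trefoil:
  "\<not> under_right_to_left trefoil_diagram ((0, 9/2), (0, 19/3))"
  "\<not> under_right_to_left trefoil_diagram ((1, 13/6), (0, 1/2))"
  "\<not> under_right_to_left trefoil_diagram ((0, 7/3), (0, 14/3))"
  "\<not> under_right_to_left trefoil_diagram ((0, 37/6), (0, 5/2))"
  "under_right_to_left trefoil_diagram ((1, 8/3), (0, 7/2))"
  "under_right_to_left trefoil_diagram ((0, 17/4), (1, 5/2))"
  "\<not> under_right_to_left trefoil_diagram ((0, 20/3), (1, 7/3))"
  using turns_trefoil
    trefoil.under_right_to_left_iff[of 0 4 1 2 0 6 1 3]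
    trefoil.under_right_to_left_iff[of 1 2 1 6 0 0 1 2]
    trefoil.under_right_to_left_iff[of 0 2 1 3 0 4 2 3]
    trefoil.under_right_to_left_iff[of 0 6 1 6 0 2 1 2]
    trefoil.under_right_to_left_iff[of 1 2 2 3 0 3 1 2]
    trefoil.under_right_to_left_iff[of 0 4 1 4 1 2 1 2]
    trefoil.under_right_to_left_iff[of 0 6 2 3 1 2 1 3]
  by (simp_all add: trefoil_diagram_def changed_crossing_def shared_crossings_def edge_position_def)

lemma turns_unknot:
  "0 < turn [knot 0, circle] 0 6 0 4"
  "\<not> 0 < turn [knot 0, circle] 1 2 0 0"
  "\<not> 0 < turn [knot 0, circle] 0 2 0 4"
  "\<not> 0 < turn [knot 0, circle] 0 6 0 2"
  "0 < turn [knot 0, circle] 1 2 0 3"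
  "0 < turn [knot 0, circle] 0 4 1 2"
  "\<not> 0 < turn [knot 0, circle] 0 6 1 2"
  by code_simp+

lemma orientations_unknot:
  "under_right_to_left unknot_diagram ((0, 19/3), (0, 9/2))"
  "\<not> under_right_to_left unknot_diagram ((1, 13/6), (0, 1/2))"
  "\<not> under_right_to_left unknot_diagram ((0, 7/3), (0, 14/3))"
  "\<not> under_right_to_left unknot_diagram ((0, 37/6), (0, 5/2))"
  "under_right_to_left unknot_diagram ((1, 8/3), (0, 7/2))"
  "under_right_to_left unknot_diagram ((0, 17/4), (1, 5/2))"
  "\<not> under_right_to_left unknot_diagram ((0, 20/3), (1, 7/3))"
  using turns_unknot
    unknot.under_right_to_left_iff[of 0 6 1 3 0 4 1 2]
    unknot.under_right_to_left_iff[of 1 2 1 6 0 0 1 2]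
    unknot.under_right_to_left_iff[of 0 2 1 3 0 4 2 3]
    unknot.under_right_to_left_iff[of 0 6 1 6 0 2 1 2]
    unknot.under_right_to_left_iff[of 1 2 2 3 0 3 1 2]
    unknot.under_right_to_left_iff[of 0 4 1 4 1 2 1 2]
    unknot.under_right_to_left_iff[of 0 6 2 3 1 2 1 3]
  by (simp_all add: unknot_diagram_def changed_crossing_def shared_crossings_def edge_position_def)

definition crossing_arcs :: "polygon list \<Rightarrow> crossing \<Rightarrow> position \<times> position \<times> position"
  where "crossing_arcs D c = (over_arc D c, left_arc D c, right_arc D c)"

lemma arc_at_list:
  assumes "under_params D i = set xs" "xs \<noteq> []"
  shows "arc_at D (i, u) = (i, if filter (\<lambda>v. v \<le> u) xs = [] then Max (set xs) else Max (set (filter (\<lambda>v. v \<le> u) xs)))"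
    "arc_before D (i, u) = (i, if filter (\<lambda>v. v < u) xs = [] then Max (set xs) else Max (set (filter (\<lambda>v. v < u) xs)))"
  using assms by (auto simp: arc_at_def arc_before_def Let_def filter_empty_conv)

lemma crossing_arcs_trefoil:
  "crossing_arcs trefoil_diagram ` crossings trefoil_diagram =
    {((0, 7/2), (0, 14/3), (0, 19/3)), ((1, 5/2), (0, 19/3), (0, 1/2)), ((0, 1/2), (0, 7/2), (0, 14/3)),
     ((0, 14/3), (0, 1/2), (0, 5/2)), ((1, 5/2), (0, 7/2), (0, 5/2)), ((0, 7/2), (1, 5/2), (1, 7/3)),
     ((0, 19/3), (1, 5/2), (1, 7/3))}"
  unfolding crossings_trefoil image_insert image_empty
  by (simp add: crossing_arcs_def over_arc_def left_arc_def right_arc_def orientations_trefoil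
      arc_at_list[OF under_params_trefoil(1)] arc_at_list[OF under_params_trefoil(2)]
      del: One_nat_def)

lemma crossing_arcs_unknot:
  "crossing_arcs unknot_diagram ` crossings unknot_diagram =
    {((0, 14/3), (0, 9/2), (0, 7/2)), ((1, 5/2), (0, 14/3), (0, 1/2)), ((0, 1/2), (0, 9/2), (0, 14/3)),
     ((0, 14/3), (0, 1/2), (0, 5/2)), ((1, 5/2), (0, 7/2), (0, 5/2)), ((0, 7/2), (1, 5/2), (1, 7/3)),
     ((0, 14/3), (1, 5/2), (1, 7/3))}"
  unfolding crossings_unknot image_insert image_empty
  by (simp add: crossing_arcs_def over_arc_def left_arc_def right_arc_def orientations_unknot
      arc_at_list[OF under_params_unknot(1)] arc_at_list[OF under_params_unknot(2)]
      del: One_nat_def)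

lemma length_diagrams: "length trefoil_diagram = 2" "length unknot_diagram = 2"
  by (simp_all add: trefoil_diagram_def unknot_diagram_def)

lemma (in finite_diagram) arcs_eq_under_positions:
  assumes "\<forall>i<length D. under_params D i \<noteq> {}"
  shows "arcs D = snd ` crossings D"
proof (intro equalityI subsetI)
  fix a assume "a \<in> arcs D"
  then obtain i u where a: "a = arc_at D (i, u)" "i < length D" by (auto simp: arcs_def positions_def)
  show "a \<in> snd ` crossings D"
  proof (cases rule: arc_at_cases[of i u])
    case (1 v)
    then show ?thesis using a by (simp add: under_params_def)
  next
    case 2
    then show ?thesis using a assms by blast
  qed
next
  fix a assume "a \<in> snd ` crossings D"
  then have "snd a \<in> under_params D (fst a)" by (simp add: under_params_def)
  then show "a \<in> arcs D" using under_arc by force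
qed

interpretation trefoil: finite_diagram trefoil_diagram
  by unfold_locales (simp add: crossings_trefoil)

interpretation unknot: finite_diagram unknot_diagram
  by unfold_locales (simp add: crossings_unknot)

lemma less_2_iff: "i < 2 \<longleftrightarrow> i = 0 \<or> i = 1" for i :: nat by auto

lemma arcs_trefoil:
  "arcs trefoil_diagram = {(0, 1/2), (0, 5/2), (0, 7/2), (0, 14/3), (0, 19/3), (1, 7/3), (1, 5/2)}"
  by (subst trefoil.arcs_eq_under_positions) (auto simp: length_diagrams less_2_iff under_params_trefoil crossings_trefoil simp del: One_nat_def)

lemma arcs_unknot:
  "arcs unknot_diagram = {(0, 1/2), (0, 5/2), (0, 7/2), (0, 9/2), (0, 14/3), (1, 7/3), (1, 5/2)}"
  by (subst unknot.arcs_eq_under_positions) (auto simp: length_diagrams less_2_iff under_params_unknot crossings_unknot simp del: One_nat_def)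

lemma trefoil_diagram: "polygonal_link trefoil_diagram" "regular_position trefoil_diagram"
  using trefoil.polygonal_link trefoil.regular_position by (simp_all add: trefoil_diagram_def)

lemma unknot_diagram: "polygonal_link unknot_diagram" "regular_position unknot_diagram"
  using unknot.polygonal_link unknot.regular_position by (simp_all add: unknot_diagram_def)

section \<open>The two links are Crowell equivalent\<close>

definition crossing_vector :: "position \<times> position \<times> position \<Rightarrow> position \<Rightarrow> laurent"
  where "crossing_vector = (\<lambda>(over, left, right) b. (1 - tvar (arc_component left)) * basis_vector over b +
    tvar (arc_component over) * basis_vector right b - basis_vector left b)"

lemma (in finite_diagram) crossing_vector_in_relations:
  "p \<in> crossing_arcs D ` crossings D \<Longrightarrow> crossing_vector p \<in> relations D"
  using crossing_relation_in_relations
  by (auto simp: crossing_vector_def crossing_arcs_def crossing_relation_def[abs_def])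

text \<open>
  What the twist along the disc does to meridians. Those of the knot do not change outside the part
  between the disc and the changed crossing. The arc that leaves this part at the crossing starts at
  \<open>7/2\<close> in the trefoil diagram and at \<open>9/2\<close> in the other one, where it leaves an undercrossing. The
  meridian \<open>(1, 5/2)\<close> of the circle is multiplied by a longitude of the circle, which contributes the
  difference of the two meridians of the knot that pass through the disc. The longitude is
  null-homologous, as the linking number is \<open>0\<close>, so the Crowell map is preserved. The other two values
  follow from the crossing relations.
\<close>

definition meridian_image :: "position \<Rightarrow> position \<Rightarrow> laurent"
  where "meridian_image a = (\<lambda>b.
    if a = (0, 7/2) then basis_vector (0, 9/2) b
    else if a = (0, 19/3) then
      (2 - tvar 0) * basis_vector (0, 14/3) b - (1 - tvar 0) * basis_vector (0, 7/2) b
    else if a = (1, 5/2) then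
      basis_vector (1, 5/2) b + (basis_vector (0, 14/3) b - basis_vector (0, 7/2) b)
    else if a = (1, 7/3) then
      basis_vector (1, 7/3) b + tvar_inverse 0 * (basis_vector (0, 14/3) b - basis_vector (0, 7/2) b)
    else basis_vector a b)"

text \<open>
  The opposite twist.
\<close>

definition meridian_preimage :: "position \<Rightarrow> position \<Rightarrow> laurent"
  where "meridian_preimage a = (\<lambda>b.
    if a = (0, 9/2) then basis_vector (0, 7/2) b
    else if a = (0, 7/2) then
      (2 - tvar 0) * basis_vector (0, 7/2) b - (1 - tvar 0) * basis_vector (0, 19/3) b
    else if a = (1, 5/2) then
      basis_vector (1, 5/2) b + (basis_vector (0, 7/2) b - basis_vector (0, 19/3) b)
    else if a = (1, 7/3) then
      basis_vector (1, 7/3) b + tvar_inverse 0 * (basis_vector (0, 7/2) b - basis_vector (0, 19/3) b)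
    else basis_vector a b)"

lemma tvar_0_inverse: "tvar 0 * (tvar_inverse 0 * x) = x"
  by (simp flip: mult.assoc)

lemma scalars_2 [simp]: "2 - tvar 0 \<in> scalars 2"
  using scalars_add[OF scalars_1 scalars_diff[OF scalars_1 scalars_tvar[of 0 2]]] by simp

lemma basis_vector_pair:
  "basis_vector (i, u) (j, numeral m / numeral n) = (if j = i \<and> numeral m / numeral n = u then 1 else 0)"
  "basis_vector (i, u) (j, 1 / numeral n) = (if j = i \<and> 1 / numeral n = u then 1 else 0)"
  by (simp_all add: basis_vector_def)

lemma crowell_equivalent_trefoil_unknot: "crowell_equivalent trefoil_diagram unknot_diagram"
proof -
  let ?D = trefoil_diagram and ?D' = unknot_diagram
  have id: "scalar_hom (length ?D) (length ?D') (\<lambda>p. p)" "scalar_hom (length ?D') (length ?D) (\<lambda>p. p)"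
    using scalar_hom_id by (simp_all add: length_diagrams)
  define t s where "t = tvar 0" and "s = tvar (Suc 0)"
  have ts: "t \<in> scalars 2" "s \<in> scalars 2" "tvar_inverse 0 \<in> scalars 2" "1 - t \<in> scalars 2" "1 - s \<in> scalars 2" "2 - t \<in> scalars 2"
    by (simp_all add: t_def s_def)
  have t_inverse: "t * (tvar_inverse 0 * x) = x" for x by (simp add: t_def tvar_0_inverse)
  note unfold_t = t_def[symmetric] s_def[symmetric]
  have E: "basis_vector a \<in> formal_sums ?D" if "a \<in> arcs ?D" for a using that by (rule formal_sums_basis_vector)
  have E': "basis_vector a \<in> formal_sums ?D'" if "a \<in> arcs ?D'" for a using that by (rule formal_sums_basis_vector)
  \<comment> \<open>The crossing relations \<open>q\<close> of the first and \<open>r\<close> of the second diagram.\<close>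
  define q1 where "q1 = crossing_vector ((1, 5/2), (0, 19/3), (0, 1/2))"
  define q2 where "q2 = crossing_vector ((0, 1/2), (0, 7/2), (0, 14/3))"
  define q3 where "q3 = crossing_vector ((0, 14/3), (0, 1/2), (0, 5/2))"
  define q4 where "q4 = crossing_vector ((1, 5/2), (0, 7/2), (0, 5/2))"
  define q5 where "q5 = crossing_vector ((0, 7/2), (0, 14/3), (0, 19/3))"
  define q6 where "q6 = crossing_vector ((0, 7/2), (1, 5/2), (1, 7/3))"
  define q7 where "q7 = crossing_vector ((0, 19/3), (1, 5/2), (1, 7/3))"
  note q_defs = q1_def q2_def q3_def q4_def q5_def q6_def q7_def
  have q: "q1 \<in> relations ?D" "q2 \<in> relations ?D" "q3 \<in> relations ?D" "q4 \<in> relations ?D"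
    "q5 \<in> relations ?D" "q6 \<in> relations ?D" "q7 \<in> relations ?D"
    unfolding q_defs by (rule trefoil.crossing_vector_in_relations, simp add: crossing_arcs_trefoil)+
  define r1 where "r1 = crossing_vector ((1, 5/2), (0, 14/3), (0, 1/2))"
  define r2 where "r2 = crossing_vector ((0, 1/2), (0, 9/2), (0, 14/3))"
  define r3 where "r3 = crossing_vector ((0, 14/3), (0, 1/2), (0, 5/2))"
  define r4 where "r4 = crossing_vector ((1, 5/2), (0, 7/2), (0, 5/2))"
  define r5 where "r5 = crossing_vector ((0, 14/3), (0, 9/2), (0, 7/2))"
  define r6 where "r6 = crossing_vector ((0, 7/2), (1, 5/2), (1, 7/3))"
  define r7 where "r7 = crossing_vector ((0, 14/3), (1, 5/2), (1, 7/3))"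
  note r_defs = r1_def r2_def r3_def r4_def r5_def r6_def r7_def
  have r: "r1 \<in> relations ?D'" "r2 \<in> relations ?D'" "r3 \<in> relations ?D'" "r4 \<in> relations ?D'"
    "r5 \<in> relations ?D'" "r6 \<in> relations ?D'" "r7 \<in> relations ?D'"
    unfolding r_defs by (rule unknot.crossing_vector_in_relations, simp add: crossing_arcs_unknot)+
  note q_closed = trefoil.relations_add trefoil.relations_diff trefoil.relations_uminus trefoil.relations_scale
  note r_closed = unknot.relations_add unknot.relations_diff unknot.relations_uminus unknot.relations_scale
  \<comment> \<open>The combinations to which the relations of the other diagram are sent, in the order of the crossings
    there; the last three are the defects of the two composites on generators.\<close>
  have r_mem:
    "(\<lambda>b. r1 b) \<in> relations ?D'" "(\<lambda>b. r2 b) \<in> relations ?D'" "(\<lambda>b. r3 b) \<in> relations ?D'"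
    "(\<lambda>b. r5 b + r4 b) \<in> relations ?D'" "(\<lambda>b. - ((1 - t) * r5 b)) \<in> relations ?D'"
    "(\<lambda>b. r6 b - (1 - t) * (r6 b - r7 b) - (1 - s) * r5 b) \<in> relations ?D'"
    "(\<lambda>b. r7 b - (1 - t) * (r6 b - r7 b)) \<in> relations ?D'"
    "(\<lambda>b. - ((2 - t) * r5 b)) \<in> relations ?D'" "(\<lambda>b. - r5 b) \<in> relations ?D'"
    "(\<lambda>b. - (tvar_inverse 0 * r5 b)) \<in> relations ?D'"
    by (intro r_closed r; simp add: ts length_diagrams)+
  have q_mem:
    "(\<lambda>b. q1 b + q5 b) \<in> relations ?D" "(\<lambda>b. q2 b) \<in> relations ?D" "(\<lambda>b. q3 b) \<in> relations ?D"
    "(\<lambda>b. q4 b) \<in> relations ?D" "(\<lambda>b. - ((1 - t) * q5 b)) \<in> relations ?D"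
    "(\<lambda>b. q6 b + (1 - t) * (q6 b - q7 b)) \<in> relations ?D"
    "(\<lambda>b. q7 b + (1 - t) * (q6 b - q7 b) - (1 - s) * q5 b) \<in> relations ?D"
    "(\<lambda>b. - ((2 - t) * q5 b)) \<in> relations ?D" "(\<lambda>b. - q5 b) \<in> relations ?D"
    "(\<lambda>b. - (tvar_inverse 0 * q5 b)) \<in> relations ?D"
    by (intro q_closed q; simp add: ts length_diagrams)+
  note simps = crossing_vector_def unfold_t t_inverse
  have image: "meridian_image a \<in> formal_sums ?D'" if "a \<in> arcs ?D" for a
    using that unfolding arcs_trefoil
    by (elim insertE; simp add: meridian_image_def[abs_def] unfold_t)
      (intro formal_sums_add formal_sums_diff formal_sums_scale E'; simp add: arcs_unknot ts length_diagrams)+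
  have preimage: "meridian_preimage a \<in> formal_sums ?D" if "a \<in> arcs ?D'" for a
    using that unfolding arcs_unknot
    by (elim insertE; simp add: meridian_preimage_def[abs_def] unfold_t)
      (intro formal_sums_add formal_sums_diff formal_sums_scale E; simp add: arcs_trefoil ts length_diagrams)+
  have membership: "w \<in> R" if "v \<in> R" "\<And>b. w b = v b" for v w :: "position \<Rightarrow> laurent" and R
    using that by (metis ext)
  define G where "G = (\<lambda>(k, l, m) b. (1 - tvar (arc_component l)) * meridian_image k b +
    tvar (arc_component k) * meridian_image m b - meridian_image l b)"
  have G1: "G ((1, 5/2), (0, 19/3), (0, 1/2)) \<in> relations ?D'"
    by (rule membership[OF r_mem(1)]) (simp add: G_def meridian_image_def r_defs simps algebra_simps)
  have G2: "G ((0, 1/2), (0, 7/2), (0, 14/3)) \<in> relations ?D'"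
    by (rule membership[OF r_mem(2)]) (simp add: G_def meridian_image_def r_defs simps algebra_simps)
  have G3: "G ((0, 14/3), (0, 1/2), (0, 5/2)) \<in> relations ?D'"
    by (rule membership[OF r_mem(3)]) (simp add: G_def meridian_image_def r_defs simps algebra_simps)
  have G4: "G ((1, 5/2), (0, 7/2), (0, 5/2)) \<in> relations ?D'"
    by (rule membership[OF r_mem(4)]) (simp add: G_def meridian_image_def r_defs simps algebra_simps)
  have G5: "G ((0, 7/2), (0, 14/3), (0, 19/3)) \<in> relations ?D'"
    by (rule membership[OF r_mem(5)]) (simp add: G_def meridian_image_def r_defs simps algebra_simps)
  have G6: "G ((0, 7/2), (1, 5/2), (1, 7/3)) \<in> relations ?D'"
    by (rule membership[OF r_mem(6)]) (simp add: G_def meridian_image_def r_defs simps algebra_simps)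
  have G7: "G ((0, 19/3), (1, 5/2), (1, 7/3)) \<in> relations ?D'"
    by (rule membership[OF r_mem(7)]) (simp add: G_def meridian_image_def r_defs simps algebra_simps)
  define H where "H = (\<lambda>(k, l, m) b. (1 - tvar (arc_component l)) * meridian_preimage k b +
    tvar (arc_component k) * meridian_preimage m b - meridian_preimage l b)"
  have H1: "H ((1, 5/2), (0, 14/3), (0, 1/2)) \<in> relations ?D"
    by (rule membership[OF q_mem(1)]) (simp add: H_def meridian_preimage_def q_defs simps algebra_simps)
  have H2: "H ((0, 1/2), (0, 9/2), (0, 14/3)) \<in> relations ?D"
    by (rule membership[OF q_mem(2)]) (simp add: H_def meridian_preimage_def q_defs simps algebra_simps)
  have H3: "H ((0, 14/3), (0, 1/2), (0, 5/2)) \<in> relations ?D"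
    by (rule membership[OF q_mem(3)]) (simp add: H_def meridian_preimage_def q_defs simps algebra_simps)
  have H4: "H ((1, 5/2), (0, 7/2), (0, 5/2)) \<in> relations ?D"
    by (rule membership[OF q_mem(4)]) (simp add: H_def meridian_preimage_def q_defs simps algebra_simps)
  have H5: "H ((0, 14/3), (0, 9/2), (0, 7/2)) \<in> relations ?D"
    by (rule membership[OF q_mem(5)]) (simp add: H_def meridian_preimage_def q_defs simps algebra_simps)
  have H6: "H ((0, 7/2), (1, 5/2), (1, 7/3)) \<in> relations ?D"
    by (rule membership[OF q_mem(6)]) (simp add: H_def meridian_preimage_def q_defs simps algebra_simps)
  have H7: "H ((0, 14/3), (1, 5/2), (1, 7/3)) \<in> relations ?D"
    by (rule membership[OF q_mem(7)]) (simp add: H_def meridian_preimage_def q_defs simps algebra_simps)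
  have G: "G p \<in> relations ?D'" if "p \<in> crossing_arcs ?D ` crossings ?D" for p
    using that unfolding crossing_arcs_trefoil by (elim insertE emptyE) (simp_all only: G1 G2 G3 G4 G5 G6 G7)
  have H: "H p \<in> relations ?D" if "p \<in> crossing_arcs ?D' ` crossings ?D'" for p
    using that unfolding crossing_arcs_unknot by (elim insertE emptyE) (simp_all only: H1 H2 H3 H4 H5 H6 H7)
  have G_crossing: "(\<lambda>b. (1 - tvar (arc_component (left_arc ?D c))) * meridian_image (over_arc ?D c) b +
      tvar (arc_component (over_arc ?D c)) * meridian_image (right_arc ?D c) b - meridian_image (left_arc ?D c) b) \<in> relations ?D'"
    if "c \<in> crossings ?D" for c
    using G[OF imageI[OF that]] by (simp add: G_def crossing_arcs_def)
  have H_crossing: "(\<lambda>b. (1 - tvar (arc_component (left_arc ?D' c))) * meridian_preimage (over_arc ?D' c) b +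
      tvar (arc_component (over_arc ?D' c)) * meridian_preimage (right_arc ?D' c) b - meridian_preimage (left_arc ?D' c) b) \<in> relations ?D"
    if "c \<in> crossings ?D'" for c
    using H[OF imageI[OF that]] by (simp add: H_def crossing_arcs_def)
  obtain g where g: "semilinear ?D ?D' (\<lambda>p. p) g"
    and g_sum: "\<And>v. v \<in> formal_sums ?D \<Longrightarrow> g (\<gamma> ?D v) = \<gamma> ?D' (\<lambda>b. \<Sum>a\<in>arcs ?D. v a * meridian_image a b)"
    and g_meridian: "\<And>a. a \<in> arcs ?D \<Longrightarrow> g (meridian ?D a) = \<gamma> ?D' (meridian_image a)"
    by (rule semilinear_extension_formal_sums[OF trefoil.finite_diagram_axioms unknot.finite_diagram_axioms id(1),
          where \<psi> = meridian_image]) (rule image G_crossing that; assumption)+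
  obtain h where h: "semilinear ?D' ?D (\<lambda>p. p) h"
    and h_sum: "\<And>v. v \<in> formal_sums ?D' \<Longrightarrow> h (\<gamma> ?D' v) = \<gamma> ?D (\<lambda>b. \<Sum>a\<in>arcs ?D'. v a * meridian_preimage a b)"
    and h_meridian: "\<And>a. a \<in> arcs ?D' \<Longrightarrow> h (meridian ?D' a) = \<gamma> ?D (meridian_preimage a)"
    by (rule semilinear_extension_formal_sums[OF unknot.finite_diagram_axioms trefoil.finite_diagram_axioms id(2),
          where \<psi> = meridian_preimage]) (rule preimage H_crossing that; assumption)+
  have HG1: "(\<lambda>b. (\<Sum>x\<in>arcs ?D'. meridian_image (0, 1/2) x * meridian_preimage x b) - basis_vector (0, 1/2) b) \<in> relations ?D"
    by (rule membership[OF trefoil.relations_0]) (simp add: arcs_unknot meridian_image_def meridian_preimage_def basis_vector_pair q_defs simps algebra_simps)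
  have HG2: "(\<lambda>b. (\<Sum>x\<in>arcs ?D'. meridian_image (0, 5/2) x * meridian_preimage x b) - basis_vector (0, 5/2) b) \<in> relations ?D"
    by (rule membership[OF trefoil.relations_0]) (simp add: arcs_unknot meridian_image_def meridian_preimage_def basis_vector_pair q_defs simps algebra_simps)
  have HG3: "(\<lambda>b. (\<Sum>x\<in>arcs ?D'. meridian_image (0, 7/2) x * meridian_preimage x b) - basis_vector (0, 7/2) b) \<in> relations ?D"
    by (rule membership[OF trefoil.relations_0]) (simp add: arcs_unknot meridian_image_def meridian_preimage_def basis_vector_pair q_defs simps algebra_simps)
  have HG4: "(\<lambda>b. (\<Sum>x\<in>arcs ?D'. meridian_image (0, 14/3) x * meridian_preimage x b) - basis_vector (0, 14/3) b) \<in> relations ?D"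
    by (rule membership[OF trefoil.relations_0]) (simp add: arcs_unknot meridian_image_def meridian_preimage_def basis_vector_pair q_defs simps algebra_simps)
  have HG5: "(\<lambda>b. (\<Sum>x\<in>arcs ?D'. meridian_image (0, 19/3) x * meridian_preimage x b) - basis_vector (0, 19/3) b) \<in> relations ?D"
    by (rule membership[OF q_mem(8)]) (simp add: arcs_unknot meridian_image_def meridian_preimage_def basis_vector_pair q_defs simps algebra_simps)
  have HG6: "(\<lambda>b. (\<Sum>x\<in>arcs ?D'. meridian_image (1, 7/3) x * meridian_preimage x b) - basis_vector (1, 7/3) b) \<in> relations ?D"
    by (rule membership[OF q_mem(10)]) (simp add: arcs_unknot meridian_image_def meridian_preimage_def basis_vector_pair q_defs simps algebra_simps)
  have HG7: "(\<lambda>b. (\<Sum>x\<in>arcs ?D'. meridian_image (1, 5/2) x * meridian_preimage x b) - basis_vector (1, 5/2) b) \<in> relations ?D"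
    by (rule membership[OF q_mem(9)]) (simp add: arcs_unknot meridian_image_def meridian_preimage_def basis_vector_pair q_defs simps algebra_simps)
  have GH1: "(\<lambda>b. (\<Sum>x\<in>arcs ?D. meridian_preimage (0, 1/2) x * meridian_image x b) - basis_vector (0, 1/2) b) \<in> relations ?D'"
    by (rule membership[OF unknot.relations_0]) (simp add: arcs_trefoil meridian_preimage_def meridian_image_def basis_vector_pair r_defs simps algebra_simps)
  have GH2: "(\<lambda>b. (\<Sum>x\<in>arcs ?D. meridian_preimage (0, 5/2) x * meridian_image x b) - basis_vector (0, 5/2) b) \<in> relations ?D'"
    by (rule membership[OF unknot.relations_0]) (simp add: arcs_trefoil meridian_preimage_def meridian_image_def basis_vector_pair r_defs simps algebra_simps)
  have GH3: "(\<lambda>b. (\<Sum>x\<in>arcs ?D. meridian_preimage (0, 7/2) x * meridian_image x b) - basis_vector (0, 7/2) b) \<in> relations ?D'"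
    by (rule membership[OF r_mem(8)]) (simp add: arcs_trefoil meridian_preimage_def meridian_image_def basis_vector_pair r_defs simps algebra_simps)
  have GH4: "(\<lambda>b. (\<Sum>x\<in>arcs ?D. meridian_preimage (0, 9/2) x * meridian_image x b) - basis_vector (0, 9/2) b) \<in> relations ?D'"
    by (rule membership[OF unknot.relations_0]) (simp add: arcs_trefoil meridian_preimage_def meridian_image_def basis_vector_pair r_defs simps algebra_simps)
  have GH5: "(\<lambda>b. (\<Sum>x\<in>arcs ?D. meridian_preimage (0, 14/3) x * meridian_image x b) - basis_vector (0, 14/3) b) \<in> relations ?D'"
    by (rule membership[OF unknot.relations_0]) (simp add: arcs_trefoil meridian_preimage_def meridian_image_def basis_vector_pair r_defs simps algebra_simps)
  have GH6: "(\<lambda>b. (\<Sum>x\<in>arcs ?D. meridian_preimage (1, 7/3) x * meridian_image x b) - basis_vector (1, 7/3) b) \<in> relations ?D'"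
    by (rule membership[OF r_mem(10)]) (simp add: arcs_trefoil meridian_preimage_def meridian_image_def basis_vector_pair r_defs simps algebra_simps)
  have GH7: "(\<lambda>b. (\<Sum>x\<in>arcs ?D. meridian_preimage (1, 5/2) x * meridian_image x b) - basis_vector (1, 5/2) b) \<in> relations ?D'"
    by (rule membership[OF r_mem(9)]) (simp add: arcs_trefoil meridian_preimage_def meridian_image_def basis_vector_pair r_defs simps algebra_simps)
  show ?thesis
  proof (rule crowell_equivalentI[OF trefoil.finite_diagram_axioms unknot.finite_diagram_axioms _ g h])
    show "length ?D = length ?D'" by (simp add: length_diagrams)
    fix a assume a: "a \<in> arcs ?D"
    have "(\<lambda>b. (\<Sum>x\<in>arcs ?D'. meridian_image a x * meridian_preimage x b) - basis_vector a b) \<in> relations ?D"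
      using a unfolding arcs_trefoil by (elim insertE emptyE) (simp_all only: HG1 HG2 HG3 HG4 HG5 HG6 HG7)
    then show "h (g (meridian ?D a)) = meridian ?D a"
      using a by (simp only: g_meridian h_sum[OF image] trefoil.\<gamma>_eq_iff)
    show "\<phi> ?D' (g (meridian ?D a)) = tvar (arc_component a) - 1"
      unfolding g_meridian[OF a] unknot.\<phi>_\<gamma> augment_def
      using a unfolding arcs_trefoil
      by (elim insertE emptyE; simp add: arcs_unknot meridian_image_def basis_vector_pair unfold_t algebra_simps)
  next
    fix a assume a: "a \<in> arcs ?D'"
    have "(\<lambda>b. (\<Sum>x\<in>arcs ?D. meridian_preimage a x * meridian_image x b) - basis_vector a b) \<in> relations ?D'"
      using a unfolding arcs_unknot by (elim insertE emptyE) (simp_all only: GH1 GH2 GH3 GH4 GH5 GH6 GH7)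
    then show "g (h (meridian ?D' a)) = meridian ?D' a"
      using a by (simp only: h_meridian g_sum[OF preimage] unknot.\<gamma>_eq_iff)
  qed
qed

section \<open>The quandles of the two links are not isomorphic\<close>

text \<open>
  The value at \<open>-1\<close> for the variable of the knot and \<open>1\<close> for the variable of the circle. With these values
  and modulo \<open>3\<close>, the crossing relations become those of Fox 3-colourings of the knot, for which the
  circle is transparent.
\<close>

definition sign_value :: "laurent \<Rightarrow> int"
  where "sign_value = evaluate (\<lambda>m. if even (Poly_Mapping.lookup m 0) then 1 else - 1)"

lemma sign_value_mult: "sign_value (p * q) = sign_value p * sign_value q"
  unfolding sign_value_def by (rule evaluate_mult) (simp add: lookup_add)

lemma sign_value_simps [simp]:
  "sign_value 0 = 0" "sign_value 1 = 1" "sign_value (p + q) = sign_value p + sign_value q"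
  "sign_value (p - q) = sign_value p - sign_value q" "sign_value (- p) = - sign_value p"
  "sign_value (sum g A) = (\<Sum>a\<in>A. sign_value (g a))"
  by (simp_all add: sign_value_def evaluate_1 evaluate_add evaluate_diff evaluate_uminus evaluate_sum)

lemma sign_value_tvar [simp]:
  "sign_value (tvar i) = (if i = 0 then - 1 else 1)"
  "sign_value (tvar_inverse i) = (if i = 0 then - 1 else 1)"
  by (simp_all add: sign_value_def tvar_def tvar_inverse_def lookup_single when_def)

text \<open>
  The 3-colouring of the trefoil by its three arcs; these are cut into five by passing under the circle.
\<close>

definition arc_colour :: "position \<Rightarrow> int"
  where "arc_colour a = (if a = (0, 5/2) \<or> a = (0, 7/2) then 2 else if a = (0, 14/3) then 1 else 0)"

definition colour_sum :: "(position \<Rightarrow> laurent) \<Rightarrow> int"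
  where "colour_sum v = (\<Sum>a\<in>arcs trefoil_diagram. sign_value (v a) * arc_colour a)"

text \<open>
  All representatives of a class have the same value, because the relations have values divisible by
  \<open>3\<close>.
\<close>

definition colour :: "alexander_element \<Rightarrow> int"
  where "colour X = colour_sum (SOME v. v \<in> X) mod 3"

lemma colour_sum_simps:
  "colour_sum (\<lambda>a. v a + w a) = colour_sum v + colour_sum w"
  "colour_sum (\<lambda>a. v a - w a) = colour_sum v - colour_sum w"
  "colour_sum (\<lambda>a. r * v a) = sign_value r * colour_sum v"
  by (simp_all add: colour_sum_def sign_value_mult ring_distribs sum.distrib sum_subtractf sum_distrib_left mult_ac)

lemma colour_sum_basis_vector: "a \<in> arcs trefoil_diagram \<Longrightarrow> colour_sum (basis_vector a) = arc_colour a"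
  using trefoil.finite_arcs
  by (simp add: colour_sum_def basis_vector_def if_distrib[of sign_value] if_distrib[of "\<lambda>x. x * _"] cong: if_cong)

lemma colour_sum_crossing_vector:
  assumes "p \<in> crossing_arcs trefoil_diagram ` crossings trefoil_diagram"
  shows "3 dvd colour_sum (crossing_vector p)"
proof -
  have *: "colour_sum (crossing_vector (k, l, m)) =
      sign_value (1 - tvar (arc_component l)) * arc_colour k + sign_value (tvar (arc_component k)) * arc_colour m - arc_colour l"
    if "k \<in> arcs trefoil_diagram" "l \<in> arcs trefoil_diagram" "m \<in> arcs trefoil_diagram" for k l m
    unfolding crossing_vector_def prod.case colour_sum_simps using that by (simp only: colour_sum_basis_vector)
  show ?thesis
    using assms unfolding crossing_arcs_trefoil
    by (elim insertE emptyE) (simp_all add: * arcs_trefoil arc_colour_def)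
qed

lemma colour_sum_relations:
  assumes "v \<in> relations trefoil_diagram" shows "3 dvd colour_sum v"
proof -
  obtain w where v: "v = \<rho> trefoil_diagram w" using assms by blast
  have "colour_sum v = (\<Sum>c\<in>crossings trefoil_diagram. sign_value (w c) * colour_sum (crossing_relation trefoil_diagram c))"
    unfolding v \<rho>_def colour_sum_def
    by (simp add: sign_value_mult sum_distrib_left sum_distrib_right mult.assoc) (rule sum.swap)
  moreover have "3 dvd colour_sum (crossing_relation trefoil_diagram c)" if "c \<in> crossings trefoil_diagram" for c
  proof -
    have "crossing_relation trefoil_diagram c = crossing_vector (crossing_arcs trefoil_diagram c)"
      by (simp add: crossing_relation_def[abs_def] crossing_vector_def crossing_arcs_def)
    then show ?thesis using colour_sum_crossing_vector[OF imageI[OF that]] by simp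
  qed
  ultimately show ?thesis by (simp add: dvd_sum)
qed

lemma colour_\<gamma>: "colour (\<gamma> trefoil_diagram v) = colour_sum v mod 3"
proof -
  let ?w = "SOME w. w \<in> \<gamma> trefoil_diagram v"
  have "?w \<in> \<gamma> trefoil_diagram v" by (rule someI[of _ v]) (rule trefoil.self_in_\<gamma>)
  then have "3 dvd colour_sum (\<lambda>a. ?w a - v a)" by (intro colour_sum_relations) (simp add: trefoil.\<gamma>_eq)
  then have "colour_sum ?w mod 3 = colour_sum v mod 3" unfolding colour_sum_simps by (simp add: mod_eq_dvd_iff)
  then show ?thesis by (simp only: colour_def)
qed

lemma colour_range: "0 \<le> colour x" "colour x < 3"
  by (simp_all add: colour_def)

lemma colour_meridian: "a \<in> arcs trefoil_diagram \<Longrightarrow> colour (meridian trefoil_diagram a) = arc_colour a"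
  by (simp add: colour_\<gamma> colour_sum_basis_vector) (simp add: arc_colour_def)

lemma colour_tri:
  assumes "x \<in> elements trefoil_diagram" "y \<in> elements trefoil_diagram"
  shows "colour (tri trefoil_diagram x y) =
    (sign_value (\<phi> trefoil_diagram y + 1) * colour x - sign_value (\<phi> trefoil_diagram x) * colour y) mod 3"
proof -
  obtain v w where vw: "v \<in> formal_sums trefoil_diagram" "w \<in> formal_sums trefoil_diagram"
    "x = \<gamma> trefoil_diagram v" "y = \<gamma> trefoil_diagram w" using assms by (auto simp: trefoil.elements_eq)
  show ?thesis
    unfolding vw(3,4) trefoil.tri_\<gamma>[OF vw(1,2)] colour_\<gamma> colour_sum_simps trefoil.\<phi>_\<gamma>
    by (intro mod_diff_cong mod_mult_cong refl) (simp_all only: mod_mod_trivial)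
qed

lemma colour_tri_inv:
  assumes "x \<in> elements trefoil_diagram" "y \<in> elements trefoil_diagram"
    and i: "\<phi> trefoil_diagram y = tvar i - 1" "i < length trefoil_diagram"
  shows "colour (tri_inv trefoil_diagram x y) =
    (sign_value (tvar_inverse i) * (colour x + sign_value (\<phi> trefoil_diagram x) * colour y)) mod 3"
proof -
  obtain v w where vw: "v \<in> formal_sums trefoil_diagram" "w \<in> formal_sums trefoil_diagram"
    "x = \<gamma> trefoil_diagram v" "y = \<gamma> trefoil_diagram w" using assms by (auto simp: trefoil.elements_eq)
  have "augment trefoil_diagram v \<in> scalars (length trefoil_diagram)" using vw by (simp add: trefoil.augment_in_scalars)
  then have "tri_inv trefoil_diagram x y =
    \<gamma> trefoil_diagram (\<lambda>a. tvar_inverse i * (v a + augment trefoil_diagram v * w a))"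
    unfolding trefoil.tri_inv_eq[OF i] using vw i(2)
    by (simp add: trefoil.\<phi>_\<gamma> trefoil.\<gamma>_scale trefoil.\<gamma>_add)
  then show ?thesis
    unfolding vw(3,4) by (simp only: colour_\<gamma> colour_sum_simps trefoil.\<phi>_\<gamma>)
      (intro mod_mult_cong mod_add_cong refl; simp only: mod_mod_trivial)
qed

lemma colour_circle:
  assumes "x \<in> Q\<^sub>A trefoil_diagram" "component trefoil_diagram x \<noteq> 0"
  shows "colour x = 0"
  using assms
proof induction
  case (arc a)
  then show ?case by (auto simp: trefoil.component_meridian colour_meridian arc_colour_def)
next
  case (tri x y)
  then show ?case
    by (simp add: trefoil.component_tri colour_tri trefoil.quandle_in_elements trefoil.\<phi>_quandle[of x])
next
  case (tri_inv x y)
  then show ?case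
    by (simp add: trefoil.component_tri_inv trefoil.\<phi>_quandle[of x]
        colour_tri_inv[OF _ _ trefoil.\<phi>_quandle trefoil.component_less] trefoil.quandle_in_elements)
qed

text \<open>
  On the knot the quandle operations act on colours by the reflections of the dihedral quandle of order
  \<open>3\<close>, which are involutions, and the circle acts trivially.
\<close>

lemma colour_knot:
  assumes "x \<in> Q\<^sub>A trefoil_diagram" "component trefoil_diagram x = 0" "y \<in> Q\<^sub>A trefoil_diagram"
    and "z = tri trefoil_diagram x y \<or> z = tri_inv trefoil_diagram x y"
  shows "colour z = (if component trefoil_diagram y = 0 then (2 * colour y - colour x) mod 3 else colour x)"
proof -
  have "colour x mod 3 = colour x" using colour_range by simp
  then show ?thesis
    using assms(4)
  proof (elim disjE)
    assume "z = tri trefoil_diagram x y"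
    then show ?thesis
      using assms(1-3) \<open>colour x mod 3 = colour x\<close> colour_circle[of y]
      by (simp add: colour_tri trefoil.quandle_in_elements trefoil.\<phi>_quandle)
  next
    assume "z = tri_inv trefoil_diagram x y"
    then show ?thesis
      using assms(1-3) \<open>colour x mod 3 = colour x\<close> colour_circle[of y]
      by (simp add: colour_tri_inv[OF _ _ trefoil.\<phi>_quandle trefoil.component_less] trefoil.quandle_in_elements
          trefoil.\<phi>_quandle[of x] algebra_simps)
  qed
qed

lemma (in finite_diagram) meridian_left:
  assumes "(k, l, m) \<in> crossing_arcs D ` crossings D"
  shows "meridian D l = tri D (meridian D m) (meridian D k)"
  using assms \<gamma>_left_arc by (auto simp: crossing_arcs_def)

lemma crossing_arcs_unknotI:
  "((1, 5/2), (0, 14/3), (0, 1/2)) \<in> crossing_arcs unknot_diagram ` crossings unknot_diagram"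
  "((0, 1/2), (0, 9/2), (0, 14/3)) \<in> crossing_arcs unknot_diagram ` crossings unknot_diagram"
  "((0, 14/3), (0, 1/2), (0, 5/2)) \<in> crossing_arcs unknot_diagram ` crossings unknot_diagram"
  "((1, 5/2), (0, 7/2), (0, 5/2)) \<in> crossing_arcs unknot_diagram ` crossings unknot_diagram"
  "((0, 7/2), (1, 5/2), (1, 7/3)) \<in> crossing_arcs unknot_diagram ` crossings unknot_diagram"
  by (simp_all add: crossing_arcs_unknot)

lemma not_quandle_isomorphic_trefoil_unknot: "\<not> quandle_isomorphic trefoil_diagram unknot_diagram"
proof
  let ?D = trefoil_diagram and ?D' = unknot_diagram
  assume iso: "quandle_isomorphic ?D ?D'"
  obtain f f' where f: "\<And>x. x \<in> Q\<^sub>A ?D \<Longrightarrow> f x \<in> Q\<^sub>A ?D'" and f': "\<And>x. x \<in> Q\<^sub>A ?D' \<Longrightarrow> f' x \<in> Q\<^sub>A ?D"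
    and ff': "\<And>x. x \<in> Q\<^sub>A ?D' \<Longrightarrow> f (f' x) = x" and f'f: "\<And>x. x \<in> Q\<^sub>A ?D \<Longrightarrow> f' (f x) = x"
    and tri': "\<And>x y. x \<in> Q\<^sub>A ?D' \<Longrightarrow> y \<in> Q\<^sub>A ?D' \<Longrightarrow> f' (tri ?D' x y) = tri ?D (f' x) (f' y)"
    and tri_inv': "\<And>x y. x \<in> Q\<^sub>A ?D' \<Longrightarrow> y \<in> Q\<^sub>A ?D' \<Longrightarrow> f' (tri_inv ?D' x y) = tri_inv ?D (f' x) (f' y)"
    and inv: "\<And>x y. x \<in> Q\<^sub>A ?D \<Longrightarrow> y \<in> Q\<^sub>A ?D \<Longrightarrow> component ?D x = component ?D y \<Longrightarrow>
      component ?D' (f x) = component ?D' (f y)"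
    and inv': "\<And>x y. x \<in> Q\<^sub>A ?D' \<Longrightarrow> y \<in> Q\<^sub>A ?D' \<Longrightarrow> component ?D' x = component ?D' y \<Longrightarrow>
      component ?D (f' x) = component ?D (f' y)"
    by (rule quandle_isomorphicE[OF trefoil.finite_diagram_axioms unknot.finite_diagram_axioms iso])
      (rule that; assumption)
  define m where "m = meridian ?D (0, 1/2)"
  define m2 where "m2 = meridian ?D (0, 5/2)"
  have arcs: "(0, 1/2) \<in> arcs ?D" "(0, 5/2) \<in> arcs ?D" by (simp_all add: arcs_trefoil)
  have m: "m \<in> Q\<^sub>A ?D" "component ?D m = 0" and m2: "m2 \<in> Q\<^sub>A ?D" "component ?D m2 = 0"
    using arcs by (simp_all add: m_def m2_def Q\<^sub>A.arc trefoil.component_meridian)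
  \<comment> \<open>The component of the second link that corresponds to the trefoil.\<close>
  define j where "j = component ?D' (f m)"
  define k where "k x = colour (f' x)" for x
  have j: "component ?D (f' y) = 0 \<longleftrightarrow> component ?D' y = j" if "y \<in> Q\<^sub>A ?D'" for y
    using inv[OF f'[OF that] m(1)] inv'[OF that f[OF m(1)]] m that by (auto simp: j_def ff' f'f)
  have k: "k z = (if component ?D' y = j then (2 * k y - k x) mod 3 else k x)"
    if "x \<in> Q\<^sub>A ?D'" "component ?D' x = j" "y \<in> Q\<^sub>A ?D'" "z = tri ?D' x y \<or> z = tri_inv ?D' x y" for x y z
  proof -
    have "f' z = tri ?D (f' x) (f' y) \<or> f' z = tri_inv ?D (f' x) (f' y)"
      using that tri' tri_inv' by blast
    from colour_knot[OF f'[OF that(1)] _ f'[OF that(3)] this] show ?thesis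
      using that by (simp add: j k_def)
  qed
  have range: "0 \<le> k x" "k x < 3" for x by (simp_all add: k_def colour_range)
  have crossing: "k (meridian ?D' b) = (if arc_component a = j then (2 * k (meridian ?D' a) - k (meridian ?D' c)) mod 3
      else k (meridian ?D' c))"
    if "(a, b, c) \<in> crossing_arcs ?D' ` crossings ?D'" "arc_component c = j" for a b c
  proof -
    have "a \<in> arcs ?D'" "c \<in> arcs ?D'" using that(1) by (auto simp: crossing_arcs_def)
    then show ?thesis
      using k[of "meridian ?D' c" "meridian ?D' a" "meridian ?D' b"] that unknot.meridian_left[OF that(1)]
      by (simp add: Q\<^sub>A.arc unknot.component_meridian)
  qed
  have crossing_same: "k (meridian ?D' b) = (2 * k (meridian ?D' a) - k (meridian ?D' c)) mod 3"
    if "(a, b, c) \<in> crossing_arcs ?D' ` crossings ?D'" "arc_component c = j" "arc_component a = j" for a b c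
    unfolding crossing[OF that(1,2)] if_P[OF that(3)] ..
  have crossing_other: "k (meridian ?D' b) = k (meridian ?D' c)"
    if "(a, b, c) \<in> crossing_arcs ?D' ` crossings ?D'" "arc_component c = j" "arc_component a \<noteq> j" for a b c
    unfolding crossing[OF that(1,2)] if_not_P[OF that(3)] ..
  \<comment> \<open>Both components of the second link are unknots, so their colourings are constant.\<close>
  have "\<exists>\<kappa>. \<forall>a\<in>arcs ?D'. arc_component a = j \<longrightarrow> k (meridian ?D' a) = \<kappa>"
  proof -
    have "j < 2" using unknot.component_less[OF f[OF m(1)]] by (simp add: j_def length_diagrams)
    then consider "j = 0" | "j = 1" by linarith
    then show ?thesis
    proof cases
      case 1
      let ?k = "\<lambda>u. k (meridian ?D' (0, u))"
      have fixed: "q = p" if p: "p = (2 * p - q) mod 3" and "0 \<le> q" "q < 3" for p q :: int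
      proof -
        have "0 \<le> p" "p < 3" using pos_mod_bound[of 3 "2 * p - q"] pos_mod_sign[of 3 "2 * p - q"] p by linarith+
        moreover from this have "p mod 3 = (2 * p - q) mod 3" using p by simp
        then have "3 dvd q - p" by (simp add: mod_eq_dvd_iff)
        then obtain r where r: "q - p = 3 * r" ..
        ultimately have "- 1 < r" "r < 1" using \<open>0 \<le> q\<close> \<open>q < 3\<close> by linarith+
        then show ?thesis using r by simp
      qed
      have k1: "?k (14/3) = ?k (1/2)"
        by (rule crossing_other[OF crossing_arcs_unknotI(1)]) (simp_all add: \<open>j = 0\<close>)
      have "?k (9/2) = (2 * ?k (1/2) - ?k (14/3)) mod 3"
        by (rule crossing_same[OF crossing_arcs_unknotI(2)]) (simp_all add: \<open>j = 0\<close>)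
      then have k2: "?k (9/2) = ?k (1/2)"
        unfolding k1 using mod_pos_pos_trivial[OF range] by simp
      have "?k (1/2) = (2 * ?k (14/3) - ?k (5/2)) mod 3"
        by (rule crossing_same[OF crossing_arcs_unknotI(3)]) (simp_all add: \<open>j = 0\<close>)
      then have k3: "?k (5/2) = ?k (1/2)"
        unfolding k1 using range by (rule fixed)
      have k4: "?k (7/2) = ?k (1/2)"
        unfolding k3[symmetric]
        by (rule crossing_other[OF crossing_arcs_unknotI(4)]) (simp_all add: \<open>j = 0\<close>)
      have "k (meridian ?D' a) = ?k (1/2)" if "a \<in> arcs ?D'" "arc_component a = j" for a
        using that unfolding arcs_unknot \<open>j = 0\<close>
        by (elim insertE emptyE) (simp_all only: k1 k2 k3 k4 fst_conv one_neq_zero)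
      then show ?thesis by blast
    next
      case 2
      have "k (meridian ?D' (1, 5/2)) = k (meridian ?D' (1, 7/3))"
        by (rule crossing_other[OF crossing_arcs_unknotI(5)]) (simp_all add: \<open>j = 1\<close>)
      then show ?thesis using 2 by (intro exI[of _ "k (meridian ?D' (1, 7/3))"]) (auto simp: arcs_unknot)
    qed
  qed
  then obtain \<kappa> where \<kappa>: "\<And>a. a \<in> arcs ?D' \<Longrightarrow> arc_component a = j \<Longrightarrow> k (meridian ?D' a) = \<kappa>" by blast
  have const: "k x = \<kappa>" if "x \<in> Q\<^sub>A ?D'" "component ?D' x = j" for x
    using that
  proof induction
    case (arc a)
    then show ?case by (simp add: \<kappa> unknot.component_meridian)
  next
    case (tri x y)
    then have "k x = \<kappa>" "component ?D' y = j \<Longrightarrow> k y = \<kappa>" by (simp_all add: unknot.component_tri)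
    then show ?case
      using k[of x y "tri ?D' x y"] tri range[of x] by (auto simp: unknot.component_tri)
  next
    case (tri_inv x y)
    then have "k x = \<kappa>" "component ?D' y = j \<Longrightarrow> k y = \<kappa>" by (simp_all add: unknot.component_tri_inv)
    then show ?case
      using k[of x y "tri_inv ?D' x y"] tri_inv range[of x] by (auto simp: unknot.component_tri_inv)
  qed
  have "colour m = \<kappa>" "colour m2 = \<kappa>"
    using const[OF f[OF m(1)]] const[OF f[OF m2(1)]] inv[OF m2(1) m(1)] m m2 by (simp_all add: k_def f'f j_def)
  then show False
    using arcs by (simp add: m_def m2_def colour_meridian arc_colour_def)
qed

section \<open>The module sequence is strictly weaker than the quandle\<close>

theorem corollary6:
  shows
    "(\<forall>L L' D D'.
        classical_link L \<and> classical_link L' \<and> diagram_of D L \<and> diagram_of D' L' \<and>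
        quandle_isomorphic D D' \<longrightarrow>
        (\<exists>\<sigma> \<tau>. \<sigma> permutes {..<length L} \<and> \<tau> permutes {..<length L'} \<and>
          diagram_of (permute_list \<sigma> D) (permute_list \<sigma> L) \<and>
          diagram_of (permute_list \<tau> D') (permute_list \<tau> L') \<and>
          crowell_equivalent (permute_list \<sigma> D) (permute_list \<tau> D')))
     \<and>
     (\<exists>L L' D D'.
        classical_link L \<and> classical_link L' \<and> diagram_of D L \<and> diagram_of D' L' \<and>
        crowell_equivalent D D' \<and> \<not> quandle_isomorphic D D')"
proof (rule conjI)
  have "\<exists>\<sigma> \<tau>. \<sigma> permutes {..<length L} \<and> \<tau> permutes {..<length L'} \<and>
          diagram_of (permute_list \<sigma> D) (permute_list \<sigma> L) \<and>
          diagram_of (permute_list \<tau> D') (permute_list \<tau> L') \<and>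
          crowell_equivalent (permute_list \<sigma> D) (permute_list \<tau> D')"
    if DL: "diagram_of D L" and DL': "diagram_of D' L'" and iso: "quandle_isomorphic D D'"
    for L L' D D'
  proof -
    have "polygonal_link D" "finite (crossings D)" "polygonal_link D'" "finite (crossings D')"
      using DL DL' by (auto simp: diagram_of_def regular_position_def)
    from quandle_isomorphic_imp_crowell_equivalent[OF this iso]
    obtain \<tau> where \<tau>: "\<tau> permutes {..<length D'}" "crowell_equivalent D (permute_list \<tau> D')" by metis
    have "length L' = length D'" using DL' by (simp add: diagram_of_def isotopic_to_polygons_def)
    moreover have "diagram_of (permute_list \<tau> D') (permute_list \<tau> L')"
      using \<tau>(1) DL' by (intro permuted_diagram.diagram_of_P) (simp add: permuted_diagram_def)
    ultimately show ?thesis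
      using \<tau> DL by (intro exI[of _ id] exI[of _ \<tau>]) (simp add: permutes_id)
  qed
  then show "\<forall>L L' D D'.
        classical_link L \<and> classical_link L' \<and> diagram_of D L \<and> diagram_of D' L' \<and>
        quandle_isomorphic D D' \<longrightarrow>
        (\<exists>\<sigma> \<tau>. \<sigma> permutes {..<length L} \<and> \<tau> permutes {..<length L'} \<and>
          diagram_of (permute_list \<sigma> D) (permute_list \<sigma> L) \<and>
          diagram_of (permute_list \<tau> D') (permute_list \<tau> L') \<and>
          crowell_equivalent (permute_list \<sigma> D) (permute_list \<tau> D'))"
    by blast
  show "\<exists>L L' D D'.
        classical_link L \<and> classical_link L' \<and> diagram_of D L \<and> diagram_of D' L' \<and>
        crowell_equivalent D D' \<and> \<not> quandle_isomorphic D D'"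
    using trefoil_diagram unknot_diagram classical_link_of diagram_of_link_of
      crowell_equivalent_trefoil_unknot not_quandle_isomorphic_trefoil_unknot
    by blast
qed

end
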